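(* Let $(M,g)$ be a transverse Riemann-Lorentz space with tangent radical, singular hypersurface $\Sigma$ and canonical screen distribution $S$. Let $\nabla$ be the Levi-Civita connection on $M-\Sigma$. Let $\mathcal A,\mathcal B\in\mathfrak{X}(M)$, with restrictions $A=\mathcal A|_\Sigma$, $B=\mathcal B|_\Sigma$. (a) $\nabla_{\mathcal A^o}\mathcal B^o\cong0$ if and only if $II(A,B)=0$. (b) The following two assertions are equivalent: (1) $\nabla_{\mathcal A^o}\mathcal B^o\cong0$ whenever $\mathcal A,\mathcal B$ are tangent to $\Sigma$; (2) $\Sigma$ is $II$-flat. Let now $A,B\in\mathfrak{X}_\Sigma$. (c) $\nabla_AB$ is not well-defined whenever one of the vector fields $A,B$ is either $N$ or $R$. (d) The following two assertions are equivalent: (1) $\nabla_AB$ is well-defined whenever $A,B\in\Gamma(S)$; (2) $\Sigma$ is $II$-flat.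
   Context: $M$ is a connected smooth manifold of dimension $m>2$ with a smooth symmetric $(0,2)$-tensor field $g=\langle\cdot,\cdot\rangle$ which fails to have maximal rank exactly on a nonempty set $\Sigma\subset M$. $(M,g)$ is a transverse singular space if in every local coordinate system $\det(g_{ab})$ has nonzero differential at the points of $\Sigma$; then $\Sigma$ is a smooth hypersurface (the singular hypersurface) and the radical $Rad_p=\{v\in T_pM: g(v,\cdot)=0\}$, $p\in\Sigma$, is one-dimensional. Tangent radical: $Rad_p\subset T_p\Sigma$ for all $p\in\Sigma$. Riemann-Lorentz: the signature of $g$ changes from Riemannian to Lorentzian across $\Sigma$. $\mathfrak{X}_\Sigma$: smooth vector fields along $\Sigma$; $\mathfrak{X}(\Sigma)$: those tangent to $\Sigma$. For $\mathcal A\in\mathfrak{X}(M)$, $\mathcal A^o=\mathcal A|_{M-\Sigma}$; $\mathcal A$ is an extension of $A=\mathcal A|_\Sigma$. Everything is local: $M$ may be replaced by a small neighbourhood of (a point of) $\Sigma$, and vector fields may be only locally defined. Dual connection: $2\square_{\mathcal A}\mathcal B(\mathcal C)=\mathcal A\langle\mathcal B,\mathcal C\rangle+\mathcal B\langle\mathcal C,\mathcal A\rangle-\mathcal C\langle\mathcal A,\mathcal B\rangle+\langle[\mathcal A,\mathcal B],\mathcal C\rangle-\langle[\mathcal B,\mathcal C],\mathcal A\rangle+\langle[\mathcal C,\mathcal A],\mathcal B\rangle$. For a radical vector field $R'$ along $\Sigma$, $II_{R'}(A,B):=\square_AB(R')$ is a well-defined symmetric $C^\infty(\Sigma)$-bilinear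 map on $\mathfrak{X}_\Sigma$. The main normal $N\in\mathfrak{X}_\Sigma$ satisfies $\langle N,T\Sigma\rangle=0$, $II_{R'}(N,N)=0$ for radical $R'$, $\langle N,N\rangle=1$ (unique up to sign). Second fundamental form: the symmetric tensor $\mathcal H(X,Y):=\square_XY(N)=-\square_XN(Y)$ on $\Sigma$. The main radical vector field $R\in\mathfrak{X}(\Sigma)$ is in the radical distribution with $\mathcal H(R,R)=-1$ (unique up to sign, the sign of $N$ being chosen to make this possible). $II:=II_R$. Canonical screen distribution: $S_p:=\{v\in T_p\Sigma:\mathcal H(v,R(p))=0\}$, a complement of $Rad_p$ in $T_p\Sigma$; $\Gamma(S)$ is its module of sections. $\Sigma$ is $II$-flat if $II(V,W)=0$ for all $V,W\in\Gamma(S)$ (equivalently $II(X,Y)=0$ for all $X,Y\in\mathfrak{X}(\Sigma)$). For a smooth object $F$ on $M-\Sigma$, $F\cong0$ ("$F$ has a good limit on $\Sigma$") means that $F$ extends smoothly to $M$. For $A,B\in\mathfrak{X}_\Sigma$, "$\nabla_AB$ is well-defined" means: for all extensions $\mathcal A,\mathcal B$ of $A,B$, $\nabla_{\mathcal A^o}\mathcal B^o\cong0$, and the restriction to $\Sigma$ of its smooth extension depends only on $A,B$ (not on the extensions chosen). *)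

theory Defs
  imports "HOL-Analysis.Analysis"
begin

section \<open>Smooth maps between normed spaces\<close>

primrec Ck_on :: "nat \<Rightarrow> ('e::real_normed_vector \<Rightarrow> 'f::real_normed_vector) \<Rightarrow> 'e set \<Rightarrow> bool" where
  "Ck_on 0 f S \<longleftrightarrow> continuous_on S f"
| "Ck_on (Suc k) f S \<longleftrightarrow>
     (\<forall>x\<in>S. f differentiable (at x)) \<and>
     (\<forall>v. Ck_on k (\<lambda>x. frechet_derivative f (at x) v) S)"

text \<open>Only used for open \<open>S\<close>.\<close>

definition smooth_on :: "'e set \<Rightarrow> ('e::real_normed_vector \<Rightarrow> 'f::real_normed_vector) \<Rightarrow> bool" where
  "smooth_on S f \<longleftrightarrow> (\<forall>k. Ck_on k f S)"


section \<open>Smooth manifolds, tensor fields by components\<close>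

text \<open>
  A chart is a pair of its domain and its coordinate map (whose values outside the domain are
  irrelevant). A manifold is given by an atlas \<open>At\<close>, not necessarily maximal, and its points are
  those covered by the atlas. Statements about all local coordinate systems are statements about all
  charts of \<open>At\<close>, and \<open>At\<close> may be the maximal atlas. The Hausdorff and second countability
  axioms come from the sort of the type of points.
\<close>

type_synonym ('a, 'n) chart = "'a set \<times> ('a \<Rightarrow> real ^ 'n)"

definition carrier_of :: "('a, 'n::finite) chart set \<Rightarrow> 'a set" where
  "carrier_of At = (\<Union>c\<in>At. fst c)"

definition charts_at :: "('a, 'n::finite) chart set \<Rightarrow> 'a \<Rightarrow> ('a, 'n) chart set" where
  "charts_at At p = {c \<in> At. p \<in> fst c}"

definition chart_at :: "('a, 'n::finite) chart set \<Rightarrow> 'a \<Rightarrow> ('a, 'n) chart" where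
  "chart_at At p = (SOME c. c \<in> charts_at At p)"

definition coord_rep :: "('a, 'n::finite) chart \<Rightarrow> ('a \<Rightarrow> 'b) \<Rightarrow> real ^ 'n \<Rightarrow> 'b" where
  "coord_rep c f = (\<lambda>x. f (inv_into (fst c) (snd c) x))"

definition smooth_manifold ::
    "('a::{t2_space, second_countable_topology}, 'n::finite) chart set \<Rightarrow> bool" where
  "smooth_manifold At \<longleftrightarrow>
     (\<forall>c\<in>At. open (fst c) \<and> open (snd c ` fst c) \<and>
        (\<exists>h. homeomorphism (fst c) (snd c ` fst c) (snd c) h)) \<and>
     (\<forall>c\<in>At. \<forall>d\<in>At. smooth_on (snd c ` (fst c \<inter> fst d)) (coord_rep c (snd d)))"

definition chart_jacobian ::
    "('a, 'n::finite) chart \<Rightarrow> ('a, 'n) chart \<Rightarrow> 'a \<Rightarrow> real ^ 'n ^ 'n" where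
  "chart_jacobian c d p = matrix (frechet_derivative (coord_rep c (snd d)) (at (snd c p)))"

definition smooth_fun ::
    "('a::topological_space, 'n::finite) chart set \<Rightarrow> 'a set \<Rightarrow> ('a \<Rightarrow> real) \<Rightarrow> bool" where
  "smooth_fun At V f \<longleftrightarrow> (\<forall>c\<in>At. smooth_on (snd c ` (fst c \<inter> V)) (coord_rep c f))"

text \<open>
  A tangent vector at \<open>p\<close> is a family of component vectors, one for each chart around \<open>p\<close>,
  transforming by the Jacobian of the change of charts. Accordingly a vector field assigns
  components to each chart and each point; components with respect to a chart not containing the
  point, and values at points outside the set on which the field is considered, are irrelevant, and
  \<open>vf_eq\<close> is the resulting equality of fields.
\<close>

type_synonym ('a, 'n) vfield = "('a, 'n) chart \<Rightarrow> 'a \<Rightarrow> real ^ 'n"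

definition vfield_on ::
    "('a, 'n::finite) chart set \<Rightarrow> 'a set \<Rightarrow> ('a, 'n) vfield \<Rightarrow> bool" where
  "vfield_on At S A \<longleftrightarrow>
     (\<forall>p\<in>S. \<forall>c\<in>charts_at At p. \<forall>d\<in>charts_at At p. A d p = chart_jacobian c d p *v A c p)"

definition vf_eq ::
    "('a, 'n::finite) chart set \<Rightarrow> 'a set \<Rightarrow> ('a, 'n) vfield \<Rightarrow> ('a, 'n) vfield \<Rightarrow> bool" where
  "vf_eq At S A B \<longleftrightarrow> (\<forall>p\<in>S. \<forall>c\<in>charts_at At p. A c p = B c p)"

definition smooth_vfield ::
    "('a::topological_space, 'n::finite) chart set \<Rightarrow> 'a set \<Rightarrow> ('a, 'n) vfield \<Rightarrow> bool" where
  "smooth_vfield At V A \<longleftrightarrow>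
     vfield_on At V A \<and> (\<forall>c\<in>At. smooth_on (snd c ` (fst c \<inter> V)) (coord_rep c (A c)))"

definition vf_add :: "('a, 'n::finite) vfield \<Rightarrow> ('a, 'n) vfield \<Rightarrow> ('a, 'n) vfield" where
  "vf_add A B = (\<lambda>c p. A c p + B c p)"

definition vf_diff :: "('a, 'n::finite) vfield \<Rightarrow> ('a, 'n) vfield \<Rightarrow> ('a, 'n) vfield" where
  "vf_diff A B = (\<lambda>c p. A c p - B c p)"

definition vf_scale :: "('a \<Rightarrow> real) \<Rightarrow> ('a, 'n::finite) vfield \<Rightarrow> ('a, 'n) vfield" where
  "vf_scale f A = (\<lambda>c p. f p *\<^sub>R A c p)"

definition vderiv ::
    "('a, 'n::finite) chart set \<Rightarrow> ('a, 'n) vfield \<Rightarrow> ('a \<Rightarrow> real) \<Rightarrow> 'a \<Rightarrow> real" where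
  "vderiv At A f p =
     (let c = chart_at At p in frechet_derivative (coord_rep c f) (at (snd c p)) (A c p))"

definition lie_bracket :: "('a, 'n::finite) vfield \<Rightarrow> ('a, 'n) vfield \<Rightarrow> ('a, 'n) vfield" where
  "lie_bracket A B = (\<lambda>c p.
     frechet_derivative (coord_rep c (B c)) (at (snd c p)) (A c p) -
     frechet_derivative (coord_rep c (A c)) (at (snd c p)) (B c p))"

text \<open>A \<open>(0,2)\<close>-tensor field is given by its Gram matrix in each chart.\<close>

type_synonym ('a, 'n) tensor02 = "('a, 'n) chart \<Rightarrow> 'a \<Rightarrow> real ^ 'n ^ 'n"

definition smooth_sym_tensor ::
    "('a::topological_space, 'n::finite) chart set \<Rightarrow> ('a, 'n) tensor02 \<Rightarrow> bool" where
  "smooth_sym_tensor At g \<longleftrightarrow>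
     (\<forall>p\<in>carrier_of At. \<forall>c\<in>charts_at At p. \<forall>d\<in>charts_at At p.
        g c p = transpose (chart_jacobian c d p) ** g d p ** chart_jacobian c d p) \<and>
     (\<forall>p\<in>carrier_of At. \<forall>c\<in>charts_at At p. transpose (g c p) = g c p) \<and>
     (\<forall>c\<in>At. smooth_on (snd c ` fst c) (coord_rep c (g c)))"

definition ip ::
    "('a, 'n::finite) chart set \<Rightarrow> ('a, 'n) tensor02 \<Rightarrow> ('a, 'n) vfield \<Rightarrow> ('a, 'n) vfield
      \<Rightarrow> 'a \<Rightarrow> real" where
  "ip At g A B p = (let c = chart_at At p in A c p \<bullet> (g c p *v B c p))"


section \<open>Transverse singular spaces\<close>

definition sing_set :: "('a, 'n::finite) chart set \<Rightarrow> ('a, 'n) tensor02 \<Rightarrow> 'a set" where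
  "sing_set At g = {p. \<exists>c\<in>charts_at At p. rank (g c p) < CARD('n)}"

definition ddet :: "('a, 'n::finite) tensor02 \<Rightarrow> ('a, 'n) chart \<Rightarrow> 'a \<Rightarrow> real ^ 'n \<Rightarrow> real" where
  "ddet g c p = frechet_derivative (coord_rep c (\<lambda>q. det (g c q))) (at (snd c p))"

definition transverse_singular_space ::
    "('a::{t2_space, second_countable_topology}, 'n::finite) chart set \<Rightarrow> ('a, 'n) tensor02
      \<Rightarrow> bool" where
  "transverse_singular_space At g \<longleftrightarrow>
     smooth_manifold At \<and> connected (carrier_of At) \<and> CARD('n) > 2 \<and>
     smooth_sym_tensor At g \<and> sing_set At g \<noteq> {} \<and>
     (\<forall>p\<in>sing_set At g. \<forall>c\<in>charts_at At p. \<exists>v. ddet g c p v \<noteq> 0)"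

definition riemannian_matrix :: "real ^ 'n::finite ^ 'n \<Rightarrow> bool" where
  "riemannian_matrix G \<longleftrightarrow> (\<forall>v. v \<noteq> 0 \<longrightarrow> v \<bullet> (G *v v) > 0)"

definition lorentzian_matrix :: "real ^ 'n::finite ^ 'n \<Rightarrow> bool" where
  "lorentzian_matrix G \<longleftrightarrow>
     (\<exists>(P :: real ^ 'n ^ 'n) k. invertible P \<and> transpose P ** G ** P =
        (\<chi> i j. if i = j then (if i = k then - 1 else 1) else 0))"

definition riemannian_part :: "('a, 'n::finite) chart set \<Rightarrow> ('a, 'n) tensor02 \<Rightarrow> 'a set" where
  "riemannian_part At g = {p \<in> carrier_of At. \<forall>c\<in>charts_at At p. riemannian_matrix (g c p)}"

definition lorentzian_part :: "('a, 'n::finite) chart set \<Rightarrow> ('a, 'n) tensor02 \<Rightarrow> 'a set" where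
  "lorentzian_part At g = {p \<in> carrier_of At. \<forall>c\<in>charts_at At p. lorentzian_matrix (g c p)}"

definition riemann_lorentz ::
    "('a::topological_space, 'n::finite) chart set \<Rightarrow> ('a, 'n) tensor02 \<Rightarrow> bool" where
  "riemann_lorentz At g \<longleftrightarrow>
     carrier_of At - sing_set At g \<subseteq> riemannian_part At g \<union> lorentzian_part At g \<and>
     sing_set At g \<subseteq> closure (riemannian_part At g) \<inter> closure (lorentzian_part At g)"

text \<open>
  The singular hypersurface is the regular zero set of \<open>det g\<close> in each chart, so that its tangent
  space is the kernel of the differential of this function.
\<close>

definition tangent_radical :: "('a, 'n::finite) chart set \<Rightarrow> ('a, 'n) tensor02 \<Rightarrow> bool" where
  "tangent_radical At g \<longleftrightarrow>
     (\<forall>p\<in>sing_set At g. \<forall>c\<in>charts_at At p. \<forall>v. g c p *v v = 0 \<longrightarrow> ddet g c p v = 0)"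

definition tangent_to_sing ::
    "('a, 'n::finite) chart set \<Rightarrow> ('a, 'n) tensor02 \<Rightarrow> 'a set \<Rightarrow> ('a, 'n) vfield \<Rightarrow> bool" where
  "tangent_to_sing At g V A \<longleftrightarrow>
     (\<forall>p\<in>sing_set At g \<inter> V. \<forall>c\<in>charts_at At p. ddet g c p (A c p) = 0)"


section \<open>Vector fields along the singular hypersurface\<close>

text \<open>
  Below, \<open>V\<close> is an open subset of the manifold, and fields along the singular hypersurface are
  considered on its part inside \<open>V\<close>. Their smoothness means local extendability to smooth fields
  on open subsets of the manifold.
\<close>

definition extension ::
    "('a::topological_space, 'n::finite) chart set \<Rightarrow> ('a, 'n) tensor02 \<Rightarrow> 'a set
      \<Rightarrow> ('a, 'n) vfield \<Rightarrow> ('a, 'n) vfield \<Rightarrow> bool" where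
  "extension At g W \<A> A \<longleftrightarrow> smooth_vfield At W \<A> \<and> vf_eq At (sing_set At g \<inter> W) \<A> A"

definition smooth_along ::
    "('a::topological_space, 'n::finite) chart set \<Rightarrow> ('a, 'n) tensor02 \<Rightarrow> 'a set
      \<Rightarrow> ('a, 'n) vfield \<Rightarrow> bool" where
  "smooth_along At g V A \<longleftrightarrow>
     (\<forall>p\<in>sing_set At g \<inter> V. \<exists>W \<A>. open W \<and> p \<in> W \<and> W \<subseteq> V \<and> extension At g W \<A> A)"

definition radical_field ::
    "('a::topological_space, 'n::finite) chart set \<Rightarrow> ('a, 'n) tensor02 \<Rightarrow> 'a set
      \<Rightarrow> ('a, 'n) vfield \<Rightarrow> bool" where
  "radical_field At g V A \<longleftrightarrow>
     smooth_along At g V A \<and>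
     (\<forall>p\<in>sing_set At g \<inter> V. \<forall>c\<in>charts_at At p. g c p *v A c p = 0)"

definition dual_conn ::
    "('a, 'n::finite) chart set \<Rightarrow> ('a, 'n) tensor02 \<Rightarrow> ('a, 'n) vfield \<Rightarrow> ('a, 'n) vfield
      \<Rightarrow> ('a, 'n) vfield \<Rightarrow> 'a \<Rightarrow> real" where
  "dual_conn At g A B C p =
     (vderiv At A (ip At g B C) p + vderiv At B (ip At g C A) p - vderiv At C (ip At g A B) p +
      ip At g (lie_bracket A B) C p - ip At g (lie_bracket B C) A p +
      ip At g (lie_bracket C A) B p) / 2"

text \<open>
  For fields along the singular hypersurface, the dual connection is the common value on all
  extensions, and hence is meaningful only where it does not depend on the extensions. This holds if
  the third field is radical, or if the first one is tangent.
\<close>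

definition dual_conn_along ::
    "('a::topological_space, 'n::finite) chart set \<Rightarrow> ('a, 'n) tensor02 \<Rightarrow> ('a, 'n) vfield
      \<Rightarrow> ('a, 'n) vfield \<Rightarrow> ('a, 'n) vfield \<Rightarrow> 'a \<Rightarrow> real" where
  "dual_conn_along At g A B C p =
     (THE r. \<forall>W \<A> \<B> \<C>. open W \<and> p \<in> W \<and> W \<subseteq> carrier_of At \<and>
        extension At g W \<A> A \<and> extension At g W \<B> B \<and> extension At g W \<C> C \<longrightarrow>
        dual_conn At g \<A> \<B> \<C> p = r)"

definition II ::
    "('a::topological_space, 'n::finite) chart set \<Rightarrow> ('a, 'n) tensor02 \<Rightarrow> ('a, 'n) vfield
      \<Rightarrow> ('a, 'n) vfield \<Rightarrow> ('a, 'n) vfield \<Rightarrow> 'a \<Rightarrow> real" where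
  "II At g R A B = dual_conn_along At g A B R"

definition second_ff ::
    "('a::topological_space, 'n::finite) chart set \<Rightarrow> ('a, 'n) tensor02 \<Rightarrow> ('a, 'n) vfield
      \<Rightarrow> ('a, 'n) vfield \<Rightarrow> ('a, 'n) vfield \<Rightarrow> 'a \<Rightarrow> real" where
  "second_ff At g N X Y = dual_conn_along At g X Y N"

definition main_normal ::
    "('a::topological_space, 'n::finite) chart set \<Rightarrow> ('a, 'n) tensor02 \<Rightarrow> 'a set
      \<Rightarrow> ('a, 'n) vfield \<Rightarrow> bool" where
  "main_normal At g V N \<longleftrightarrow>
     smooth_along At g V N \<and>
     (\<forall>p\<in>sing_set At g \<inter> V. \<forall>c\<in>charts_at At p. \<forall>x. ddet g c p x = 0 \<longrightarrow>
        N c p \<bullet> (g c p *v x) = 0) \<and>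
     (\<forall>W R'. open W \<and> W \<subseteq> V \<and> radical_field At g W R' \<longrightarrow>
        (\<forall>p\<in>sing_set At g \<inter> W. II At g R' N N p = 0)) \<and>
     (\<forall>p\<in>sing_set At g \<inter> V. ip At g N N p = 1)"

definition main_radical ::
    "('a::topological_space, 'n::finite) chart set \<Rightarrow> ('a, 'n) tensor02 \<Rightarrow> 'a set
      \<Rightarrow> ('a, 'n) vfield \<Rightarrow> ('a, 'n) vfield \<Rightarrow> bool" where
  "main_radical At g V N R \<longleftrightarrow>
     radical_field At g V R \<and> tangent_to_sing At g V R \<and>
     (\<forall>p\<in>sing_set At g \<inter> V. second_ff At g N R R p = - 1)"

definition screen_section ::
    "('a::topological_space, 'n::finite) chart set \<Rightarrow> ('a, 'n) tensor02 \<Rightarrow> ('a, 'n) vfield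
      \<Rightarrow> ('a, 'n) vfield \<Rightarrow> 'a set \<Rightarrow> ('a, 'n) vfield \<Rightarrow> bool" where
  "screen_section At g N R V X \<longleftrightarrow>
     smooth_along At g V X \<and> tangent_to_sing At g V X \<and>
     (\<forall>p\<in>sing_set At g \<inter> V. second_ff At g N X R p = 0)"

definition II_flat ::
    "('a::topological_space, 'n::finite) chart set \<Rightarrow> ('a, 'n) tensor02 \<Rightarrow> ('a, 'n) vfield
      \<Rightarrow> ('a, 'n) vfield \<Rightarrow> 'a set \<Rightarrow> bool" where
  "II_flat At g N R U \<longleftrightarrow>
     (\<forall>V X Y. open V \<and> V \<subseteq> U \<and> screen_section At g N R V X \<and> screen_section At g N R V Y \<longrightarrow>
        (\<forall>p\<in>sing_set At g \<inter> V. II At g R X Y p = 0))"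


section \<open>The Levi-Civita connection off the singular hypersurface\<close>

text \<open>
  A connection acts on fields over every open set \<open>V\<close> of nondegenerate points; the second
  condition says that it respects the equality of fields over \<open>V\<close>.
\<close>

definition levi_civita ::
    "('a::topological_space, 'n::finite) chart set \<Rightarrow> ('a, 'n) tensor02
      \<Rightarrow> (('a, 'n) vfield \<Rightarrow> ('a, 'n) vfield \<Rightarrow> ('a, 'n) vfield) \<Rightarrow> bool" where
  "levi_civita At g D \<longleftrightarrow> (\<forall>V. open V \<and> V \<subseteq> carrier_of At - sing_set At g \<longrightarrow>
     (\<forall>A B. smooth_vfield At V A \<and> smooth_vfield At V B \<longrightarrow> smooth_vfield At V (D A B)) \<and>
     (\<forall>A A' B B'. smooth_vfield At V A \<and> smooth_vfield At V A' \<and>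
        smooth_vfield At V B \<and> smooth_vfield At V B' \<and> vf_eq At V A A' \<and> vf_eq At V B B' \<longrightarrow>
        vf_eq At V (D A B) (D A' B')) \<and>
     (\<forall>A A' B. smooth_vfield At V A \<and> smooth_vfield At V A' \<and> smooth_vfield At V B \<longrightarrow>
        vf_eq At V (D (vf_add A A') B) (vf_add (D A B) (D A' B))) \<and>
     (\<forall>A B B'. smooth_vfield At V A \<and> smooth_vfield At V B \<and> smooth_vfield At V B' \<longrightarrow>
        vf_eq At V (D A (vf_add B B')) (vf_add (D A B) (D A B'))) \<and>
     (\<forall>f A B. smooth_fun At V f \<and> smooth_vfield At V A \<and> smooth_vfield At V B \<longrightarrow>
        vf_eq At V (D (vf_scale f A) B) (vf_scale f (D A B)) \<and>
        vf_eq At V (D A (vf_scale f B)) (vf_add (vf_scale (vderiv At A f) B) (vf_scale f (D A B)))) \<and>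
     (\<forall>A B. smooth_vfield At V A \<and> smooth_vfield At V B \<longrightarrow>
        vf_eq At V (vf_diff (D A B) (D B A)) (lie_bracket A B)) \<and>
     (\<forall>A B C. smooth_vfield At V A \<and> smooth_vfield At V B \<and> smooth_vfield At V C \<longrightarrow>
        (\<forall>p\<in>V. vderiv At A (ip At g B C) p = ip At g (D A B) C p + ip At g B (D A C) p)))"

definition extends_over_sing ::
    "('a::topological_space, 'n::finite) chart set \<Rightarrow> ('a, 'n) tensor02 \<Rightarrow> 'a set
      \<Rightarrow> ('a, 'n) vfield \<Rightarrow> ('a, 'n) vfield \<Rightarrow> bool" where
  "extends_over_sing At g V F G \<longleftrightarrow> smooth_vfield At V G \<and> vf_eq At (V - sing_set At g) G F"

definition good_limit ::
    "('a::topological_space, 'n::finite) chart set \<Rightarrow> ('a, 'n) tensor02 \<Rightarrow> 'a set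
      \<Rightarrow> ('a, 'n) vfield \<Rightarrow> bool" where
  "good_limit At g V F \<longleftrightarrow> (\<exists>G. extends_over_sing At g V F G)"

definition conn_well_defined ::
    "('a::topological_space, 'n::finite) chart set \<Rightarrow> ('a, 'n) tensor02
      \<Rightarrow> (('a, 'n) vfield \<Rightarrow> ('a, 'n) vfield \<Rightarrow> ('a, 'n) vfield) \<Rightarrow> 'a set
      \<Rightarrow> ('a, 'n) vfield \<Rightarrow> ('a, 'n) vfield \<Rightarrow> bool" where
  "conn_well_defined At g D V A B \<longleftrightarrow>
     (\<forall>W \<A> \<B>. open W \<and> W \<subseteq> V \<and> extension At g W \<A> A \<and> extension At g W \<B> B \<longrightarrow>
        good_limit At g W (D \<A> \<B>)) \<and>
     (\<forall>W \<A> \<B> \<A>' \<B>' F F'. open W \<and> W \<subseteq> V \<and>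
        extension At g W \<A> A \<and> extension At g W \<B> B \<and>
        extension At g W \<A>' A \<and> extension At g W \<B>' B \<and>
        extends_over_sing At g W (D \<A> \<B>) F \<and> extends_over_sing At g W (D \<A>' \<B>') F' \<longrightarrow>
        vf_eq At (sing_set At g \<inter> W) F F')"

end

(*
  In a chart let G be the Gram matrix, phi = det G and Gamma(A,B) the covector of Christoffel symbols
  of the first kind. The dual connection is DB(A) . G C + Gamma(A,B) . C, so II(A,B) = Gamma(A,B) . R,
  and off the singular hypersurface the connection is DB(A) + adj(G) Gamma(A,B) / phi. Since phi has
  regular zeros, a smooth function vanishing on them is smoothly divisible by phi; and adj(G) y
  vanishes at a singular point exactly if y . R = 0, because differentiating G adj(G) y = phi y
  in a transverse direction gives a nonzero multiple of y . R. This proves (a). For (b), A - Gamma(A,N,R) R is a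
  screen section if A is tangent, and Gamma(X,R,R) = 0 for tangent X.

  Two extensions of a field along the hypersurface differ by a multiple phi X. Replacing A by A + phi X and B
  by B + phi Y changes the limit by dphi(A) Y + adj(G) (Gamma(X,B) + Gamma(A,Y)). With
  Gamma(R,N,R) = 1, Gamma(N,N,R) = 0 and dphi(N) nonzero, this gives (c) and (d).
*)
theory Submission
  imports Defs
begin

section \<open>Calculus of smooth maps\<close>

text \<open>Fields are families of components, so limits must be glued over charts. The
  transformation law of Christoffel symbols is never computed: off the hypersurface the chart
  formulas express \<open>D A B\<close>, which is a field by hypothesis, and the regular points are
  dense because a regular zero of phi has no neighbourhood of zeros. Identities, including the
  change of charts of the limit itself, then reach the hypersurface by continuity. The products
  adj(G) y replace the inverse matrix because their entries are determinants, hence smooth across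
  the hypersurface; the only singular factor left is 1/phi. The constants come from one computation:
  along the hypersurface the pairing of R with any field is zero, and differentiating this in a
  tangent direction X gives H(X,R) = - Gamma(X,N,R) and Gamma(X,R,R) = 0. Thus H(R,R) = -1 becomes
  Gamma(R,N,R) = 1, and X lies in the screen exactly if Gamma(X,N,R) = 0. Since N is transverse,
  flatness then controls Gamma(v,X,R) for all v, not only for tangent ones.\<close>

lemma Ck_on_subset: "Ck_on k f S \<Longrightarrow> T \<subseteq> S \<Longrightarrow> Ck_on k f T"
  by (induction k arbitrary: f) (auto intro: continuous_on_subset)

lemma Ck_on_imp_continuous_on: "Ck_on k f S \<Longrightarrow> continuous_on S f"
  by (cases k) (auto intro!: continuous_at_imp_continuous_on differentiable_imp_continuous_within)

lemma Ck_on_SucD: "Ck_on (Suc k) f S \<Longrightarrow> Ck_on k f S"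
proof (induction k arbitrary: f)
  case 0
  then show ?case
    using Ck_on_imp_continuous_on[OF 0] by simp
qed auto

lemma Ck_on_cong:
  assumes "open S" "\<And>x. x \<in> S \<Longrightarrow> f x = g x" "Ck_on k f S"
  shows "Ck_on k g S"
  using assms(2,3)
proof (induction k arbitrary: f g)
  case 0
  then show ?case
    using continuous_on_eq by auto
next
  case (Suc k)
  have d: "f differentiable (at x)" if "x \<in> S" for x
    using Suc.prems that by auto
  have eq: "frechet_derivative f (at x) = frechet_derivative g (at x)" if "x \<in> S" for x
    using frechet_derivative_transform_within_open[OF d[OF that] \<open>open S\<close> that] Suc.prems(1) by blast
  have "g differentiable (at x)" if "x \<in> S" for x
  proof -
    obtain f' where "(f has_derivative f') (at x)"
      using d[OF \<open>x \<in> S\<close>] by (auto simp: differentiable_def)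
    then have "(g has_derivative f') (at x)"
      by (rule has_derivative_transform_within_open[OF _ \<open>open S\<close> \<open>x \<in> S\<close>]) (use Suc.prems in auto)
    then show ?thesis
      by (auto simp: differentiable_def)
  qed
  moreover have "Ck_on k (\<lambda>x. frechet_derivative g (at x) v) S" for v
    using Suc.IH[of "\<lambda>x. frechet_derivative f (at x) v"] Suc.prems eq by auto
  ultimately show ?case by simp
qed

text \<open>Both conditions in \<open>Ck_on\<close> are conditions at single points, so local pieces
  glue; the quotient in \<open>smooth_division\<close> is obtained in this way.\<close>

lemma Ck_on_local:
  assumes "\<And>x. x \<in> S \<Longrightarrow> \<exists>T. open T \<and> x \<in> T \<and> Ck_on k f T"
  shows "Ck_on k f S"
  using assms
proof (induction k arbitrary: f)
  case 0
  show ?case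
    unfolding Ck_on.simps
  proof (rule continuous_at_imp_continuous_on, rule ballI)
    fix x assume "x \<in> S"
    then obtain T where "open T" "x \<in> T" "continuous_on T f"
      using 0 by auto
    then show "isCont f x"
      using continuous_on_eq_continuous_at by blast
  qed
next
  case (Suc k)
  have "f differentiable (at x)" if "x \<in> S" for x
    using Suc.prems[OF that] by auto
  moreover have "Ck_on k (\<lambda>x. frechet_derivative f (at x) v) S" for v
    by (rule Suc.IH) (use Suc.prems in fastforce)
  ultimately show ?case by simp
qed

text \<open>Lets the inductions on the order work with an explicit derivative. Each closure property
  below follows because that derivative is built from the same operations at order
  \<open>k\<close>.\<close>

lemma Ck_on_SucI:
  assumes "open S" "\<And>x. x \<in> S \<Longrightarrow> (f has_derivative f' x) (at x)" "\<And>v. Ck_on k (\<lambda>x. f' x v) S"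
  shows "Ck_on (Suc k) f S"
proof -
  have "Ck_on k (\<lambda>x. frechet_derivative f (at x) v) S" for v
    by (rule Ck_on_cong[OF assms(1) _ assms(3)[of v]]) (metis assms(2) frechet_derivative_at)
  then show ?thesis
    using assms(2) by (auto simp: differentiable_def)
qed

lemma Ck_on_has_derivative:
  "Ck_on (Suc k) f S \<Longrightarrow> x \<in> S \<Longrightarrow> (f has_derivative frechet_derivative f (at x)) (at x)"
  by (simp add: frechet_derivative_works[symmetric])

lemma Ck_on_const: "Ck_on k (\<lambda>x. c) S"
  by (induction k arbitrary: c) (auto simp: frechet_derivative_const)

lemma Ck_on_bounded_linear:
  assumes "bounded_linear L" "open S" "Ck_on k f S"
  shows "Ck_on k (\<lambda>x. L (f x)) S"
  using assms(3)
proof (induction k arbitrary: f)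
  case 0
  then show ?case
    using assms(1) bounded_linear.continuous_on by auto
next
  case (Suc k)
  show ?case
  proof (rule Ck_on_SucI[OF \<open>open S\<close>, where f' = "\<lambda>x v. L (frechet_derivative f (at x) v)"])
    show "((\<lambda>x. L (f x)) has_derivative (\<lambda>v. L (frechet_derivative f (at x) v))) (at x)" if "x \<in> S" for x
      using bounded_linear.has_derivative[OF assms(1) Ck_on_has_derivative[OF Suc.prems that]] .
    show "Ck_on k (\<lambda>x. L (frechet_derivative f (at x) v)) S" for v
      using Suc.IH Suc.prems by auto
  qed
qed

lemma Ck_on_add:
  assumes "open S" "Ck_on k f S" "Ck_on k g S"
  shows "Ck_on k (\<lambda>x. f x + g x) S"
  using assms(2,3)
proof (induction k arbitrary: f g)
  case 0
  then show ?case
    by (auto intro: continuous_on_add)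
next
  case (Suc k)
  show ?case
  proof (rule Ck_on_SucI[OF \<open>open S\<close>, where
        f' = "\<lambda>x v. frechet_derivative f (at x) v + frechet_derivative g (at x) v"])
    show "((\<lambda>x. f x + g x) has_derivative
        (\<lambda>v. frechet_derivative f (at x) v + frechet_derivative g (at x) v)) (at x)" if "x \<in> S" for x
      using has_derivative_add[OF Ck_on_has_derivative[OF Suc.prems(1) that]
          Ck_on_has_derivative[OF Suc.prems(2) that]] .
    show "Ck_on k (\<lambda>x. frechet_derivative f (at x) v + frechet_derivative g (at x) v) S" for v
      using Suc.IH Suc.prems by auto
  qed
qed

lemma Ck_on_sum:
  assumes "open S" "\<And>i. i \<in> I \<Longrightarrow> Ck_on k (f i) S"
  shows "Ck_on k (\<lambda>x. \<Sum>i\<in>I. f i x) S"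
  using assms(2)
  by (induction I rule: infinite_finite_induct) (auto intro!: Ck_on_const Ck_on_add[OF assms(1)])

lemma Ck_on_bounded_bilinear:
  assumes "bounded_bilinear B" "open S" "Ck_on k f S" "Ck_on k g S"
  shows "Ck_on k (\<lambda>x. B (f x) (g x)) S"
  using assms(3,4)
proof (induction k arbitrary: f g)
  case 0
  then show ?case
    using bounded_bilinear.continuous_on[OF assms(1)] by auto
next
  case (Suc k)
  show ?case
  proof (rule Ck_on_SucI[OF \<open>open S\<close>, where
        f' = "\<lambda>x v. B (f x) (frechet_derivative g (at x) v) + B (frechet_derivative f (at x) v) (g x)"])
    show "((\<lambda>x. B (f x) (g x)) has_derivative
        (\<lambda>v. B (f x) (frechet_derivative g (at x) v) + B (frechet_derivative f (at x) v) (g x))) (at x)"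
      if "x \<in> S" for x
      using bounded_bilinear.FDERIV[OF assms(1) Ck_on_has_derivative[OF Suc.prems(1) that]
          Ck_on_has_derivative[OF Suc.prems(2) that]] .
    show "Ck_on k (\<lambda>x. B (f x) (frechet_derivative g (at x) v) + B (frechet_derivative f (at x) v) (g x)) S"
      for v
      by (intro Ck_on_add[OF \<open>open S\<close>] Suc.IH) (use Suc.prems Ck_on_SucD in auto)
  qed
qed

text \<open>\<open>Ck_on\<close> controls derivatives only in directions that are fixed over the
  set. This expansion turns a direction varying with the point into scalar coefficients times
  derivatives in fixed directions.\<close>

lemma linear_expand_Basis:
  fixes L :: "'e::euclidean_space \<Rightarrow> 'f::real_vector"
  assumes "linear L"
  shows "L v = (\<Sum>b\<in>Basis. (v \<bullet> b) *\<^sub>R L b)"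
proof -
  have "L v = L (\<Sum>b\<in>Basis. (v \<bullet> b) *\<^sub>R b)"
    by (simp add: euclidean_representation)
  also have "\<dots> = (\<Sum>b\<in>Basis. (v \<bullet> b) *\<^sub>R L b)"
    using assms by (simp add: linear_sum linear_cmul)
  finally show ?thesis .
qed

lemma Ck_on_compose:
  fixes g :: "'e::real_normed_vector \<Rightarrow> 'f::euclidean_space"
    and f :: "'f \<Rightarrow> 'h::real_normed_vector"
  assumes "open S" "open T" "g ` S \<subseteq> T" "Ck_on k g S" "Ck_on k f T"
  shows "Ck_on k (\<lambda>x. f (g x)) S"
  using assms(4,5)
proof (induction k arbitrary: f)
  case 0
  then show ?case
    using assms(3) continuous_on_compose2[of T f S g] by auto
next
  case (Suc k)
  have gT: "g x \<in> T" if "x \<in> S" for x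
    using that assms(3) by auto
  have dg: "(g has_derivative frechet_derivative g (at x)) (at x)" if "x \<in> S" for x
    using Ck_on_has_derivative[OF Suc.prems(1) that] .
  have df: "(f has_derivative frechet_derivative f (at (g x))) (at (g x))" if "x \<in> S" for x
    using Ck_on_has_derivative[OF Suc.prems(2) gT[OF that]] .
  show ?case
  \<comment> \<open>The chain rule differentiates \<open>f\<close> in the varying direction Dg(x) v,
    hence the expansion over \<open>Basis\<close> and the Euclidean middle space.\<close>
  proof (rule Ck_on_SucI[OF \<open>open S\<close>, where f' = "\<lambda>x v. \<Sum>b\<in>Basis.
      (frechet_derivative g (at x) v \<bullet> b) *\<^sub>R frechet_derivative f (at (g x)) b"])
    fix x assume x: "x \<in> S"
    have lin: "linear (frechet_derivative f (at (g x)))"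
      using df[OF x] has_derivative_linear by blast
    show "((\<lambda>x. f (g x)) has_derivative (\<lambda>v. \<Sum>b\<in>Basis.
      (frechet_derivative g (at x) v \<bullet> b) *\<^sub>R frechet_derivative f (at (g x)) b)) (at x)"
      using diff_chain_at[OF dg[OF x] df[OF x]]
      unfolding o_def linear_expand_Basis[OF lin, of "frechet_derivative g (at x) _"] .
  next
    fix v
    have "Ck_on k (\<lambda>x. frechet_derivative f (at (g x)) b) S" for b
      by (rule Suc.IH) (use Suc.prems Ck_on_SucD in auto)
    moreover have "Ck_on k (\<lambda>x. frechet_derivative g (at x) v \<bullet> b) S" for b
      by (rule Ck_on_bounded_linear[OF bounded_linear_inner_left \<open>open S\<close>]) (use Suc.prems(1) in auto)
    ultimately show "Ck_on k (\<lambda>x. \<Sum>b\<in>Basis.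
        (frechet_derivative g (at x) v \<bullet> b) *\<^sub>R frechet_derivative f (at (g x)) b) S"
      by (intro Ck_on_sum Ck_on_bounded_bilinear[OF bounded_bilinear_scaleR]) (auto simp: \<open>open S\<close>)
  qed
qed

text \<open>The derivative of 1/f contains 1/f undifferentiated, so regularity of order
  \<open>k\<close> of 1/f itself feeds the step to order \<open>Suc k\<close>.\<close>

lemma Ck_on_inverse:
  fixes f :: "'e::real_normed_vector \<Rightarrow> real"
  assumes "open S" "\<And>x. x \<in> S \<Longrightarrow> f x \<noteq> 0" "Ck_on k f S"
  shows "Ck_on k (\<lambda>x. inverse (f x)) S"
  using assms(3)
proof (induction k)
  case 0
  then show ?case
    using assms(2) by (auto intro!: continuous_on_inverse)
next
  case (Suc k)
  have c: "Ck_on k (\<lambda>x. inverse (f x)) S"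
    using Suc Ck_on_SucD by blast
  show ?case
  proof (rule Ck_on_SucI[OF \<open>open S\<close>, where
        f' = "\<lambda>x v. - ((inverse (f x) * frechet_derivative f (at x) v) * inverse (f x))"])
    show "((\<lambda>x. inverse (f x)) has_derivative
      (\<lambda>v. - ((inverse (f x) * frechet_derivative f (at x) v) * inverse (f x)))) (at x)" if "x \<in> S" for x
      using Deriv.has_derivative_inverse[OF assms(2)[OF that] Ck_on_has_derivative[OF Suc.prems that]]
      by simp
    show "Ck_on k (\<lambda>x. - ((inverse (f x) * frechet_derivative f (at x) v) * inverse (f x))) S" for v
      by (intro Ck_on_bounded_linear[OF bounded_linear_minus[OF bounded_linear_ident]]
          Ck_on_bounded_bilinear[OF bounded_bilinear_mult] c)
        (use Suc.prems \<open>open S\<close> in auto)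
  qed
qed

section \<open>Closure properties of smooth maps, determinants and matrix products\<close>

lemma smooth_on_subset: "smooth_on S f \<Longrightarrow> T \<subseteq> S \<Longrightarrow> smooth_on T f"
  using Ck_on_subset unfolding smooth_on_def by blast

lemma smooth_on_imp_continuous_on: "smooth_on S f \<Longrightarrow> continuous_on S f"
  unfolding smooth_on_def using Ck_on_imp_continuous_on by blast

lemma smooth_on_cong:
  "open S \<Longrightarrow> (\<And>x. x \<in> S \<Longrightarrow> f x = g x) \<Longrightarrow> smooth_on S f \<Longrightarrow> smooth_on S g"
  unfolding smooth_on_def using Ck_on_cong by blast

lemma smooth_on_local:
  assumes "\<And>x. x \<in> S \<Longrightarrow> \<exists>T. open T \<and> x \<in> T \<and> smooth_on T f"
  shows "smooth_on S f"
  unfolding smooth_on_def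
  by (intro allI Ck_on_local) (use assms smooth_on_def in blast)

lemma smooth_on_const [simp]: "smooth_on S (\<lambda>x. c)"
  by (simp add: smooth_on_def Ck_on_const)

lemma smooth_on_ident [simp]: "smooth_on S (\<lambda>x. x)"
proof -
  have "Ck_on k (\<lambda>x. x) S" for k
    by (cases k) (auto simp: Ck_on_const)
  then show ?thesis
    by (simp add: smooth_on_def)
qed

lemma smooth_on_bounded_linear:
  "bounded_linear L \<Longrightarrow> open S \<Longrightarrow> smooth_on S f \<Longrightarrow> smooth_on S (\<lambda>x. L (f x))"
  unfolding smooth_on_def by (intro allI Ck_on_bounded_linear[of L]) auto

lemma smooth_on_add: "open S \<Longrightarrow> smooth_on S f \<Longrightarrow> smooth_on S g \<Longrightarrow> smooth_on S (\<lambda>x. f x + g x)"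
  unfolding smooth_on_def by (intro allI Ck_on_add) auto

lemma smooth_on_sum:
  "open S \<Longrightarrow> (\<And>i. i \<in> I \<Longrightarrow> smooth_on S (f i)) \<Longrightarrow> smooth_on S (\<lambda>x. \<Sum>i\<in>I. f i x)"
  unfolding smooth_on_def by (intro allI Ck_on_sum) auto

lemma smooth_on_bounded_bilinear:
  "bounded_bilinear B \<Longrightarrow> open S \<Longrightarrow> smooth_on S f \<Longrightarrow> smooth_on S g \<Longrightarrow> smooth_on S (\<lambda>x. B (f x) (g x))"
  unfolding smooth_on_def by (intro allI Ck_on_bounded_bilinear[of B]) auto

lemmas smooth_on_scaleR = smooth_on_bounded_bilinear[OF bounded_bilinear_scaleR]
  and smooth_on_mult = smooth_on_bounded_bilinear[OF bounded_bilinear_mult]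
  and smooth_on_inner = smooth_on_bounded_bilinear[OF bounded_bilinear_inner]
  and smooth_on_minus = smooth_on_bounded_linear[OF bounded_linear_minus[OF bounded_linear_ident]]

lemma smooth_on_diff: "open S \<Longrightarrow> smooth_on S f \<Longrightarrow> smooth_on S g \<Longrightarrow> smooth_on S (\<lambda>x. f x - g x)"
  using smooth_on_add[of S f "\<lambda>x. - g x"] smooth_on_minus[of S g] by simp

lemma smooth_on_inverse:
  fixes f :: "'e::real_normed_vector \<Rightarrow> real"
  shows "open S \<Longrightarrow> (\<And>x. x \<in> S \<Longrightarrow> f x \<noteq> 0) \<Longrightarrow> smooth_on S f \<Longrightarrow> smooth_on S (\<lambda>x. inverse (f x))"
  unfolding smooth_on_def by (intro allI Ck_on_inverse) auto

lemma smooth_on_prod: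
  fixes f :: "'i \<Rightarrow> 'e::real_normed_vector \<Rightarrow> real"
  assumes "open S" "\<And>i. i \<in> I \<Longrightarrow> smooth_on S (f i)"
  shows "smooth_on S (\<lambda>x. \<Prod>i\<in>I. f i x)"
  using assms(2)
  by (induction I rule: infinite_finite_induct) (auto intro!: smooth_on_mult assms(1))

lemma smooth_on_compose:
  fixes g :: "'e::real_normed_vector \<Rightarrow> 'f::euclidean_space"
  shows "open S \<Longrightarrow> open T \<Longrightarrow> g ` S \<subseteq> T \<Longrightarrow> smooth_on S g \<Longrightarrow> smooth_on T f \<Longrightarrow> smooth_on S (\<lambda>x. f (g x))"
  unfolding smooth_on_def by (intro allI Ck_on_compose[of S T g _ f]) auto

lemma smooth_on_has_derivative:
  "smooth_on S f \<Longrightarrow> x \<in> S \<Longrightarrow> (f has_derivative frechet_derivative f (at x)) (at x)"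
  unfolding smooth_on_def using Ck_on_has_derivative by blast

lemma smooth_on_linear_frechet_derivative:
  "smooth_on S f \<Longrightarrow> x \<in> S \<Longrightarrow> linear (frechet_derivative f (at x))"
  using smooth_on_has_derivative has_derivative_linear by blast

lemma smooth_on_frechet_derivative:
  "smooth_on S f \<Longrightarrow> smooth_on S (\<lambda>x. frechet_derivative f (at x) v)"
  unfolding smooth_on_def by (metis Ck_on.simps(2))

lemma smooth_on_frechet_derivative_apply:
  fixes f :: "'e::euclidean_space \<Rightarrow> 'f::real_normed_vector"
  assumes "open S" "smooth_on S f" "smooth_on S w"
  shows "smooth_on S (\<lambda>x. frechet_derivative f (at x) (w x))"
proof (rule smooth_on_cong[OF assms(1)])
  show "(\<Sum>b\<in>Basis. (w x \<bullet> b) *\<^sub>R frechet_derivative f (at x) b) = frechet_derivative f (at x) (w x)"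
    if "x \<in> S" for x
    by (rule linear_expand_Basis[OF smooth_on_linear_frechet_derivative[OF assms(2) that], symmetric])
  show "smooth_on S (\<lambda>x. \<Sum>b\<in>Basis. (w x \<bullet> b) *\<^sub>R frechet_derivative f (at x) b)"
    by (intro smooth_on_sum smooth_on_scaleR smooth_on_bounded_linear[OF bounded_linear_inner_left]
        assms smooth_on_frechet_derivative)
qed

lemma smooth_on_vec_nth: "open S \<Longrightarrow> smooth_on S f \<Longrightarrow> smooth_on S (\<lambda>x. f x $ i)"
  using smooth_on_bounded_linear[OF bounded_linear_vec_nth] .

lemma smooth_on_vec_lambda:
  fixes f :: "'i::finite \<Rightarrow> 'e::real_normed_vector \<Rightarrow> 'f::euclidean_space"
  assumes "open S" "\<And>i. smooth_on S (f i)"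
  shows "smooth_on S (\<lambda>x. \<chi> i. f i x)"
proof -
  have lin: "bounded_linear (\<lambda>y. axis i y :: 'f ^ 'i)" for i :: 'i
    unfolding linear_conv_bounded_linear[symmetric]
    by (rule linearI) (auto simp: vec_eq_iff axis_def)
  have "(\<chi> i. f i x) = (\<Sum>i\<in>UNIV. axis i (f i x))" for x
    by (simp add: vec_eq_iff axis_def)
  then show ?thesis
    by (simp only:) (intro smooth_on_sum smooth_on_bounded_linear[OF lin] assms)
qed

lemma smooth_on_det:
  fixes M :: "'e::real_normed_vector \<Rightarrow> real ^ 'n ^ 'n"
  assumes "open S" "smooth_on S M"
  shows "smooth_on S (\<lambda>x. det (M x))"
  unfolding det_def
  by (intro smooth_on_sum smooth_on_mult smooth_on_const smooth_on_prod smooth_on_vec_nth assms)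

lemma smooth_on_matrix_vector_mult:
  fixes M :: "'e::real_normed_vector \<Rightarrow> real ^ 'n ^ 'm"
  assumes "open S" "smooth_on S M" "smooth_on S v"
  shows "smooth_on S (\<lambda>x. M x *v v x)"
  unfolding matrix_vector_mult_def
  by (intro smooth_on_vec_lambda smooth_on_sum smooth_on_mult smooth_on_vec_nth assms)

lemma smooth_on_matrix_frechet_derivative:
  fixes f :: "real ^ 'n \<Rightarrow> real ^ 'm"
  assumes "open S" "smooth_on S f"
  shows "smooth_on S (\<lambda>x. matrix (frechet_derivative f (at x)))"
  unfolding matrix_def
  by (intro smooth_on_vec_lambda smooth_on_vec_nth smooth_on_frechet_derivative assms)


section \<open>Division by a function with regular zeros\<close>

text \<open>For a unit vector \<open>e\<close> the integration runs from \<open>y\<close> to its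
  projection on the hyperplane orthogonal to \<open>e\<close>. The derivative of the integrand in
  direction \<open>v\<close> is \<open>s ^ j\<close> times the \<open>v\<close>-derivative of
  \<open>u\<close> minus \<open>(e \<bullet> v) * s ^ Suc j\<close> times its
  \<open>e\<close>-derivative. Carrying all powers of \<open>s\<close> thus gives a family closed
  under differentiation under the integral, which makes the induction possible.\<close>

lemma Ck_on_integral_projected_segment:
  fixes u :: "'e::euclidean_space \<Rightarrow> real" and e y0 :: 'e
  assumes "open \<Omega>" "smooth_on \<Omega> u"
    and "\<And>y s. y \<in> ball y0 r \<Longrightarrow> s \<in> {0..1} \<Longrightarrow> y - (s * (e \<bullet> y)) *\<^sub>R e \<in> \<Omega>"
  shows "Ck_on k (\<lambda>y. integral {0..1} (\<lambda>s. s ^ j * u (y - (s * (e \<bullet> y)) *\<^sub>R e))) (ball y0 r)"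
  using assms(2)
proof (induction k arbitrary: j u)
  let ?L = "\<lambda>y s. y - (s * (e \<bullet> y)) *\<^sub>R e"
  have cont: "continuous_on (ball y0 r \<times> {0..1}) (\<lambda>z. v (?L (fst z) (snd z)))"
    if "smooth_on \<Omega> v" for v :: "'e \<Rightarrow> real"
    by (rule continuous_on_compose2[OF smooth_on_imp_continuous_on[OF that]])
      (use assms(3) in \<open>auto intro!: continuous_intros\<close>)
  have pr: "continuous_on {0..1} (\<lambda>s::real. (y, s))" for y :: 'e
    by (intro continuous_intros)
  {
    case 0
    show ?case
      unfolding Ck_on.simps cbox_interval[symmetric]
    proof (rule integral_continuous_on_param)
      show "continuous_on (ball y0 r \<times> cbox 0 1) (\<lambda>(y, s). s ^ j * u (?L y s))"
        unfolding split_beta cbox_interval by (intro continuous_intros cont 0)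
    qed
  next
    case (Suc k)
    define du where "du b = (\<lambda>y. frechet_derivative u (at y) b)" for b
    have du: "smooth_on \<Omega> (du b)" for b
      unfolding du_def using Suc.prems by (rule smooth_on_frechet_derivative)
    have du_lin: "linear (\<lambda>b. du b y)" if "y \<in> \<Omega>" for y
      unfolding du_def using smooth_on_linear_frechet_derivative[OF Suc.prems that] .
    \<comment> \<open>\<open>leibniz_rule\<close> wants the derivative as a bounded linear map
      depending continuously on \<open>y\<close> and \<open>s\<close>. Assembled over
      \<open>Basis\<close>, its continuity is visible.\<close>
    define F where "F y s = (\<Sum>b\<in>Basis. (s ^ j * du b (?L y s) - (e \<bullet> b) * (s ^ (Suc j) * du e (?L y s)))
      *\<^sub>R blinfun_inner_left b)" for y s
    have F: "blinfun_apply (F y s) v = s ^ j * du v (?L y s) - (e \<bullet> v) * (s ^ (Suc j) * du e (?L y s))"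
      if "y \<in> ball y0 r" "s \<in> {0..1}" for y s v
    proof -
      have 1: "du v (?L y s) = (\<Sum>b\<in>Basis. (v \<bullet> b) *\<^sub>R du b (?L y s))"
        by (rule linear_expand_Basis[OF du_lin[OF assms(3)[OF that]]])
      have 2: "e \<bullet> v = (\<Sum>b\<in>Basis. (v \<bullet> b) * (e \<bullet> b))"
        by (subst euclidean_inner) (simp add: mult.commute)
      show ?thesis
        unfolding F_def blinfun.sum_left blinfun.scaleR_left blinfun_inner_left.rep_eq 1 2
        by (simp add: left_diff_distrib right_diff_distrib sum_distrib_left sum_distrib_right sum_subtractf inner_commute mult_ac)
    qed
    have int: "(\<lambda>s. s ^ i * v (?L y s)) integrable_on {0..1}"
      if "smooth_on \<Omega> v" "y \<in> ball y0 r" for v :: "'e \<Rightarrow> real" and y i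
    proof (rule integrable_continuous_real)
      have "continuous_on {0..1} (\<lambda>s. v (?L y s))"
        using continuous_on_compose2[OF cont[OF that(1)] pr, of y] that(2) by (auto simp: image_subset_iff)
      then show "continuous_on {0..1} (\<lambda>s. s ^ i * v (?L y s))"
        by (intro continuous_intros)
    qed
    have contF: "continuous_on (ball y0 r \<times> {0..1}) (\<lambda>(y, s). F y s)"
      unfolding F_def split_beta by (intro continuous_intros cont du)
    have der: "((\<lambda>y. integral {0..1} (\<lambda>s. s ^ j * u (?L y s))) has_derivative
        (\<lambda>v. integral {0..1} (\<lambda>s. s ^ j * du v (?L y s)) -
          (e \<bullet> v) * integral {0..1} (\<lambda>s. s ^ (Suc j) * du e (?L y s)))) (at y)"
      if y: "y \<in> ball y0 r" for y
    proof -
      have "((\<lambda>y. integral (cbox 0 1) (\<lambda>s. s ^ j * u (?L y s))) has_derivative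
          blinfun_apply (integral (cbox 0 1) (F y))) (at y within ball y0 r)"
      proof (rule leibniz_rule[OF _ _ _ y])
        fix x and s :: real assume x: "x \<in> ball y0 r" and "s \<in> cbox 0 1"
        then have s: "s \<in> {0..1}" by simp
        have "((\<lambda>x. u (?L x s)) has_derivative
            (\<lambda>v. frechet_derivative u (at (?L x s)) (v - (s * (e \<bullet> v)) *\<^sub>R e))) (at x)"
          by (rule has_derivative_compose[where f = "\<lambda>x. ?L x s" and g = u, OF _ smooth_on_has_derivative[OF Suc.prems assms(3)[OF x s]]])
            (auto intro!: derivative_eq_intros)
        moreover have "frechet_derivative u (at (?L x s)) (v - (s * (e \<bullet> v)) *\<^sub>R e) =
            du v (?L x s) - s * (e \<bullet> v) * du e (?L x s)" for v
          using du_lin[OF assms(3)[OF x s]] unfolding du_def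
          by (simp add: linear_diff linear_cmul)
        ultimately have "((\<lambda>x. u (?L x s)) has_derivative
            (\<lambda>v. du v (?L x s) - s * (e \<bullet> v) * du e (?L x s))) (at x)"
          by simp
        then have "((\<lambda>x. s ^ j * u (?L x s)) has_derivative
            (\<lambda>v. s ^ j * (du v (?L x s) - s * (e \<bullet> v) * du e (?L x s)))) (at x)"
          by (rule has_derivative_mult_right)
        moreover have "(\<lambda>v. s ^ j * (du v (?L x s) - s * (e \<bullet> v) * du e (?L x s))) = blinfun_apply (F x s)"
          using F[OF x s] by (auto simp: algebra_simps)
        ultimately have "((\<lambda>x. s ^ j * u (?L x s)) has_derivative blinfun_apply (F x s)) (at x)"
          by (simp only:)
        then show "((\<lambda>x. s ^ j * u (?L x s)) has_derivative blinfun_apply (F x s)) (at x within ball y0 r)"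
          by (rule has_derivative_at_withinI)
      next
        show "(\<lambda>s. s ^ j * u (?L x s)) integrable_on cbox 0 1" if "x \<in> ball y0 r" for x
          using int[OF Suc.prems that] by simp
        show "continuous_on (ball y0 r \<times> cbox 0 1) (\<lambda>(y, s). F y s)"
          using contF by simp
      qed auto
      moreover
      have "blinfun_apply (integral (cbox 0 1) (F y)) v =
          integral {0..1} (\<lambda>s. s ^ j * du v (?L y s)) -
            (e \<bullet> v) * integral {0..1} (\<lambda>s. s ^ (Suc j) * du e (?L y s))" for v
      proof -
        have "F y integrable_on cbox 0 1"
        proof (rule integrable_continuous)
          show "continuous_on (cbox 0 1) (F y)"
            using continuous_on_compose2[OF contF pr, of y] y by (auto simp: image_subset_iff)
        qed
        then have "blinfun_apply (integral (cbox 0 1) (F y)) v = integral (cbox 0 1) (\<lambda>s. blinfun_apply (F y s) v)"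
          by (rule blinfun_apply_integral)
        also have "\<dots> = integral {0..1} (\<lambda>s. s ^ j * du v (?L y s) - (e \<bullet> v) * (s ^ (Suc j) * du e (?L y s)))"
          using F[OF y] by (auto intro!: integral_cong)
        also have "\<dots> = integral {0..1} (\<lambda>s. s ^ j * du v (?L y s)) -
            integral {0..1} (\<lambda>s. (e \<bullet> v) * (s ^ (Suc j) * du e (?L y s)))"
          by (rule integral_diff[OF int[OF du y] integrable_on_mult_right[OF int[OF du y]]])
        finally show ?thesis
          by (simp only: integral_mult_right)
      qed
      then have "blinfun_apply (integral (cbox 0 1) (F y)) =
          (\<lambda>v. integral {0..1} (\<lambda>s. s ^ j * du v (?L y s)) -
            (e \<bullet> v) * integral {0..1} (\<lambda>s. s ^ (Suc j) * du e (?L y s)))"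
        by (rule ext)
      ultimately show ?thesis
        unfolding at_within_open[OF y open_ball] cbox_interval by (simp only:)
    qed
    show ?case
    proof (rule Ck_on_SucI[OF open_ball der])
      fix v
      have "Ck_on k (\<lambda>y. integral {0..1} (\<lambda>s. s ^ j * du v (?L y s)) +
          - (e \<bullet> v) * integral {0..1} (\<lambda>s. s ^ (Suc j) * du e (?L y s))) (ball y0 r)"
        by (intro Ck_on_add Ck_on_bounded_linear[OF bounded_linear_mult_right] Suc.IH[OF du] open_ball)
      then show "Ck_on k (\<lambda>y. integral {0..1} (\<lambda>s. s ^ j * du v (?L y s)) -
          (e \<bullet> v) * integral {0..1} (\<lambda>s. s ^ (Suc j) * du e (?L y s))) (ball y0 r)"
        by simp
    qed
  }
qed

text \<open>The map replaces the \<open>e\<close>-component of \<open>x\<close> by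
  \<open>\<phi> x\<close> and keeps the part orthogonal to \<open>e\<close>, so that
  \<open>\<phi>\<close> becomes a linear coordinate. Its derivative is invertible wherever the
  derivative of \<open>\<phi>\<close> along \<open>e\<close> is nonzero.\<close>

lemma smooth_straightening:
  fixes \<phi> :: "'e::euclidean_space \<Rightarrow> real"
  assumes "open \<Omega>" "smooth_on \<Omega> \<phi>" "p \<in> \<Omega>" "norm e = 1" "frechet_derivative \<phi> (at p) e \<noteq> 0"
  obtains U V \<Psi> where "open U" "U \<subseteq> \<Omega>" "p \<in> U" "open V"
    "homeomorphism U V (\<lambda>x. x + (\<phi> x - e \<bullet> x) *\<^sub>R e) \<Psi>" "smooth_on V \<Psi>"
proof -
  let ?\<Phi> = "\<lambda>x. x + (\<phi> x - e \<bullet> x) *\<^sub>R e"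
  define d\<phi> where "d\<phi> v x = frechet_derivative \<phi> (at x) v" for v x
  have ee: "e \<bullet> e = 1"
    using assms(4) by (simp add: dot_square_norm)
  have d\<phi>: "smooth_on \<Omega> (d\<phi> v)" for v
    unfolding d\<phi>_def using assms(2) by (rule smooth_on_frechet_derivative)
  have d\<phi>_lin: "linear (\<lambda>v. d\<phi> v x)" if "x \<in> \<Omega>" for x
    unfolding d\<phi>_def using smooth_on_linear_frechet_derivative[OF assms(2) that] .
  define \<Omega>0 where "\<Omega>0 = \<Omega> \<inter> d\<phi> e -` (- {0})"
  have \<Omega>0: "open \<Omega>0" "p \<in> \<Omega>0" "\<Omega>0 \<subseteq> \<Omega>"
    using continuous_open_preimage[OF smooth_on_imp_continuous_on[OF d\<phi>] assms(1), of "- {0}" e] assms(3,5)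
    by (auto simp: \<Omega>0_def d\<phi>_def)
  define f' where "f' x = id_blinfun +
    (\<Sum>b\<in>Basis. (d\<phi> b x - e \<bullet> b) *\<^sub>R (blinfun_scaleR_left e o\<^sub>L blinfun_inner_left b))" for x
  have f': "blinfun_apply (f' x) v = v + (d\<phi> v x - e \<bullet> v) *\<^sub>R e" if "x \<in> \<Omega>" for x v
  proof -
    have 1: "d\<phi> v x = (\<Sum>b\<in>Basis. (v \<bullet> b) *\<^sub>R d\<phi> b x)"
      by (rule linear_expand_Basis[OF d\<phi>_lin[OF that]])
    have 2: "e \<bullet> v = (\<Sum>b\<in>Basis. (v \<bullet> b) * (e \<bullet> b))"
      by (subst euclidean_inner) (simp add: mult.commute)
    have "d\<phi> v x - e \<bullet> v = (\<Sum>b\<in>Basis. (d\<phi> b x - e \<bullet> b) * (v \<bullet> b))"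
      unfolding 1 2 sum_subtractf[symmetric] by (rule sum.cong) (auto simp: algebra_simps)
    then have "(d\<phi> v x - e \<bullet> v) *\<^sub>R e = (\<Sum>b\<in>Basis. (d\<phi> b x - e \<bullet> b) *\<^sub>R (v \<bullet> b) *\<^sub>R e)"
      by (simp only: scaleR_sum_left scaleR_scaleR)
    then show ?thesis
      unfolding f'_def blinfun.add_left blinfun.sum_left blinfun.scaleR_left
      by (simp add: blinfun_inner_left.rep_eq inner_commute)
  qed
  have der: "(?\<Phi> has_derivative blinfun_apply (f' x)) (at x)" if "x \<in> \<Omega>" for x
  proof -
    have "(?\<Phi> has_derivative (\<lambda>v. v + (d\<phi> v x - e \<bullet> v) *\<^sub>R e)) (at x)"
      unfolding d\<phi>_def
      by (auto intro!: derivative_eq_intros smooth_on_has_derivative[OF assms(2) that])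
    moreover have "blinfun_apply (f' x) = (\<lambda>v. v + (d\<phi> v x - e \<bullet> v) *\<^sub>R e)"
      using f'[OF that] by auto
    ultimately show ?thesis by simp
  qed
  \<comment> \<open>The inverse of \<open>f' x\<close>: a preimage of \<open>w\<close> has the form
    w + t e, and since the \<open>e\<close>-component of \<open>f' x v\<close> is
    \<open>d\<phi> v x\<close>, the number t solves d\<phi>(w) + t d\<phi>(e) = e . w.\<close>
  define k where "k x w = w + ((e \<bullet> w - d\<phi> w x) / d\<phi> e x) *\<^sub>R e" for x w
  have d\<phi>_e: "d\<phi> e x \<noteq> 0" if "x \<in> \<Omega>0" for x
    using that by (simp add: \<Omega>0_def)
  have d\<phi>_add: "d\<phi> (v + a *\<^sub>R e) x = d\<phi> v x + a * d\<phi> e x" if "x \<in> \<Omega>0" for x v a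
    using linear_add[OF d\<phi>_lin[of x], of v "a *\<^sub>R e"] linear_cmul[OF d\<phi>_lin[of x], of a e] that \<Omega>0(3) by auto
  have k1: "f' x (k x w) = w" if "x \<in> \<Omega>0" for x w
    using that \<Omega>0(3) d\<phi>_e[OF that] by (simp add: f' subsetD k_def d\<phi>_add inner_add_right ee field_simps
        scaleR_add_left[symmetric] add_divide_distrib[symmetric])
  have k2: "k x (f' x w) = w" if "x \<in> \<Omega>0" for x w
  proof -
    have 1: "f' x w = w + (d\<phi> w x - e \<bullet> w) *\<^sub>R e"
      using that \<Omega>0(3) f' by blast
    have 2: "e \<bullet> (w + (d\<phi> w x - e \<bullet> w) *\<^sub>R e) = d\<phi> w x"
      by (simp add: inner_add_right ee)
    have 3: "(d\<phi> w x - (d\<phi> w x + (d\<phi> w x - e \<bullet> w) * d\<phi> e x)) / d\<phi> e x = e \<bullet> w - d\<phi> w x"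
      using d\<phi>_e[OF that] by simp
    show ?thesis
      unfolding k_def 1 2 d\<phi>_add[OF that] 3 by (simp add: scaleR_left_diff_distrib)
  qed
  have "linear (\<lambda>w. (e \<bullet> w - d\<phi> w p) / d\<phi> e p)"
    by (rule linearI) (auto simp: linear_add[OF d\<phi>_lin[OF assms(3)]] linear_cmul[OF d\<phi>_lin[OF assms(3)]]
      inner_add_right diff_divide_distrib add_divide_distrib right_diff_distrib)
  from linear_add[OF this] linear_cmul[OF this] have "linear (k p)"
    unfolding k_def by (intro linearI) (simp_all add: algebra_simps)
  then have inv: "Blinfun (k p) o\<^sub>L f' p = id_blinfun"
    using k2[OF \<Omega>0(2)] by (intro blinfun_eqI) (simp add: bounded_linear_Blinfun_apply linear_conv_bounded_linear)
  have contf: "continuous_on \<Omega>0 f'"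
    unfolding f'_def
    by (intro continuous_intros continuous_on_subset[OF smooth_on_imp_continuous_on[OF d\<phi>] \<Omega>0(3)])
  have der0: "(?\<Phi> has_derivative blinfun_apply (f' x)) (at x)" if "x \<in> \<Omega>0" for x
    using der that \<Omega>0(3) by blast
  obtain U V \<Psi> g' where *: "open U" "U \<subseteq> \<Omega>0" "p \<in> U" "open V" "homeomorphism U V ?\<Phi> \<Psi>"
    "\<And>y. y \<in> V \<Longrightarrow> (\<Psi> has_derivative (g' y)) (at y)"
    "\<And>y. y \<in> V \<Longrightarrow> g' y = inv (blinfun_apply (f'(\<Psi> y)))"
    "\<And>y. y \<in> V \<Longrightarrow> bij (blinfun_apply (f'(\<Psi> y)))"
    by (rule inverse_function_theorem[OF \<Omega>0(1) der0 contf \<Omega>0(2) inv]) (assumption | rule that)+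
  have im: "\<Psi> ` V \<subseteq> \<Omega>0"
    using *(2,5) by (auto simp: homeomorphism_def)
  have g': "g' y w = k (\<Psi> y) w" if "y \<in> V" for y w
    unfolding *(7)[OF that]
    using *(8)[OF that] k1[of "\<Psi> y" w] im that by (intro inv_f_eq) (auto simp: bij_def)
  \<comment> \<open>Bootstrapping: the derivative of \<open>\<Psi>\<close> at \<open>y\<close> is a
    rational expression in values of \<open>d\<phi>\<close> at \<open>\<Psi> y\<close>, so each
    order of regularity of \<open>\<Psi>\<close> yields the next.\<close>
  have "Ck_on j \<Psi> V" for j
  proof (induction j)
    case 0
    then show ?case
      using *(5) by (auto simp: homeomorphism_def)
  next
    case (Suc j)
    have c: "Ck_on j (\<lambda>y. d\<phi> v (\<Psi> y)) V" for v
      using d\<phi>[of v] smooth_on_subset[OF _ \<Omega>0(3)]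
      by (intro Ck_on_compose[OF *(4) \<Omega>0(1) im Suc]) (auto simp: smooth_on_def)
    show ?case
    proof (rule Ck_on_SucI[OF *(4,6)])
      fix w
      have "Ck_on j (\<lambda>y. w + ((e \<bullet> w + - d\<phi> w (\<Psi> y)) * inverse (d\<phi> e (\<Psi> y))) *\<^sub>R e) V"
        by (intro Ck_on_add *(4) Ck_on_const c Ck_on_bounded_linear[OF bounded_linear_scaleR_left]
            Ck_on_bounded_bilinear[OF bounded_bilinear_mult] Ck_on_inverse
            Ck_on_bounded_linear[OF bounded_linear_minus[OF bounded_linear_ident]])
          (use im d\<phi>_e in auto)
      then show "Ck_on j (\<lambda>y. g' y w) V"
        by (rule Ck_on_cong[OF *(4), rotated]) (simp add: g' k_def divide_inverse)
    qed auto
  qed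
  then show thesis
    using that[of U V \<Psi>] * \<Omega>0(3) by (auto simp: smooth_on_def)
qed

text \<open>Hadamard's lemma: in coordinates straightening \<open>\<phi>\<close>, the quotient is
  \<open>\<integral>\<^sub>0\<^sup>1 \<partial>\<^sub>e h (y - s (e \<bullet> y) e) ds\<close>.\<close>

lemma smooth_division_local:
  fixes h \<phi> :: "'e::euclidean_space \<Rightarrow> real"
  assumes "open \<Omega>" "smooth_on \<Omega> h" "smooth_on \<Omega> \<phi>"
    and "\<And>x. x \<in> \<Omega> \<Longrightarrow> \<phi> x = 0 \<Longrightarrow> h x = 0"
    and "p \<in> \<Omega>" "\<phi> p = 0" "frechet_derivative \<phi> (at p) v \<noteq> 0"
  obtains T q where "open T" "p \<in> T" "T \<subseteq> \<Omega>" "smooth_on T q" "\<And>x. x \<in> T \<Longrightarrow> h x = \<phi> x * q x"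
proof -
  define e where "e = v /\<^sub>R norm v"
  have lin: "linear (frechet_derivative \<phi> (at p))"
    by (rule smooth_on_linear_frechet_derivative[OF assms(3,5)])
  then have "v \<noteq> 0"
    using assms(7) linear_0 by blast
  then have e: "norm e = 1" "frechet_derivative \<phi> (at p) e \<noteq> 0"
    using assms(7) by (auto simp: e_def linear_cmul[OF lin])
  have ee: "e \<bullet> e = 1"
    using e(1) by (simp add: dot_square_norm)
  let ?\<Phi> = "\<lambda>x. x + (\<phi> x - e \<bullet> x) *\<^sub>R e"
  obtain U V \<Psi> where *: "open U" "U \<subseteq> \<Omega>" "p \<in> U" "open V" "homeomorphism U V ?\<Phi> \<Psi>" "smooth_on V \<Psi>"
    using smooth_straightening[OF assms(1,3,5) e] by blast
  have e\<Phi>: "e \<bullet> ?\<Phi> x = \<phi> x" for x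
    by (simp add: inner_add_right ee)
  have \<Phi>V: "?\<Phi> x \<in> V" "\<Psi> (?\<Phi> x) = x" if "x \<in> U" for x
    using *(5) that by (auto simp: homeomorphism_def)
  have \<Psi>U: "\<Psi> y \<in> U" "?\<Phi> (\<Psi> y) = y" if "y \<in> V" for y
    using *(5) that by (auto simp: homeomorphism_def)
  define u where "u y = h (\<Psi> y)" for y
  have u: "smooth_on V u"
    unfolding u_def using \<Psi>U *(2) by (intro smooth_on_compose[OF *(4) assms(1) _ *(6) assms(2)]) auto
  define du where "du y = frechet_derivative u (at y) e" for y
  have du: "smooth_on V du"
    unfolding du_def by (rule smooth_on_frechet_derivative[OF u])
  define y0 where "y0 = ?\<Phi> p"
  have y0: "y0 \<in> V" "e \<bullet> y0 = 0"
    unfolding y0_def e\<Phi> using \<Phi>V(1)[OF *(3)] assms(6) by auto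
  then obtain \<epsilon> where \<epsilon>: "\<epsilon> > 0" "ball y0 \<epsilon> \<subseteq> V"
    using *(4) open_contains_ball by blast
  let ?L = "\<lambda>y s. y - (s * (e \<bullet> y)) *\<^sub>R e"
  \<comment> \<open>As \<open>e \<bullet> y0 = 0\<close>, sliding \<open>y\<close> along
    \<open>e\<close> towards the hyperplane at most doubles its distance from \<open>y0\<close>;
    hence the halved radius.\<close>
  have LV: "?L y s \<in> V" if "y \<in> ball y0 (\<epsilon> / 2)" "s \<in> {0..1}" for y s
  proof -
    have eq: "?L y s - y0 = (y - y0) - (s * (e \<bullet> (y - y0))) *\<^sub>R e"
      using y0(2) by (simp add: inner_diff_right)
    have "norm (?L y s - y0) \<le> norm (y - y0) + \<bar>s\<bar> * \<bar>e \<bullet> (y - y0)\<bar>"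
      unfolding eq using norm_triangle_ineq4[of "y - y0" "(s * (e \<bullet> (y - y0))) *\<^sub>R e"] e(1) by (simp add: abs_mult)
    also have "\<dots> \<le> norm (y - y0) + 1 * norm (y - y0)"
      using that(2) Cauchy_Schwarz_ineq2[of e "y - y0"] e(1) by (intro add_left_mono mult_mono) auto
    also have "\<dots> < \<epsilon>"
      using that(1) by (simp add: dist_norm norm_minus_commute)
    finally show ?thesis
      using \<epsilon>(2) by (auto simp: dist_norm norm_minus_commute)
  qed
  define I where "I y = integral {0..1} (\<lambda>s. du (?L y s))" for y
  have I: "smooth_on (ball y0 (\<epsilon> / 2)) I"
    using Ck_on_integral_projected_segment[OF *(4) du LV, of y0 "\<epsilon> / 2" _ 0]
    by (simp add: smooth_on_def I_def[abs_def])
  have uI: "u y = (e \<bullet> y) * I y" if y: "y \<in> ball y0 (\<epsilon> / 2)" for y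
  proof -
    have "((\<lambda>s. - (e \<bullet> y) * du (?L y s)) has_integral (u (?L y 1) - u (?L y 0))) {0..1}"
    proof (rule fundamental_theorem_of_calculus)
      fix s :: real assume s: "s \<in> {0..1}"
      have "((\<lambda>s. u (?L y s)) has_derivative
          (\<lambda>t. frechet_derivative u (at (?L y s)) (- (t * (e \<bullet> y)) *\<^sub>R e))) (at s)"
        by (rule has_derivative_compose[where f = "\<lambda>s. ?L y s" and g = u,
              OF _ smooth_on_has_derivative[OF u LV[OF y s]]])
          (auto intro!: derivative_eq_intros)
      then have "((\<lambda>s. u (?L y s)) has_derivative (\<lambda>t. t *\<^sub>R (- (e \<bullet> y) * du (?L y s)))) (at s)"
        unfolding du_def linear_cmul[OF smooth_on_linear_frechet_derivative[OF u LV[OF y s]]]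
        by (simp add: mult.assoc)
      then show "((\<lambda>s. u (?L y s)) has_vector_derivative - (e \<bullet> y) * du (?L y s)) (at s within {0..1})"
        unfolding has_vector_derivative_def by (rule has_derivative_at_withinI)
    qed auto
    then have "integral {0..1} (\<lambda>s. - (e \<bullet> y) * du (?L y s)) = u (?L y 1) - u (?L y 0)"
      by (rule integral_unique)
    then have 1: "- (e \<bullet> y) * I y = u (?L y 1) - u y"
      unfolding I_def integral_mult_right by simp
    have L1: "?L y 1 \<in> V"
      by (rule LV[OF y]) simp
    \<comment> \<open>At \<open>s = 1\<close> the \<open>e\<close>-component is zero, so this end of
      the segment corresponds to a zero of \<open>\<phi>\<close>, where \<open>h\<close>
      vanishes.\<close>
    have "\<phi> (\<Psi> (?L y 1)) = e \<bullet> ?L y 1"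
      using e\<Phi>[of "\<Psi> (?L y 1)"] \<Psi>U(2)[OF L1] by simp
    also have "\<dots> = 0"
      by (simp add: inner_diff_right ee)
    finally have "u (?L y 1) = 0"
      unfolding u_def using \<Psi>U(1)[OF L1] *(2) assms(4) by blast
    then show ?thesis
      using 1 by simp
  qed
  have \<Phi>_smooth: "smooth_on U ?\<Phi>"
    by (intro smooth_on_add smooth_on_ident smooth_on_scaleR smooth_on_diff smooth_on_inner smooth_on_const
        smooth_on_subset[OF assms(3) *(2)] *(1))
  define T where "T = U \<inter> ?\<Phi> -` ball y0 (\<epsilon> / 2)"
  have T: "open T" "p \<in> T" "T \<subseteq> U"
    unfolding T_def
    using continuous_open_preimage[OF smooth_on_imp_continuous_on[OF \<Phi>_smooth] *(1) open_ball] *(3) \<epsilon>(1)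
    by (auto simp: y0_def)
  show thesis
  proof (rule that[OF T(1,2)])
    show "T \<subseteq> \<Omega>"
      using T(3) *(2) by blast
    show "smooth_on T (\<lambda>x. I (?\<Phi> x))"
      by (rule smooth_on_compose[OF T(1) open_ball _ smooth_on_subset[OF \<Phi>_smooth T(3)] I]) (auto simp: T_def)
    show "h x = \<phi> x * I (?\<Phi> x)" if "x \<in> T" for x
      using uI[of "?\<Phi> x"] that \<Phi>V[of x] unfolding e\<Phi> by (simp add: T_def u_def)
  qed
qed

text \<open>No partition of unity is needed, because local quotients are forced to agree: off the
  zeros they are h/\<phi>, and at a zero differentiating h = \<phi> r in a direction where \<phi>
  has nonzero derivative determines r. The function \<open>q\<close> is defined by these two
  formulas, with the direction chosen point by point, and is smooth because it agrees with every
  local quotient.\<close>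

lemma smooth_division:
  fixes h \<phi> :: "'e::euclidean_space \<Rightarrow> real"
  assumes "open \<Omega>" "smooth_on \<Omega> h" "smooth_on \<Omega> \<phi>"
    and "\<And>x. x \<in> \<Omega> \<Longrightarrow> \<phi> x = 0 \<Longrightarrow> h x = 0"
    and "\<And>x. x \<in> \<Omega> \<Longrightarrow> \<phi> x = 0 \<Longrightarrow> \<exists>v. frechet_derivative \<phi> (at x) v \<noteq> 0"
  obtains q where "smooth_on \<Omega> q" "\<And>x. x \<in> \<Omega> \<Longrightarrow> h x = \<phi> x * q x"
proof -
  define e where "e x = (SOME v. frechet_derivative \<phi> (at x) v \<noteq> 0)" for x
  have e: "frechet_derivative \<phi> (at x) (e x) \<noteq> 0" if "x \<in> \<Omega>" "\<phi> x = 0" for x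
    unfolding e_def using assms(5)[OF that] by (rule someI_ex)
  define q where "q x = (if \<phi> x = 0 then frechet_derivative h (at x) (e x) / frechet_derivative \<phi> (at x) (e x)
    else h x / \<phi> x)" for x
  have "\<exists>T. open T \<and> p \<in> T \<and> smooth_on T q" if p: "p \<in> \<Omega>" for p
  proof (cases "\<phi> p = 0")
    case True
    obtain T r where T: "open T" "p \<in> T" "T \<subseteq> \<Omega>" "smooth_on T r" "\<And>x. x \<in> T \<Longrightarrow> h x = \<phi> x * r x"
      using smooth_division_local[OF assms(1-4) p True e[OF p True]] by metis
    have "r x = q x" if "x \<in> T" for x
    proof (cases "\<phi> x = 0")
      case True
      have x: "x \<in> \<Omega>"
        using that T(3) by blast
      have "((\<lambda>x. \<phi> x * r x) has_derivative (\<lambda>v. \<phi> x * frechet_derivative r (at x) v +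
          frechet_derivative \<phi> (at x) v * r x)) (at x)"
        by (rule has_derivative_mult[OF smooth_on_has_derivative[OF assms(3) x]
              smooth_on_has_derivative[OF T(4) that]])
      then have "(h has_derivative (\<lambda>v. \<phi> x * frechet_derivative r (at x) v +
          frechet_derivative \<phi> (at x) v * r x)) (at x)"
        by (rule has_derivative_transform_within_open[OF _ T(1) that]) (simp add: T(5))
      then have "frechet_derivative h (at x) (e x) = frechet_derivative \<phi> (at x) (e x) * r x"
        using True by (simp flip: frechet_derivative_at)
      then show ?thesis
        using True e[OF x True] by (simp add: q_def)
    next
      case False
      then show ?thesis
        using T(5)[OF that] by (simp add: q_def)
    qed
    then show ?thesis
      using smooth_on_cong[OF T(1) _ T(4)] T(1,2) by blast
  next
    case False
    define T where "T = \<Omega> \<inter> \<phi> -` (- {0})"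
    have T: "open T" "p \<in> T" "T \<subseteq> \<Omega>"
      using continuous_open_preimage[OF smooth_on_imp_continuous_on[OF assms(3)] assms(1), of "- {0}"] False p
      by (auto simp: T_def)
    have "smooth_on T (\<lambda>x. h x * inverse (\<phi> x))"
      by (intro smooth_on_mult smooth_on_inverse T(1) smooth_on_subset[OF assms(2) T(3)]
          smooth_on_subset[OF assms(3) T(3)]) (auto simp: T_def)
    then have "smooth_on T q"
      by (rule smooth_on_cong[OF T(1), rotated]) (auto simp: q_def T_def divide_inverse)
    then show ?thesis
      using T by blast
  qed
  then have "smooth_on \<Omega> q"
    by (rule smooth_on_local)
  moreover have "h x = \<phi> x * q x" if "x \<in> \<Omega>" for x
    using assms(4)[OF that] by (simp add: q_def)
  ultimately show thesis
    using that by blast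
qed


section \<open>Symmetric matrix fields on coordinate domains\<close>

lemma bounded_bilinear_matrix_vector_mult:
  "bounded_bilinear ((*v) :: real ^ 'n ^ 'm \<Rightarrow> real ^ 'n \<Rightarrow> real ^ 'm)"
  unfolding bilinear_conv_bounded_bilinear[symmetric] bilinear_def
  by (auto intro!: linearI simp: matrix_vector_mult_def vec_eq_iff sum.distrib sum_distrib_left algebra_simps)

lemmas has_derivative_matrix_vector_mult = bounded_bilinear.FDERIV[OF bounded_bilinear_matrix_vector_mult]
  and matrix_vector_mult_scaleR_left = bounded_bilinear.scaleR_left[OF bounded_bilinear_matrix_vector_mult]
  and matrix_vector_mult_scaleR_right = bounded_bilinear.scaleR_right[OF bounded_bilinear_matrix_vector_mult]
  and matrix_vector_mult_add_left = bounded_bilinear.add_left[OF bounded_bilinear_matrix_vector_mult]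
  and matrix_vector_mult_add_right = bounded_bilinear.add_right[OF bounded_bilinear_matrix_vector_mult]

section \<open>Symmetric matrices and Cramer numerators\<close>

lemma symmetric_matrix_inner:
  fixes M :: "real ^ 'n ^ 'n"
  assumes "transpose M = M"
  shows "v \<bullet> (M *v w) = w \<bullet> (M *v v)"
  using dot_lmul_matrix[of v M w] assms transpose_matrix_vector[of M v] by (simp add: inner_commute)

text \<open>The adjugate of \<open>M\<close> applied to \<open>y\<close>, written by Cramer
  numerators. Being polynomial in the entries it stays smooth where \<open>M\<close> is
  singular.\<close>

definition adjugate_mult :: "real ^ 'n ^ 'n \<Rightarrow> real ^ 'n \<Rightarrow> real ^ 'n" where
  "adjugate_mult M y = (\<chi> k. det (\<chi> i j. if j = k then y $ i else M $ i $ j))"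

lemma matrix_inv:
  fixes M :: "real ^ 'n ^ 'n"
  assumes "det M \<noteq> 0"
  shows "matrix_inv M ** M = mat 1" "M ** matrix_inv M = mat 1"
proof -
  have "\<exists>A. M ** A = mat 1 \<and> A ** M = mat 1"
    using assms by (simp add: invertible_det_nz[symmetric] invertible_def)
  then have "M ** matrix_inv M = mat 1 \<and> matrix_inv M ** M = mat 1"
    unfolding matrix_inv_def by (rule someI_ex)
  then show "matrix_inv M ** M = mat 1" "M ** matrix_inv M = mat 1"
    by auto
qed

lemma adjugate_mult_eq:
  assumes "det M \<noteq> 0"
  shows "adjugate_mult M y = det M *\<^sub>R (matrix_inv M *v y)"
proof -
  have "M *v (matrix_inv M *v y) = y"
    using assms by (simp add: matrix_vector_mul_assoc matrix_inv(2) invertible_det_nz)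
  then have "matrix_inv M *v y = (\<chi> k. det (\<chi> i j. if j = k then y $ i else M $ i $ j) / det M)"
    using cramer[OF assms] by blast
  then show ?thesis
    using assms by (simp add: adjugate_mult_def vec_eq_iff)
qed

text \<open>By symmetry the kernel vector \<open>r\<close> is orthogonal to every column of
  \<open>M\<close>, and it is orthogonal to \<open>y\<close> as well. So it is orthogonal to every
  column after one has been replaced by \<open>y\<close>, and each Cramer determinant
  vanishes.\<close>

lemma adjugate_mult_eq_0:
  fixes M :: "real ^ 'n ^ 'n"
  assumes "transpose M = M" "M *v r = 0" "r \<noteq> 0" "y \<bullet> r = 0"
  shows "adjugate_mult M y = 0"
proof -
  have "det (\<chi> i j. if j = k then y $ i else M $ i $ j) = 0" for k
  proof -
    let ?A = "\<chi> i j. if j = k then y $ i else M $ i $ j"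
    have "(\<Sum>i\<in>UNIV. M $ i $ j * r $ i) = 0" for j
    proof -
      have "(\<Sum>i\<in>UNIV. M $ i $ j * r $ i) = (\<Sum>i\<in>UNIV. M $ j $ i * r $ i)"
        by (rule sum.cong) (use assms(1) in \<open>auto simp: transpose_def vec_eq_iff\<close>)
      also have "\<dots> = (M *v r) $ j"
        by (simp add: matrix_vector_mult_def)
      finally show ?thesis
        using assms(2) by simp
    qed
    then have "(\<Sum>j\<in>UNIV. (if i = k then y $ j else M $ j $ i) * r $ j) = 0" for i
      using assms(4) by (cases "i = k") (simp_all add: inner_vec_def)
    then have "transpose ?A *v r = 0"
      by (simp add: vec_eq_iff matrix_vector_mult_def transpose_def)
    then have "\<not> invertible (transpose ?A)"
      using assms(3) invertible_left_inverse[of "transpose ?A"] matrix_left_invertible_ker by blast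
    then show ?thesis
      by (simp add: invertible_det_nz det_transpose)
  qed
  then show ?thesis
    by (simp add: adjugate_mult_def vec_eq_iff)
qed

lemma smooth_on_adjugate_mult:
  assumes "open S" "smooth_on S M" "smooth_on S y"
  shows "smooth_on S (\<lambda>x. adjugate_mult (M x) (y x))"
proof -
  have "smooth_on S (\<lambda>x. if j = k then y x $ i else M x $ i $ j)" for i j k
    by (cases "j = k") (auto intro!: smooth_on_vec_nth assms)
  then show ?thesis
    unfolding adjugate_mult_def by (intro smooth_on_vec_lambda smooth_on_det assms(1)) auto
qed

text \<open>If the values at \<open>x\<close> differed, Hausdorff separation would give a
  neighbourhood on which they differ throughout, hence on which \<open>\<phi>\<close> vanishes
  identically; then its derivative at \<open>x\<close> would be zero.\<close>

lemma continuous_eq_off_regular_zeros: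
  fixes f f' :: "'e::real_normed_vector \<Rightarrow> 'b::t2_space" and \<phi> :: "'e \<Rightarrow> real"
  assumes "open S" "continuous_on S f" "continuous_on S f'"
    and "\<And>x. x \<in> S \<Longrightarrow> \<phi> x \<noteq> 0 \<Longrightarrow> f x = f' x"
    and "x \<in> S" "\<phi> x = 0 \<Longrightarrow> frechet_derivative \<phi> (at x) v \<noteq> 0"
  shows "f x = f' x"
proof (rule ccontr)
  assume ne: "f x \<noteq> f' x"
  obtain P Q where PQ: "open P" "open Q" "f x \<in> P" "f' x \<in> Q" "P \<inter> Q = {}"
    using hausdorff[OF ne] by blast
  define T where "T = (S \<inter> f -` P) \<inter> (S \<inter> f' -` Q)"
  have T: "open T" "x \<in> T"
    unfolding T_def
    using continuous_open_preimage[OF assms(2,1) PQ(1)] continuous_open_preimage[OF assms(3,1) PQ(2)]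
      PQ(3,4) assms(5) by auto
  have zero: "\<phi> y = 0" if "y \<in> T" for y
    using that PQ(5) assms(4)[of y] by (auto simp: T_def)
  have "((\<lambda>y. 0) has_derivative (\<lambda>v. 0)) (at x)"
    by simp
  then have "(\<phi> has_derivative (\<lambda>v. 0)) (at x)"
    by (rule has_derivative_transform_within_open[OF _ T]) (simp add: zero)
  then have "frechet_derivative \<phi> (at x) v = 0"
    by (simp flip: frechet_derivative_at)
  then show False
    using assms(6) zero[OF T(2)] by simp
qed

section \<open>Christoffel symbols of the first kind of a symmetric matrix field\<close>

definition christoffel ::
    "(real ^ 'n \<Rightarrow> real ^ 'n ^ 'n) \<Rightarrow> real ^ 'n \<Rightarrow> real ^ 'n \<Rightarrow> real ^ 'n \<Rightarrow> real ^ 'n \<Rightarrow> real" where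
  "christoffel G x a b v =
     (b \<bullet> (frechet_derivative G (at x) a *v v) + a \<bullet> (frechet_derivative G (at x) b *v v) -
      a \<bullet> (frechet_derivative G (at x) v *v b)) / 2"

definition christoffel_vec ::
    "(real ^ 'n \<Rightarrow> real ^ 'n ^ 'n) \<Rightarrow> real ^ 'n \<Rightarrow> real ^ 'n \<Rightarrow> real ^ 'n \<Rightarrow> real ^ 'n" where
  "christoffel_vec G x a b = (\<chi> k. christoffel G x a b (axis k 1))"

locale smooth_symmetric_matrix =
  fixes S :: "(real ^ 'n) set" and G :: "real ^ 'n \<Rightarrow> real ^ 'n ^ 'n"
  assumes open_S: "open S" and smooth_G: "smooth_on S G"
    and sym_G: "\<And>x. x \<in> S \<Longrightarrow> transpose (G x) = G x"
begin

lemmas G_has_derivative = smooth_on_has_derivative[OF smooth_G]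

lemmas DG_linear = smooth_on_linear_frechet_derivative[OF smooth_G]

lemma DG_symmetric:
  assumes "x \<in> S"
  shows "transpose (frechet_derivative G (at x) a) = frechet_derivative G (at x) a"
proof -
  have lin: "bounded_linear (transpose :: real ^ 'n ^ 'n \<Rightarrow> real ^ 'n ^ 'n)"
    unfolding linear_conv_bounded_linear[symmetric]
    by (rule linearI) (auto simp: transpose_def vec_eq_iff)
  have "((\<lambda>x. transpose (G x)) has_derivative (\<lambda>a. transpose (frechet_derivative G (at x) a))) (at x)"
    using bounded_linear.has_derivative[OF lin G_has_derivative[OF assms]] .
  then have "(G has_derivative (\<lambda>a. transpose (frechet_derivative G (at x) a))) (at x)"
    by (rule has_derivative_transform_within_open[OF _ open_S assms]) (rule sym_G)
  then show ?thesis
    using frechet_derivative_at by metis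
qed

lemmas DG_inner_commute = symmetric_matrix_inner[OF DG_symmetric]

lemmas G_inner_commute = symmetric_matrix_inner[OF sym_G]

lemma christoffel_commute: "x \<in> S \<Longrightarrow> christoffel G x a b v = christoffel G x b a v"
  using DG_inner_commute[of x a v b] by (simp add: christoffel_def)

lemma christoffel_linear:
  assumes "x \<in> S"
  shows "linear (\<lambda>a. christoffel G x a b v)" "linear (\<lambda>b. christoffel G x a b v)"
    "linear (\<lambda>v. christoffel G x a b v)"
proof -
  note s = linear_add[OF DG_linear[OF assms]] linear_cmul[OF DG_linear[OF assms]]
    matrix_vector_mult_add_left matrix_vector_mult_add_right matrix_vector_mult_scaleR_left
    matrix_vector_mult_scaleR_right inner_add_left inner_add_right
  show "linear (\<lambda>a. christoffel G x a b v)" "linear (\<lambda>b. christoffel G x a b v)"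
    "linear (\<lambda>v. christoffel G x a b v)"
    unfolding christoffel_def by (rule linearI; simp add: s field_simps)+
qed

lemma christoffel_vec_inner:
  assumes "x \<in> S"
  shows "christoffel_vec G x a b \<bullet> v = christoffel G x a b v"
proof -
  have "v = (\<Sum>i\<in>UNIV. v $ i *\<^sub>R axis i 1)"
    by (simp add: vec_eq_iff axis_def if_distrib[of "(*) _"] cong: if_cong)
  then have "christoffel G x a b v = (\<Sum>i\<in>UNIV. christoffel G x a b (v $ i *\<^sub>R axis i 1))"
    using linear_sum[OF christoffel_linear(3)[OF assms, of a b], of "\<lambda>i. v $ i *\<^sub>R axis i 1" UNIV] by simp
  also have "\<dots> = christoffel_vec G x a b \<bullet> v"
    by (simp add: linear_cmul[OF christoffel_linear(3)[OF assms]] christoffel_vec_def inner_vec_def mult.commute)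
  finally show ?thesis by simp
qed

text \<open>Metric compatibility in coordinates. It serves to exchange the last two slots, and so to
  move \<open>R\<close> into the slot where the symbol computes \<open>II\<close>.\<close>

lemma christoffel_metric:
  assumes "x \<in> S"
  shows "christoffel G x a b c + christoffel G x a c b = b \<bullet> (frechet_derivative G (at x) a *v c)"
  using DG_inner_commute[OF assms, of a b c] DG_inner_commute[OF assms, of b a c]
    DG_inner_commute[OF assms, of c a b]
  by (simp add: christoffel_def field_simps)

lemma smooth_on_christoffel:
  assumes "open T" "T \<subseteq> S" "smooth_on T a" "smooth_on T b" "smooth_on T v"
  shows "smooth_on T (\<lambda>x. christoffel G x (a x) (b x) (v x))"
proof -
  have "smooth_on T (\<lambda>x. (b x \<bullet> (frechet_derivative G (at x) (a x) *v v x) +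
      a x \<bullet> (frechet_derivative G (at x) (b x) *v v x) -
      a x \<bullet> (frechet_derivative G (at x) (v x) *v b x)) * inverse 2)"
    by (intro smooth_on_mult smooth_on_diff smooth_on_add smooth_on_inner smooth_on_matrix_vector_mult
        smooth_on_frechet_derivative_apply smooth_on_const smooth_on_subset[OF smooth_G] assms)
  then show ?thesis
    unfolding christoffel_def divide_inverse .
qed

lemma smooth_on_christoffel_vec:
  assumes "open T" "T \<subseteq> S" "smooth_on T a" "smooth_on T b"
  shows "smooth_on T (\<lambda>x. christoffel_vec G x (a x) (b x))"
  unfolding christoffel_vec_def
  by (intro smooth_on_vec_lambda smooth_on_christoffel smooth_on_const assms)

lemma has_derivative_inner_G:
  assumes "x \<in> S" "(b has_derivative b') (at x)" "(c has_derivative c') (at x)"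
  shows "((\<lambda>x. b x \<bullet> (G x *v c x)) has_derivative
    (\<lambda>v. b' v \<bullet> (G x *v c x) + b x \<bullet> (frechet_derivative G (at x) v *v c x) + b x \<bullet> (G x *v c' v))) (at x)"
  using has_derivative_inner[OF assms(2)
      has_derivative_matrix_vector_mult[OF G_has_derivative[OF assms(1)] assms(3)]]
  by (rule has_derivative_eq_rhs) (auto simp: inner_add_right)

text \<open>By the product rule and the symmetry of \<open>G\<close> the derivatives of the three
  fields cancel in pairs, except that of \<open>b\<close> in direction \<open>a\<close>, which
  occurs twice; the derivatives of \<open>G\<close> form the symbol.\<close>

lemma koszul_chart:
  assumes x: "x \<in> S" and a: "(a has_derivative a') (at x)" and b: "(b has_derivative b') (at x)"
    and c: "(c has_derivative c') (at x)"
  shows "frechet_derivative (\<lambda>x. b x \<bullet> (G x *v c x)) (at x) (a x) +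
      frechet_derivative (\<lambda>x. c x \<bullet> (G x *v a x)) (at x) (b x) -
      frechet_derivative (\<lambda>x. a x \<bullet> (G x *v b x)) (at x) (c x) +
      (b' (a x) - a' (b x)) \<bullet> (G x *v c x) - (c' (b x) - b' (c x)) \<bullet> (G x *v a x) +
      (a' (c x) - c' (a x)) \<bullet> (G x *v b x) =
    2 * (b' (a x) \<bullet> (G x *v c x) + christoffel G x (a x) (b x) (c x))"
  unfolding has_derivative_inner_G[OF x b c, THEN frechet_derivative_at, symmetric]
    has_derivative_inner_G[OF x c a, THEN frechet_derivative_at, symmetric]
    has_derivative_inner_G[OF x a b, THEN frechet_derivative_at, symmetric] christoffel_def
  using G_inner_commute[OF x, of "b x" "c' (a x)"] G_inner_commute[OF x, of "c x" "a' (b x)"]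
    G_inner_commute[OF x, of "a x" "b' (c x)"] DG_inner_commute[OF x, of "b x" "c x" "a x"]
    DG_inner_commute[OF x, of "c x" "b x" "a x"]
  by (simp add: inner_diff_left field_simps)

lemma adjugate_mult_neq_0:
  assumes x: "x \<in> S" and reg: "\<And>y. y \<in> S \<Longrightarrow> det (G y) = 0 \<Longrightarrow>
      \<exists>v. frechet_derivative (\<lambda>y. det (G y)) (at y) v \<noteq> 0"
    and r: "G x *v r = 0" "det (G x) = 0" and y: "y \<bullet> r \<noteq> 0"
  shows "adjugate_mult (G x) y \<noteq> 0"
proof
  let ?\<phi> = "\<lambda>x. det (G x)" and ?h = "\<lambda>x. adjugate_mult (G x) y"
  assume 0: "adjugate_mult (G x) y = 0"
  obtain v where v: "frechet_derivative ?\<phi> (at x) v \<noteq> 0"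
    using reg[OF x r(2)] by blast
  have \<phi>: "smooth_on S ?\<phi>" and h: "smooth_on S ?h"
    using smooth_on_det[OF open_S smooth_G] smooth_on_adjugate_mult[OF open_S smooth_G] by auto
  \<comment> \<open>Where the determinant is nonzero this is the inverse matrix at work; the
    singular points are limits of such points.\<close>
  have eq: "G z *v ?h z = ?\<phi> z *\<^sub>R y" if z: "z \<in> S" for z
  proof -
    obtain w where w: "?\<phi> z = 0 \<Longrightarrow> frechet_derivative ?\<phi> (at z) w \<noteq> 0"
      using reg[OF z] by blast
    show ?thesis
    proof (rule continuous_eq_off_regular_zeros[OF open_S _ _ _ z w])
      show "continuous_on S (\<lambda>z. G z *v ?h z)" "continuous_on S (\<lambda>z. ?\<phi> z *\<^sub>R y)"
        by (intro smooth_on_imp_continuous_on smooth_on_matrix_vector_mult smooth_on_scaleR open_S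
            smooth_G h \<phi> smooth_on_const)+
      show "G z *v ?h z = ?\<phi> z *\<^sub>R y" if "det (G z) \<noteq> 0" for z
        using that by (simp add: adjugate_mult_eq matrix_vector_mult_scaleR_right
            matrix_vector_mul_assoc matrix_inv(2) invertible_det_nz)
    qed
  qed
  have "((\<lambda>z. G z *v ?h z) has_derivative
      (\<lambda>v. G x *v frechet_derivative ?h (at x) v + frechet_derivative G (at x) v *v ?h x)) (at x)"
    by (rule has_derivative_matrix_vector_mult[OF G_has_derivative[OF x] smooth_on_has_derivative[OF h x]])
  then have "((\<lambda>z. ?\<phi> z *\<^sub>R y) has_derivative
      (\<lambda>v. G x *v frechet_derivative ?h (at x) v + frechet_derivative G (at x) v *v ?h x)) (at x)"
    by (rule has_derivative_transform_within_open[OF _ open_S x]) (rule eq)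
  moreover have "((\<lambda>z. ?\<phi> z *\<^sub>R y) has_derivative (\<lambda>v. frechet_derivative ?\<phi> (at x) v *\<^sub>R y)) (at x)"
    using has_derivative_scaleR_left[OF smooth_on_has_derivative[OF \<phi> x]] .
  ultimately have "(\<lambda>v. G x *v frechet_derivative ?h (at x) v + frechet_derivative G (at x) v *v ?h x) =
      (\<lambda>v. frechet_derivative ?\<phi> (at x) v *\<^sub>R y)"
    by (rule has_derivative_unique)
  from fun_cong[OF this, of v]
  have "frechet_derivative ?\<phi> (at x) v *\<^sub>R y = G x *v frechet_derivative ?h (at x) v"
    by (simp add: 0)
  then have "frechet_derivative ?\<phi> (at x) v * (y \<bullet> r) = (G x *v frechet_derivative ?h (at x) v) \<bullet> r"
    by (metis inner_scaleR_left)
  \<comment> \<open>\<open>G x\<close> is symmetric with \<open>r\<close> in its kernel, so its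
    range is orthogonal to \<open>r\<close>.\<close>
  also have "\<dots> = 0"
    using G_inner_commute[OF x, of r] r(1) by (simp add: inner_commute)
  finally show False
    using v y by simp
qed

end


section \<open>Charts and vector fields\<close>

locale smooth_atlas =
  fixes At :: "('a::{t2_space, second_countable_topology}, 'n::finite) chart set"
  assumes smooth_manifold: "smooth_manifold At"
begin

lemma charts_atD: "c \<in> charts_at At q \<Longrightarrow> c \<in> At" "c \<in> charts_at At q \<Longrightarrow> q \<in> fst c"
  by (auto simp: charts_at_def)

lemma charts_atI: "c \<in> At \<Longrightarrow> q \<in> fst c \<Longrightarrow> c \<in> charts_at At q"
  by (auto simp: charts_at_def)

lemma chart_at: "q \<in> carrier_of At \<Longrightarrow> chart_at At q \<in> charts_at At q"
  unfolding chart_at_def by (rule someI_ex) (auto simp: carrier_of_def charts_at_def)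

lemma chart_homeomorphism:
  assumes "c \<in> At"
  shows "open (fst c)" "open (snd c ` fst c)" "inj_on (snd c) (fst c)" "continuous_on (fst c) (snd c)"
proof -
  obtain h where "open (fst c)" "open (snd c ` fst c)" "homeomorphism (fst c) (snd c ` fst c) (snd c) h"
    using smooth_manifold assms unfolding smooth_manifold_def by blast
  then show "open (fst c)" "open (snd c ` fst c)" "inj_on (snd c) (fst c)" "continuous_on (fst c) (snd c)"
    by (auto simp: homeomorphism_def inj_on_def) (metis)
qed

lemma inv_chart [simp]: "c \<in> At \<Longrightarrow> q \<in> fst c \<Longrightarrow> inv_into (fst c) (snd c) (snd c q) = q"
  using chart_homeomorphism(3) by simp

lemma coord_rep_chart: "c \<in> At \<Longrightarrow> q \<in> fst c \<Longrightarrow> coord_rep c f (snd c q) = f q"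
  by (simp add: coord_rep_def)

lemma open_chart_image:
  assumes "c \<in> At" "open W"
  shows "open (snd c ` (fst c \<inter> W))"
proof -
  obtain h where *: "open (fst c)" "open (snd c ` fst c)" "homeomorphism (fst c) (snd c ` fst c) (snd c) h"
    using smooth_manifold assms(1) unfolding smooth_manifold_def by blast
  have "snd c ` (fst c \<inter> W) = snd c ` fst c \<inter> h -` W"
    using *(3) by (auto simp: homeomorphism_def)
  then show ?thesis
    using continuous_open_preimage[OF _ *(2) assms(2), of h] *(3) by (auto simp: homeomorphism_def)
qed

lemma smooth_transition:
  assumes "c \<in> At" "d \<in> At"
  shows "smooth_on (snd c ` (fst c \<inter> fst d)) (coord_rep c (snd d))"
  using smooth_manifold assms unfolding smooth_manifold_def by blast

lemma transition_has_derivative: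
  assumes "c \<in> charts_at At q" "d \<in> charts_at At q"
  shows "(coord_rep c (snd d) has_derivative (\<lambda>v. chart_jacobian c d q *v v)) (at (snd c q))"
proof -
  have q: "snd c q \<in> snd c ` (fst c \<inter> fst d)"
    using assms charts_atD by blast
  have "(coord_rep c (snd d) has_derivative frechet_derivative (coord_rep c (snd d)) (at (snd c q))) (at (snd c q))"
    using smooth_on_has_derivative[OF smooth_transition q] assms charts_atD by blast
  then show ?thesis
    unfolding chart_jacobian_def
    using matrix_vector_mul(3)[OF has_derivative_bounded_linear] by (simp add: matrix_works has_derivative_linear)
qed

lemma has_derivative_change:
  assumes "c \<in> charts_at At q" "d \<in> charts_at At q" "(coord_rep c f has_derivative f') (at (snd c q))"
  shows "(coord_rep d f has_derivative (\<lambda>v. f' (chart_jacobian d c q *v v))) (at (snd d q))"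
proof -
  note cd = charts_atD[OF assms(1)] charts_atD[OF assms(2)]
  have "((\<lambda>y. coord_rep c f (coord_rep d (snd c) y)) has_derivative
      (\<lambda>v. f' (chart_jacobian d c q *v v))) (at (snd d q))"
    by (rule has_derivative_compose[where g = "coord_rep c f", OF transition_has_derivative[OF assms(2,1)]])
      (use assms(3) cd in \<open>simp add: coord_rep_chart\<close>)
  then show ?thesis
  proof (rule has_derivative_transform_within_open)
    show "open (snd d ` (fst d \<inter> fst c))"
      using open_chart_image cd chart_homeomorphism by blast
    show "snd d q \<in> snd d ` (fst d \<inter> fst c)"
      using cd by blast
    show "coord_rep c f (coord_rep d (snd c) y) = coord_rep d f y" if "y \<in> snd d ` (fst d \<inter> fst c)" for y
      using that cd by (auto simp: coord_rep_chart)
  qed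
qed

lemma chart_jacobian_compose:
  assumes "c \<in> charts_at At q" "d \<in> charts_at At q" "e \<in> charts_at At q"
  shows "chart_jacobian d e q *v (chart_jacobian c d q *v v) = chart_jacobian c e q *v v"
proof -
  have "(coord_rep c (snd e) has_derivative (\<lambda>v. chart_jacobian d e q *v (chart_jacobian c d q *v v))) (at (snd c q))"
    by (rule has_derivative_change[OF assms(2,1) transition_has_derivative[OF assms(2,3)]])
  from has_derivative_unique[OF this transition_has_derivative[OF assms(1,3)]] show ?thesis
    by (rule fun_cong)
qed

lemma chart_jacobian_self:
  assumes "c \<in> charts_at At q"
  shows "chart_jacobian c c q *v v = v"
proof -
  note c = charts_atD[OF assms]
  have "(coord_rep c (snd c) has_derivative (\<lambda>v. v)) (at (snd c q))"
  proof (rule has_derivative_transform_within_open[OF has_derivative_ident chart_homeomorphism(2)[OF c(1)]])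
    show "x = coord_rep c (snd c) x" if "x \<in> snd c ` fst c" for x
      using that c by (auto simp: coord_rep_chart)
  qed (use c in auto)
  from has_derivative_unique[OF transition_has_derivative[OF assms assms] this] show ?thesis
    by (rule fun_cong)
qed

lemma smooth_on_chart_continuous:
  assumes "c \<in> At" "smooth_on (snd c ` W) X" "W \<subseteq> fst c"
  shows "continuous_on W (\<lambda>q. X (snd c q))"
  by (rule continuous_on_compose2[OF smooth_on_imp_continuous_on[OF assms(2)]
        continuous_on_subset[OF chart_homeomorphism(4)[OF assms(1)] assms(3)]]) auto

lemma coord_rep_continuous:
  assumes "c \<in> At" "smooth_on (snd c ` W) (coord_rep c f)" "W \<subseteq> fst c"
  shows "continuous_on W f"
  by (rule continuous_on_eq[OF smooth_on_chart_continuous[OF assms]]) (use assms in \<open>auto simp: coord_rep_chart\<close>)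

lemma smooth_on_transition_compose:
  fixes X :: "real ^ 'n \<Rightarrow> 'b::real_normed_vector"
  assumes "c \<in> At" "d \<in> At" "open W" "smooth_on (snd c ` (fst c \<inter> W)) X"
  shows "smooth_on (snd d ` (fst d \<inter> (fst c \<inter> W))) (\<lambda>y. X (coord_rep d (snd c) y))"
proof (rule smooth_on_compose[OF _ _ _ _ assms(4)])
  show "open (snd d ` (fst d \<inter> (fst c \<inter> W)))" "open (snd c ` (fst c \<inter> W))"
    using assms(1-3) chart_homeomorphism(1)[OF assms(1)] by (auto intro!: open_chart_image open_Int)
  show "coord_rep d (snd c) ` snd d ` (fst d \<inter> (fst c \<inter> W)) \<subseteq> snd c ` (fst c \<inter> W)"
    using assms by (auto simp: coord_rep_chart)
  show "smooth_on (snd d ` (fst d \<inter> (fst c \<inter> W))) (coord_rep d (snd c))"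
    by (rule smooth_on_subset[OF smooth_transition[OF assms(2,1)]]) auto
qed

lemma smooth_vfield_subset:
  assumes "smooth_vfield At W A" "W' \<subseteq> W"
  shows "smooth_vfield At W' A"
  unfolding smooth_vfield_def
proof (intro conjI ballI)
  show "vfield_on At W' A"
    using assms by (auto simp: smooth_vfield_def vfield_on_def)
  show "smooth_on (snd c ` (fst c \<inter> W')) (coord_rep c (A c))" if "c \<in> At" for c
    by (rule smooth_on_subset[of "snd c ` (fst c \<inter> W)"]) (use assms that in \<open>auto simp: smooth_vfield_def\<close>)
qed

lemma smooth_vfield_coord:
  "smooth_vfield At W A \<Longrightarrow> c \<in> At \<Longrightarrow> smooth_on (snd c ` (fst c \<inter> W)) (coord_rep c (A c))"
  by (simp add: smooth_vfield_def)

lemma smooth_vfield_continuous: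
  assumes "smooth_vfield At W A" "c \<in> At"
  shows "continuous_on (fst c \<inter> W) (A c)"
  by (rule coord_rep_continuous[OF assms(2) smooth_vfield_coord[OF assms]]) simp

lemma vfield_change:
  "smooth_vfield At W A \<Longrightarrow> q \<in> W \<Longrightarrow> c \<in> charts_at At q \<Longrightarrow> d \<in> charts_at At q \<Longrightarrow>
    A d q = chart_jacobian c d q *v A c q"
  unfolding smooth_vfield_def vfield_on_def by blast

text \<open>\<open>vderiv\<close> is evaluated in a chart picked by choice. Passing to
  \<open>c\<close>, the chain rule and the transformation law of \<open>A\<close> produce the same
  Jacobian, so any chart may be used.\<close>

lemma vderiv_chart:
  assumes "q \<in> W" "smooth_vfield At W A" "c \<in> charts_at At q" "(coord_rep c f has_derivative f') (at (snd c q))"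
    and "q \<in> carrier_of At"
  shows "vderiv At A f q = f' (A c q)"
proof -
  let ?d = "chart_at At q"
  have d: "?d \<in> charts_at At q"
    using chart_at[OF assms(5)] .
  have "vderiv At A f q = f' (chart_jacobian ?d c q *v A ?d q)"
    using has_derivative_change[OF assms(3) d assms(4)]
    by (simp add: vderiv_def Let_def flip: frechet_derivative_at)
  then show ?thesis
    unfolding vfield_change[OF assms(2,1) d assms(3)] .
qed

text \<open>Prescribes a field by its components in the single chart \<open>c\<close>. With constant
  \<open>X\<close> these are the test fields for the connection; multiplied by the determinant they
  are the perturbations that separate different extensions.\<close>

definition chart_field ::
    "('a, 'n) chart \<Rightarrow> (real ^ 'n \<Rightarrow> real ^ 'n) \<Rightarrow> ('a, 'n) vfield" where
  "chart_field c X = (\<lambda>d q. chart_jacobian c d q *v X (snd c q))"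

lemma chart_field_self: "c \<in> charts_at At q \<Longrightarrow> chart_field c X c q = X (snd c q)"
  by (simp add: chart_field_def chart_jacobian_self)

lemma smooth_chart_field:
  assumes "c \<in> At" "open W" "W \<subseteq> fst c" "smooth_on (snd c ` W) X"
  shows "smooth_vfield At W (chart_field c X)"
  unfolding smooth_vfield_def
proof (intro conjI ballI)
  show "vfield_on At W (chart_field c X)"
    unfolding vfield_on_def chart_field_def
    using chart_jacobian_compose assms(1,3) by (auto simp: charts_at_def subset_iff)
next
  fix d assume d: "d \<in> At"
  have W: "fst c \<inter> W = W" "fst d \<inter> (fst c \<inter> W) = fst d \<inter> W" "fst d \<inter> (fst c \<inter> (W \<inter> fst d)) = fst d \<inter> W"
    using assms(3) by auto
  have op: "open (snd d ` (fst d \<inter> W))"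
    using open_chart_image[OF d assms(2)] .
  have "smooth_on (snd c ` (fst c \<inter> fst d)) (\<lambda>x. matrix (frechet_derivative (coord_rep c (snd d)) (at x)))"
    using open_chart_image[OF assms(1)] chart_homeomorphism(1)[OF d] smooth_transition[OF assms(1) d]
    by (intro smooth_on_matrix_frechet_derivative) auto
  then have "smooth_on (snd c ` (fst c \<inter> (W \<inter> fst d))) (\<lambda>x. matrix (frechet_derivative (coord_rep c (snd d)) (at x)))"
    by (rule smooth_on_subset) auto
  from smooth_on_transition_compose[OF assms(1) d open_Int[OF assms(2) chart_homeomorphism(1)[OF d]] this]
  have J: "smooth_on (snd d ` (fst d \<inter> W))
      (\<lambda>y. matrix (frechet_derivative (coord_rep c (snd d)) (at (coord_rep d (snd c) y))))"
    unfolding W .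
  have X: "smooth_on (snd d ` (fst d \<inter> W)) (\<lambda>y. X (coord_rep d (snd c) y))"
    using smooth_on_transition_compose[OF assms(1) d assms(2), of X] assms(4) unfolding W by blast
  show "smooth_on (snd d ` (fst d \<inter> W)) (coord_rep d (chart_field c X d))"
  proof (rule smooth_on_cong[OF op _ smooth_on_matrix_vector_mult[OF op J X]])
    show "matrix (frechet_derivative (coord_rep c (snd d)) (at (coord_rep d (snd c) y))) *v
        X (coord_rep d (snd c) y) = coord_rep d (chart_field c X d) y" if "y \<in> snd d ` (fst d \<inter> W)" for y
      using that d assms(1,3) by (auto simp: coord_rep_chart chart_field_def chart_jacobian_def)
  qed
qed

end


section \<open>The Levi-Civita connection in charts\<close>

locale transverse_space = smooth_atlas At
  for At :: "('a::{t2_space, second_countable_topology}, 'n::finite) chart set" +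
  fixes g :: "('a, 'n) tensor02"
    and D :: "('a, 'n) vfield \<Rightarrow> ('a, 'n) vfield \<Rightarrow> ('a, 'n) vfield"
  assumes tensor: "smooth_sym_tensor At g"
    and regular: "\<And>p c. p \<in> sing_set At g \<Longrightarrow> c \<in> charts_at At p \<Longrightarrow> \<exists>v. ddet g c p v \<noteq> 0"
    and levi_civita: "levi_civita At g D"
begin

abbreviation sing :: "'a set" where
  "sing \<equiv> sing_set At g"

abbreviation G :: "('a, 'n) chart \<Rightarrow> real ^ 'n \<Rightarrow> real ^ 'n ^ 'n" where
  "G c \<equiv> coord_rep c (g c)"

lemma G_chart: "c \<in> charts_at At q \<Longrightarrow> G c (snd c q) = g c q"
  by (simp add: coord_rep_chart charts_atD)

lemma charts_at_carrier: "c \<in> charts_at At q \<Longrightarrow> q \<in> carrier_of At"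
  by (auto simp: carrier_of_def charts_at_def)

lemma g_change:
  assumes "c \<in> charts_at At q" "d \<in> charts_at At q"
  shows "g c q = transpose (chart_jacobian c d q) ** g d q ** chart_jacobian c d q"
  using tensor[unfolded smooth_sym_tensor_def, THEN conjunct1] assms charts_at_carrier by blast

lemma g_symmetric: "c \<in> charts_at At q \<Longrightarrow> transpose (g c q) = g c q"
  using tensor[unfolded smooth_sym_tensor_def, THEN conjunct2, THEN conjunct1] charts_at_carrier by blast

lemma smooth_symmetric_matrix_chart:
  assumes "c \<in> At"
  shows "smooth_symmetric_matrix (snd c ` fst c) (G c)"
proof
  show "open (snd c ` fst c)"
    by (rule chart_homeomorphism(2)[OF assms])
  show "smooth_on (snd c ` fst c) (G c)"
    using tensor[unfolded smooth_sym_tensor_def, THEN conjunct2, THEN conjunct2] assms by blast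
  show "transpose (G c x) = G c x" if "x \<in> snd c ` fst c" for x
    using that assms g_symmetric[OF charts_atI[OF assms]] by (auto simp: coord_rep_chart)
qed

lemma sing_subset_carrier: "sing \<subseteq> carrier_of At"
  by (auto simp: sing_set_def carrier_of_def charts_at_def)

lemma sing_iff_det:
  assumes c: "c \<in> charts_at At q"
  shows "q \<in> sing \<longleftrightarrow> det (g c q) = 0"
proof
  assume "q \<in> sing"
  then obtain d where d: "d \<in> charts_at At q" "det (g d q) = 0"
    by (auto simp: sing_set_def det_eq_0_rank)
  show "det (g c q) = 0"
    using d(2) by (subst g_change[OF c d(1)]) (simp add: det_mul)
next
  assume "det (g c q) = 0"
  then show "q \<in> sing"
    using c by (auto simp: sing_set_def det_eq_0_rank)
qed

lemma ddet_eq: "ddet g c p = frechet_derivative (\<lambda>x. det (G c x)) (at (snd c p))"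
  by (simp add: ddet_def coord_rep_def)

lemma smooth_det_G: "c \<in> At \<Longrightarrow> smooth_on (snd c ` fst c) (\<lambda>x. det (G c x))"
  using smooth_symmetric_matrix_chart[of c] by (auto simp: smooth_symmetric_matrix_def intro: smooth_on_det)

lemma ddet_has_derivative:
  assumes "c \<in> charts_at At p"
  shows "((\<lambda>x. det (G c x)) has_derivative ddet g c p) (at (snd c p))"
  unfolding ddet_eq by (rule smooth_on_has_derivative[OF smooth_det_G]) (use charts_atD[OF assms] in auto)

lemma regular_chart:
  assumes "c \<in> At" "x \<in> snd c ` fst c" "det (G c x) = 0"
  shows "\<exists>v. frechet_derivative (\<lambda>x. det (G c x)) (at x) v \<noteq> 0"
proof -
  obtain q where q: "x = snd c q" "c \<in> charts_at At q"
    using assms charts_atI by blast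
  then have "q \<in> sing"
    using assms(3) by (simp add: sing_iff_det G_chart)
  from regular[OF this q(2)] show ?thesis
    by (simp add: ddet_eq q(1))
qed

lemma open_Diff_sing:
  assumes "open W" "W \<subseteq> carrier_of At"
  shows "open (W - sing)"
proof (subst open_subopen, rule ballI)
  fix q assume q: "q \<in> W - sing"
  then obtain c where c: "c \<in> At" "q \<in> fst c"
    using assms(2) by (auto simp: carrier_of_def)
  have "continuous_on (fst c) (\<lambda>q. det (G c (snd c q)))"
    by (rule smooth_on_chart_continuous[OF c(1) smooth_det_G[OF c(1)] subset_refl])
  then have "open (fst c \<inter> (\<lambda>q. det (G c (snd c q))) -` (- {0}))"
    by (rule continuous_open_preimage[OF _ chart_homeomorphism(1)[OF c(1)]]) auto
  then have "open ((fst c \<inter> (\<lambda>q. det (G c (snd c q))) -` (- {0})) \<inter> W)"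
    using assms(1) by (rule open_Int)
  moreover have "q \<in> (fst c \<inter> (\<lambda>q. det (G c (snd c q))) -` (- {0})) \<inter> W"
    using q c sing_iff_det[of c q] charts_atI[of c q] G_chart[of c q] by auto
  moreover have "(fst c \<inter> (\<lambda>q. det (G c (snd c q))) -` (- {0})) \<inter> W \<subseteq> W - sing"
    using c(1) sing_iff_det[of c] charts_atI[of c] G_chart[of c] by auto
  ultimately show "\<exists>T. open T \<and> q \<in> T \<and> T \<subseteq> W - sing"
    by blast
qed

text \<open>Density of the nondegenerate points, transported through a chart. This is what carries
  chart identities known for the Levi-Civita connection onto the singular hypersurface.\<close>

lemma continuous_eq_off_sing:
  fixes F F' :: "'a \<Rightarrow> 'b::t2_space"
  assumes c: "c \<in> At" and W: "open W" "W \<subseteq> fst c" and cont: "continuous_on W F" "continuous_on W F'"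
    and eq: "\<And>q. q \<in> W - sing \<Longrightarrow> F q = F' q" and q: "q \<in> W"
  shows "F q = F' q"
proof -
  have *: "continuous_on (snd c ` W) (coord_rep c H)" if "continuous_on W H" for H :: "'a \<Rightarrow> 'b"
    unfolding coord_rep_def
  proof (rule continuous_on_compose2[OF that])
    obtain h where h: "homeomorphism (fst c) (snd c ` fst c) (snd c) h"
      using smooth_manifold c unfolding smooth_manifold_def by blast
    have "continuous_on (snd c ` W) h"
      using h W(2) continuous_on_subset by (blast dest: homeomorphism_cont2)
    then show "continuous_on (snd c ` W) (inv_into (fst c) (snd c))"
      by (rule continuous_on_eq) (use h W(2) c in \<open>auto simp: homeomorphism_def subset_iff\<close>)
  qed (use W(2) c in \<open>auto simp: subset_iff\<close>)
  have cW: "c \<in> charts_at At q'" if "q' \<in> W" for q'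
    using that c W(2) charts_atI by blast
  have op: "open (snd c ` W)"
    using open_chart_image[OF c W(1)] W(2) by (simp add: Int_absorb1)
  obtain v where v: "det (G c (snd c q)) = 0 \<Longrightarrow> frechet_derivative (\<lambda>x. det (G c x)) (at (snd c q)) v \<noteq> 0"
    using regular_chart[OF c, of "snd c q"] q W(2) by blast
  have "coord_rep c F (snd c q) = coord_rep c F' (snd c q)"
  proof (rule continuous_eq_off_regular_zeros[OF op *[OF cont(1)] *[OF cont(2)] _ _ v])
    show "coord_rep c F x = coord_rep c F' x" if x: "x \<in> snd c ` W" "det (G c x) \<noteq> 0" for x
    proof -
      obtain q' where q': "x = snd c q'" "q' \<in> W"
        using x by blast
      then have "q' \<notin> sing"
        using x sing_iff_det[OF cW] G_chart[OF cW] by auto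
      then show ?thesis
        using q' eq c W(2) by (auto simp: coord_rep_chart subset_iff)
    qed
  qed (use q in auto)
  then show ?thesis
    using q c W(2) by (auto simp: coord_rep_chart subset_iff)
qed

lemma division_chart:
  fixes f :: "real ^ 'n \<Rightarrow> real"
  assumes "c \<in> At" "open W" "W \<subseteq> fst c" "smooth_on (snd c ` W) f"
    and "\<And>q. q \<in> sing \<inter> W \<Longrightarrow> f (snd c q) = 0"
  obtains r where "smooth_on (snd c ` W) r" "\<And>x. x \<in> snd c ` W \<Longrightarrow> f x = det (G c x) * r x"
proof (rule smooth_division[OF _ assms(4)])
  show "open (snd c ` W)"
    using open_chart_image[OF assms(1,2)] assms(3) by (simp add: Int_absorb1)
  show "smooth_on (snd c ` W) (\<lambda>x. det (G c x))"
    using smooth_on_subset[OF smooth_det_G[OF assms(1)]] assms(3) by blast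
  have cW: "c \<in> charts_at At q" if "q \<in> W" for q
    using that assms(1,3) charts_atI by blast
  show "f x = 0" if x: "x \<in> snd c ` W" "det (G c x) = 0" for x
    using x assms(5) sing_iff_det[OF cW] G_chart[OF cW] by auto
  show "\<exists>v. frechet_derivative (\<lambda>x. det (G c x)) (at x) v \<noteq> 0"
    if "x \<in> snd c ` W" "det (G c x) = 0" for x
    using regular_chart[OF assms(1)] that assms(3) by blast
qed (use that in blast)

lemma vector_division_chart:
  fixes f :: "real ^ 'n \<Rightarrow> real ^ 'm::finite"
  assumes "c \<in> At" "open W" "W \<subseteq> fst c" "smooth_on (snd c ` W) f"
    and "\<And>q. q \<in> sing \<inter> W \<Longrightarrow> f (snd c q) = 0"
  obtains r where "smooth_on (snd c ` W) r" "\<And>x. x \<in> snd c ` W \<Longrightarrow> f x = det (G c x) *\<^sub>R r x"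
proof -
  have op: "open (snd c ` W)"
    using open_chart_image[OF assms(1,2)] assms(3) by (simp add: Int_absorb1)
  have "\<exists>r. smooth_on (snd c ` W) r \<and> (\<forall>x\<in>snd c ` W. f x $ k = det (G c x) * r x)" for k
    by (rule division_chart[OF assms(1-3) smooth_on_vec_nth[OF op assms(4), of k]]) (use assms(5) in auto)
  then obtain r where r: "\<And>k. smooth_on (snd c ` W) (r k)"
    "\<And>k x. x \<in> snd c ` W \<Longrightarrow> f x $ k = det (G c x) * r k x"
    by metis
  show thesis
  proof (rule that)
    show "smooth_on (snd c ` W) (\<lambda>x. \<chi> k. r k x)"
      using op r(1) by (rule smooth_on_vec_lambda)
    show "f x = det (G c x) *\<^sub>R (\<chi> k. r k x)" if "x \<in> snd c ` W" for x
      using r(2)[OF that] by (simp add: vec_eq_iff)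
  qed
qed

text \<open>Writing f = phi r with phi the determinant, the derivative of f at a singular point is r
  times that of phi. This is how the kernel of \<open>ddet\<close> acts as the tangent space of the
  hypersurface.\<close>

lemma tangent_derivative_eq_0:
  fixes f :: "real ^ 'n \<Rightarrow> real"
  assumes "c \<in> charts_at At p" "open W" "p \<in> sing \<inter> W" "W \<subseteq> fst c" "smooth_on (snd c ` W) f"
    and "\<And>q. q \<in> sing \<inter> W \<Longrightarrow> f (snd c q) = 0" and "ddet g c p v = 0"
  shows "frechet_derivative f (at (snd c p)) v = 0"
proof -
  note c = charts_atD[OF assms(1)]
  obtain r where r: "smooth_on (snd c ` W) r" "\<And>x. x \<in> snd c ` W \<Longrightarrow> f x = det (G c x) * r x"
    using division_chart[OF c(1) assms(2,4,5,6)] by metis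
  have op: "open (snd c ` W)"
    using open_chart_image[OF c(1) assms(2)] assms(4) by (simp add: Int_absorb1)
  have p: "snd c p \<in> snd c ` W"
    using assms(3) by auto
  have "((\<lambda>x. det (G c x) * r x) has_derivative
    (\<lambda>v. det (G c (snd c p)) * frechet_derivative r (at (snd c p)) v + ddet g c p v * r (snd c p))) (at (snd c p))"
    by (rule has_derivative_mult[OF ddet_has_derivative[OF assms(1)] smooth_on_has_derivative[OF r(1) p]])
  then have "(f has_derivative
    (\<lambda>v. det (G c (snd c p)) * frechet_derivative r (at (snd c p)) v + ddet g c p v * r (snd c p))) (at (snd c p))"
    by (rule has_derivative_transform_within_open[OF _ op p]) (simp add: r(2))
  moreover have "det (G c (snd c p)) = 0"
    using assms(1,3) sing_iff_det G_chart by auto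
  ultimately show ?thesis
    using assms(7) by (simp flip: frechet_derivative_at)
qed

lemma ip_chart:
  assumes "q \<in> W" "q \<in> carrier_of At" "smooth_vfield At W A" "smooth_vfield At W B" "c \<in> charts_at At q"
  shows "ip At g A B q = A c q \<bullet> (g c q *v B c q)"
proof -
  let ?d = "chart_at At q" and ?J = "chart_jacobian (chart_at At q) c q"
  have d: "?d \<in> charts_at At q"
    using chart_at[OF assms(2)] .
  have g: "g ?d q = transpose ?J ** g c q ** ?J"
    by (rule g_change[OF d assms(5)])
  have "ip At g A B q = A ?d q \<bullet> (g ?d q *v B ?d q)"
    by (simp add: ip_def Let_def)
  also have "\<dots> = A ?d q \<bullet> (transpose ?J *v (g c q *v (?J *v B ?d q)))"
    unfolding g by (simp flip: matrix_vector_mul_assoc)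
  also have "\<dots> = (?J *v A ?d q) \<bullet> (g c q *v (?J *v B ?d q))"
    by (metis dot_lmul_matrix transpose_matrix_vector transpose_transpose)
  finally show ?thesis
    unfolding vfield_change[OF assms(3,1) d assms(5)] vfield_change[OF assms(4,1) d assms(5)] .
qed

section \<open>The dual connection and the Koszul formula in a chart\<close>

definition chart_conn ::
    "('a, 'n) chart \<Rightarrow> ('a, 'n) vfield \<Rightarrow> ('a, 'n) vfield \<Rightarrow> ('a, 'n) vfield \<Rightarrow> 'a \<Rightarrow> real" where
  "chart_conn c A B C q =
    frechet_derivative (coord_rep c (B c)) (at (snd c q)) (A c q) \<bullet> (g c q *v C c q) +
    christoffel (G c) (snd c q) (A c q) (B c q) (C c q)"

lemma coord_vfield_has_derivative:
  assumes "smooth_vfield At W A" "q \<in> W" "c \<in> charts_at At q"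
  shows "(coord_rep c (A c) has_derivative frechet_derivative (coord_rep c (A c)) (at (snd c q))) (at (snd c q))"
  by (rule smooth_on_has_derivative[OF smooth_vfield_coord[OF assms(1)]]) (use assms charts_atD in auto)

lemma vderiv_ip:
  assumes W: "open W" "W \<subseteq> carrier_of At" and q: "q \<in> W" and c: "c \<in> charts_at At q"
    and A: "smooth_vfield At W A" and B: "smooth_vfield At W B" and C: "smooth_vfield At W C"
  shows "vderiv At A (ip At g B C) q =
    frechet_derivative (\<lambda>x. coord_rep c (B c) x \<bullet> (G c x *v coord_rep c (C c) x)) (at (snd c q)) (A c q)"
proof -
  note c' = charts_atD[OF c]
  interpret smooth_symmetric_matrix "snd c ` fst c" "G c"
    by (rule smooth_symmetric_matrix_chart[OF c'(1)])
  have x: "snd c q \<in> snd c ` fst c"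
    using c' by auto
  note der = has_derivative_inner_G[OF x coord_vfield_has_derivative[OF B q c] coord_vfield_has_derivative[OF C q c]]
  have "(coord_rep c (ip At g B C) has_derivative
    frechet_derivative (\<lambda>x. coord_rep c (B c) x \<bullet> (G c x *v coord_rep c (C c) x)) (at (snd c q))) (at (snd c q))"
    unfolding frechet_derivative_at[OF der, symmetric]
  proof (rule has_derivative_transform_within_open[OF der])
    show "open (snd c ` (fst c \<inter> W))" "snd c q \<in> snd c ` (fst c \<inter> W)"
      using open_chart_image[OF c'(1) W(1)] c' q by auto
    show "coord_rep c (B c) x \<bullet> (G c x *v coord_rep c (C c) x) = coord_rep c (ip At g B C) x"
      if "x \<in> snd c ` (fst c \<inter> W)" for x
      using that c'(1) W(2) ip_chart[OF _ _ B C, of _ c] charts_atI[OF c'(1)] by (auto simp: coord_rep_chart)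
  qed
  from vderiv_chart[OF q A c this] show ?thesis
    using q W(2) by auto
qed

lemma koszul_chart_conn:
  assumes W: "open W" "W \<subseteq> carrier_of At" and q: "q \<in> W" and c: "c \<in> charts_at At q"
    and A: "smooth_vfield At W A" and B: "smooth_vfield At W B" and C: "smooth_vfield At W C"
  shows "vderiv At A (ip At g B C) q + vderiv At B (ip At g C A) q - vderiv At C (ip At g A B) q +
      lie_bracket A B c q \<bullet> (g c q *v C c q) - lie_bracket B C c q \<bullet> (g c q *v A c q) +
      lie_bracket C A c q \<bullet> (g c q *v B c q) = 2 * chart_conn c A B C q"
proof -
  note c' = charts_atD[OF c]
  interpret smooth_symmetric_matrix "snd c ` fst c" "G c"
    by (rule smooth_symmetric_matrix_chart[OF c'(1)])
  have x: "snd c q \<in> snd c ` fst c"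
    using c' by auto
  show ?thesis
    using koszul_chart[OF x coord_vfield_has_derivative[OF A q c] coord_vfield_has_derivative[OF B q c]
        coord_vfield_has_derivative[OF C q c]]
    unfolding vderiv_ip[OF W q c A B C] vderiv_ip[OF W q c B C A] vderiv_ip[OF W q c C A B]
    by (simp add: lie_bracket_def chart_conn_def coord_rep_chart c' G_chart[OF c])
qed

text \<open>The usual uniqueness argument: compatibility with \<open>g\<close> expands the three
  derivatives of products, vanishing torsion expands the brackets, and all but twice the pairing of
  \<open>D A B\<close> with \<open>C\<close> cancels.\<close>

lemma chart_conn_levi_civita:
  assumes W: "open W" "W \<subseteq> carrier_of At" and q: "q \<in> W - sing" and c: "c \<in> charts_at At q"
    and A: "smooth_vfield At W A" and B: "smooth_vfield At W B" and C: "smooth_vfield At W C"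
  shows "chart_conn c A B C q = D A B c q \<bullet> (g c q *v C c q)"
proof -
  let ?V = "W - sing"
  have V: "open ?V" "?V \<subseteq> carrier_of At" "?V \<subseteq> carrier_of At - sing"
    using open_Diff_sing[OF W] W(2) by auto
  have qc: "q \<in> carrier_of At"
    using q W(2) by auto
  have sm: "smooth_vfield At ?V A" "smooth_vfield At ?V B" "smooth_vfield At ?V C"
    using smooth_vfield_subset[of W _ ?V] A B C by auto
  note lc = levi_civita[unfolded levi_civita_def, THEN spec, THEN mp, OF conjI[OF V(1,3)]]
  note lc_smooth = lc[THEN conjunct1]
  note lc' = lc[THEN conjunct2, THEN conjunct2, THEN conjunct2, THEN conjunct2, THEN conjunct2]
  note lc_torsion = lc'[THEN conjunct1] and lc_metric = lc'[THEN conjunct2]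
  have DD: "smooth_vfield At ?V (D X Y)" if "smooth_vfield At ?V X" "smooth_vfield At ?V Y" for X Y
    using lc_smooth that by blast
  have metric: "vderiv At X (ip At g Y Z) q = D X Y c q \<bullet> (g c q *v Z c q) + Y c q \<bullet> (g c q *v D X Z c q)"
    if "smooth_vfield At ?V X" "smooth_vfield At ?V Y" "smooth_vfield At ?V Z" for X Y Z
  proof -
    have "vderiv At X (ip At g Y Z) q = ip At g (D X Y) Z q + ip At g Y (D X Z) q"
      using lc_metric that q by blast
    then show ?thesis
      using ip_chart[OF q qc DD[OF that(1,2)] that(3) c] ip_chart[OF q qc that(2) DD[OF that(1,3)] c] by simp
  qed
  have torsion: "lie_bracket X Y c q = D X Y c q - D Y X c q"
    if "smooth_vfield At ?V X" "smooth_vfield At ?V Y" for X Y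
  proof -
    have "vf_eq At ?V (vf_diff (D X Y) (D Y X)) (lie_bracket X Y)"
      using lc_torsion that by blast
    then show ?thesis
      using q c by (simp add: vf_eq_def vf_diff_def)
  qed
  note comm = symmetric_matrix_inner[OF g_symmetric[OF c]]
  have "2 * chart_conn c A B C q = 2 * (D A B c q \<bullet> (g c q *v C c q))"
    unfolding koszul_chart_conn[OF V(1,2) q c sm, symmetric]
      metric[OF sm(1,2,3)] metric[OF sm(2,3,1)] metric[OF sm(3,1,2)]
      torsion[OF sm(1,2)] torsion[OF sm(2,3)] torsion[OF sm(3,1)]
    using comm[of "B c q" "D A C c q"] comm[of "C c q" "D B A c q"] comm[of "A c q" "D C B c q"]
    by (simp add: inner_diff_left)
  then show ?thesis
    by simp
qed

lemma levi_civita_smooth: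
  assumes "open W" "W \<subseteq> carrier_of At" "smooth_vfield At W A" "smooth_vfield At W B"
  shows "smooth_vfield At (W - sing) (D A B)"
proof -
  have "open (W - sing)" "W - sing \<subseteq> carrier_of At - sing"
    using open_Diff_sing[OF assms(1,2)] assms(2) by auto
  note lc = levi_civita[unfolded levi_civita_def, THEN spec, THEN mp, OF conjI[OF this], THEN conjunct1]
  show ?thesis
    using lc smooth_vfield_subset[OF assms(3), of "W - sing"] smooth_vfield_subset[OF assms(4), of "W - sing"]
    by blast
qed

lemma smooth_on_chart_conn_terms:
  assumes W: "open W" and c: "c \<in> At" and A: "smooth_vfield At W A" and B: "smooth_vfield At W B"
  shows "smooth_on (snd c ` (fst c \<inter> W)) (\<lambda>x. frechet_derivative (coord_rep c (B c)) (at x) (coord_rep c (A c) x))"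
    and "smooth_on (snd c ` (fst c \<inter> W)) (\<lambda>x. christoffel_vec (G c) x (coord_rep c (A c) x) (coord_rep c (B c) x))"
    and "smooth_vfield At W C \<Longrightarrow> smooth_on (snd c ` (fst c \<inter> W))
      (\<lambda>x. christoffel (G c) x (coord_rep c (A c) x) (coord_rep c (B c) x) (coord_rep c (C c) x))"
proof -
  interpret smooth_symmetric_matrix "snd c ` fst c" "G c"
    by (rule smooth_symmetric_matrix_chart[OF c])
  have op: "open (snd c ` (fst c \<inter> W))"
    by (rule open_chart_image[OF c W])
  show "smooth_on (snd c ` (fst c \<inter> W)) (\<lambda>x. frechet_derivative (coord_rep c (B c)) (at x) (coord_rep c (A c) x))"
    by (intro smooth_on_frechet_derivative_apply op smooth_vfield_coord A B c)
  show "smooth_on (snd c ` (fst c \<inter> W)) (\<lambda>x. christoffel_vec (G c) x (coord_rep c (A c) x) (coord_rep c (B c) x))"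
    by (rule smooth_on_christoffel_vec[OF op _ smooth_vfield_coord[OF A c] smooth_vfield_coord[OF B c]]) auto
  show "smooth_on (snd c ` (fst c \<inter> W))
      (\<lambda>x. christoffel (G c) x (coord_rep c (A c) x) (coord_rep c (B c) x) (coord_rep c (C c) x))"
    if "smooth_vfield At W C"
    by (rule smooth_on_christoffel[OF op _ smooth_vfield_coord[OF A c] smooth_vfield_coord[OF B c]
          smooth_vfield_coord[OF that c]]) auto
qed

lemma smooth_on_G:
  "c \<in> At \<Longrightarrow> T \<subseteq> snd c ` fst c \<Longrightarrow> smooth_on T (G c)"
  using smooth_symmetric_matrix.smooth_G[OF smooth_symmetric_matrix_chart] smooth_on_subset by blast

lemma chart_conn_continuous:
  assumes W: "open W" and c: "c \<in> At" and A: "smooth_vfield At W A" and B: "smooth_vfield At W B"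
    and C: "smooth_vfield At W C"
  shows "continuous_on (fst c \<inter> W) (chart_conn c A B C)"
proof -
  have op: "open (snd c ` (fst c \<inter> W))"
    by (rule open_chart_image[OF c W])
  have "smooth_on (snd c ` (fst c \<inter> W)) (\<lambda>x.
      frechet_derivative (coord_rep c (B c)) (at x) (coord_rep c (A c) x) \<bullet> (G c x *v coord_rep c (C c) x) +
      christoffel (G c) x (coord_rep c (A c) x) (coord_rep c (B c) x) (coord_rep c (C c) x))"
    by (intro smooth_on_add smooth_on_inner smooth_on_matrix_vector_mult op smooth_vfield_coord[OF C c]
        smooth_on_chart_conn_terms(1)[OF W c A B] smooth_on_chart_conn_terms(3)[OF W c A B C] smooth_on_G[OF c]) auto
  from smooth_on_chart_continuous[OF c this] show ?thesis
    by (rule continuous_on_eq) (auto simp: chart_conn_def coord_rep_chart c)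
qed

text \<open>The Koszul formula settles the chart that \<open>ip\<close> chooses. To reach an
  arbitrary chart \<open>c\<close>, note that off the hypersurface both chart expressions equal the
  invariant number \<open>ip At g (D A B) C\<close>; both are continuous on the overlap, so they
  also agree on the hypersurface.\<close>

lemma dual_conn_chart:
  assumes W: "open W" "W \<subseteq> carrier_of At" and q: "q \<in> W" and c: "c \<in> charts_at At q"
    and A: "smooth_vfield At W A" and B: "smooth_vfield At W B" and C: "smooth_vfield At W C"
  shows "dual_conn At g A B C q = chart_conn c A B C q"
proof -
  define d where "d = chart_at At q"
  have d: "d \<in> charts_at At q"
    unfolding d_def using chart_at q W(2) by auto
  have lie: "ip At g (lie_bracket X Y) Z q = lie_bracket X Y d q \<bullet> (g d q *v Z d q)" for X Y Z
    by (simp add: ip_def d_def Let_def)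
  have "2 * dual_conn At g A B C q = 2 * chart_conn d A B C q"
    unfolding koszul_chart_conn[OF W q d A B C, symmetric] dual_conn_def lie by simp
  then have "dual_conn At g A B C q = chart_conn d A B C q"
    by simp
  also have "\<dots> = chart_conn c A B C q"
  proof (rule continuous_eq_off_sing[of c "fst c \<inter> fst d \<inter> W"])
    show "open (fst c \<inter> fst d \<inter> W)"
      using W(1) chart_homeomorphism(1)[of c] chart_homeomorphism(1)[of d] charts_atD c d by blast
    show "continuous_on (fst c \<inter> fst d \<inter> W) (chart_conn d A B C)"
      using chart_conn_continuous[OF W(1) charts_atD(1)[OF d] A B C] by (rule continuous_on_subset) auto
    show "continuous_on (fst c \<inter> fst d \<inter> W) (chart_conn c A B C)"
      using chart_conn_continuous[OF W(1) charts_atD(1)[OF c] A B C] by (rule continuous_on_subset) auto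
    fix q' assume q': "q' \<in> fst c \<inter> fst d \<inter> W - sing"
    then have c': "c \<in> charts_at At q'" and d': "d \<in> charts_at At q'" and q'': "q' \<in> W - sing"
      using charts_atD(1)[OF c] charts_atD(1)[OF d] charts_atI by auto
    have "chart_conn e A B C q' = ip At g (D A B) C q'" if "e \<in> charts_at At q'" for e
      unfolding chart_conn_levi_civita[OF W q'' that A B C]
      using ip_chart[OF q'' _ levi_civita_smooth[OF W A B] smooth_vfield_subset[OF C] that] q'' W(2) by auto
    from this[OF c'] this[OF d'] show "chart_conn d A B C q' = chart_conn c A B C q'"
      by simp
  qed (use charts_atD[OF c] charts_atD[OF d] q in auto)
  finally show ?thesis .
qed

text \<open>Obtained by testing against all fields that are constant in \<open>c\<close>. The form
  without the inverse matrix is kept because its right-hand side is continuous across the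
  hypersurface, so a limit of \<open>D A B\<close> can be inserted there.\<close>

lemma levi_civita_lowered:
  assumes W: "open W" "W \<subseteq> carrier_of At" and q: "q \<in> W - sing" and c: "c \<in> charts_at At q"
    and A: "smooth_vfield At W A" and B: "smooth_vfield At W B"
  shows "g c q *v D A B c q =
    g c q *v frechet_derivative (coord_rep c (B c)) (at (snd c q)) (A c q) +
    christoffel_vec (G c) (snd c q) (A c q) (B c q)"
proof -
  note c' = charts_atD[OF c]
  interpret smooth_symmetric_matrix "snd c ` fst c" "G c"
    by (rule smooth_symmetric_matrix_chart[OF c'(1)])
  let ?W = "fst c \<inter> W" and ?DB = "frechet_derivative (coord_rep c (B c)) (at (snd c q)) (A c q)"
  have W': "open ?W" "?W \<subseteq> carrier_of At" "q \<in> ?W - sing"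
    using W c' q chart_homeomorphism(1)[OF c'(1)] by auto
  have sm: "smooth_vfield At ?W A" "smooth_vfield At ?W B" "smooth_vfield At ?W (chart_field c (\<lambda>x. v))" for v
    using smooth_vfield_subset[OF A, of ?W] smooth_vfield_subset[OF B, of ?W]
      smooth_chart_field[OF c'(1) W'(1), of "\<lambda>x. v"] by auto
  note comm = symmetric_matrix_inner[OF g_symmetric[OF c]]
  have "(g c q *v D A B c q) \<bullet> v =
      (g c q *v ?DB + christoffel_vec (G c) (snd c q) (A c q) (B c q)) \<bullet> v" for v
  proof -
    have "D A B c q \<bullet> (g c q *v v) = ?DB \<bullet> (g c q *v v) + christoffel (G c) (snd c q) (A c q) (B c q) v"
      using chart_conn_levi_civita[OF W' c sm(1,2) sm(3)[of v]]
      by (simp add: chart_conn_def chart_field_self[OF c])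
    moreover have "(g c q *v w) \<bullet> v = w \<bullet> (g c q *v v)" for w
      using comm[of v w] by (simp add: inner_commute)
    moreover have "snd c q \<in> snd c ` fst c"
      using c' by auto
    ultimately show ?thesis
      by (simp only: inner_add_left christoffel_vec_inner)
  qed
  then show ?thesis
    by (metis inner_commute vector_eq_rdot)
qed

lemma levi_civita_chart:
  assumes W: "open W" "W \<subseteq> carrier_of At" and q: "q \<in> W - sing" and c: "c \<in> charts_at At q"
    and A: "smooth_vfield At W A" and B: "smooth_vfield At W B"
  shows "D A B c q = frechet_derivative (coord_rep c (B c)) (at (snd c q)) (A c q) +
    matrix_inv (g c q) *v christoffel_vec (G c) (snd c q) (A c q) (B c q)"
proof -
  have "det (g c q) \<noteq> 0"
    using q sing_iff_det[OF c] by auto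
  then have inv: "matrix_inv (g c q) *v (g c q *v v) = v" for v
    by (simp add: matrix_vector_mul_assoc matrix_inv)
  show ?thesis
    using arg_cong[OF levi_civita_lowered[OF assms], of "(*v) (matrix_inv (g c q))"]
    by (simp add: inv matrix_vector_mult_add_right)
qed

section \<open>Extensions of fields along the singular hypersurface\<close>

lemma extension_subset: "extension At g W \<A> A \<Longrightarrow> W' \<subseteq> W \<Longrightarrow> extension At g W' \<A> A"
  by (auto simp: extension_def vf_eq_def intro: smooth_vfield_subset)

lemma extension_smooth: "extension At g W \<A> A \<Longrightarrow> smooth_vfield At W \<A>"
  by (simp add: extension_def)

lemma extension_at:
  "extension At g W \<A> A \<Longrightarrow> p \<in> sing \<Longrightarrow> p \<in> W \<Longrightarrow> c \<in> charts_at At p \<Longrightarrow> \<A> c p = A c p"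
  by (auto simp: extension_def vf_eq_def)

lemma extension_self: "smooth_vfield At W A \<Longrightarrow> extension At g W A A"
  by (simp add: extension_def vf_eq_def)

lemma smooth_along_extension:
  assumes "smooth_along At g V A" "p \<in> sing \<inter> V"
  obtains W \<A> where "open W" "p \<in> W" "W \<subseteq> V" "extension At g W \<A> A"
  using assms unfolding smooth_along_def by blast

lemma smooth_vfield_imp_along: "open V \<Longrightarrow> smooth_vfield At V A \<Longrightarrow> smooth_along At g V A"
  unfolding smooth_along_def using extension_self by blast

lemma smooth_along_subset:
  assumes "smooth_along At g V A" "open V'" "V' \<subseteq> V"
  shows "smooth_along At g V' A"
  unfolding smooth_along_def
proof (rule ballI)
  fix p assume p: "p \<in> sing \<inter> V'"
  obtain W \<A> where "open W" "p \<in> W" "extension At g W \<A> A"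
    by (rule smooth_along_extension[OF assms(1), of p]) (use p assms(3) in auto)
  then show "\<exists>W \<A>. open W \<and> p \<in> W \<and> W \<subseteq> V' \<and> extension At g W \<A> A"
    using p assms(2) extension_subset[of W \<A> A "W \<inter> V'"]
    by (intro exI[of _ "W \<inter> V'"] exI[of _ \<A>]) auto
qed

text \<open>\<open>dual_conn_along\<close> is a definite description, so besides independence of the
  extensions one needs some triple of extensions over a common neighbourhood; otherwise every number
  would fit the description. Intersecting the three domains supplies it.\<close>

lemma dual_conn_along_eqI:
  assumes "p \<in> sing \<inter> V" "V \<subseteq> carrier_of At"
    and "smooth_along At g V A" "smooth_along At g V B" "smooth_along At g V C"
    and "\<And>W \<A> \<B> \<C>. open W \<Longrightarrow> p \<in> W \<Longrightarrow> W \<subseteq> carrier_of At \<Longrightarrow> extension At g W \<A> A \<Longrightarrow>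
      extension At g W \<B> B \<Longrightarrow> extension At g W \<C> C \<Longrightarrow> dual_conn At g \<A> \<B> \<C> p = r"
  shows "dual_conn_along At g A B C p = r"
  unfolding dual_conn_along_def
proof (rule the_equality)
  show "\<forall>W \<A> \<B> \<C>. open W \<and> p \<in> W \<and> W \<subseteq> carrier_of At \<and> extension At g W \<A> A \<and>
      extension At g W \<B> B \<and> extension At g W \<C> C \<longrightarrow> dual_conn At g \<A> \<B> \<C> p = r"
    using assms(6) by blast
next
  fix s
  assume s: "\<forall>W \<A> \<B> \<C>. open W \<and> p \<in> W \<and> W \<subseteq> carrier_of At \<and> extension At g W \<A> A \<and>
      extension At g W \<B> B \<and> extension At g W \<C> C \<longrightarrow> dual_conn At g \<A> \<B> \<C> p = s"
  obtain W1 \<A> where 1: "open W1" "p \<in> W1" "W1 \<subseteq> V" "extension At g W1 \<A> A"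
    by (rule smooth_along_extension[OF assms(3,1)])
  obtain W2 \<B> where 2: "open W2" "p \<in> W2" "W2 \<subseteq> V" "extension At g W2 \<B> B"
    by (rule smooth_along_extension[OF assms(4,1)])
  obtain W3 \<C> where 3: "open W3" "p \<in> W3" "W3 \<subseteq> V" "extension At g W3 \<C> C"
    by (rule smooth_along_extension[OF assms(5,1)])
  let ?W = "W1 \<inter> W2 \<inter> W3"
  have W: "open ?W" "p \<in> ?W" "?W \<subseteq> carrier_of At"
    using 1 2 3 assms(2) by auto
  have ext: "extension At g ?W \<A> A" "extension At g ?W \<B> B" "extension At g ?W \<C> C"
    using extension_subset[OF 1(4), of ?W] extension_subset[OF 2(4), of ?W] extension_subset[OF 3(4), of ?W]
    by auto
  have "dual_conn At g \<A> \<B> \<C> p = s"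
    using s W ext by blast
  moreover have "dual_conn At g \<A> \<B> \<C> p = r"
    by (rule assms(6)[OF W ext])
  ultimately show "s = r"
    by simp
qed

end


section \<open>The main normal and the main radical field\<close>

locale main_frame_space = transverse_space At g D
  for At :: "('a::{t2_space, second_countable_topology}, 'n::finite) chart set"
    and g :: "('a, 'n) tensor02" and D +
  fixes U :: "'a set" and N R :: "('a, 'n) vfield"
  assumes open_U: "open U" and U_subset: "U \<subseteq> carrier_of At"
    and main_normal: "main_normal At g U N"
    and main_radical: "main_radical At g U N R"
begin

lemma R_along: "smooth_along At g U R" and N_along: "smooth_along At g U N"
  using main_radical main_normal by (auto simp: main_radical_def radical_field_def main_normal_def)

lemma g_R:
  assumes "p \<in> sing \<inter> U" "c \<in> charts_at At p"
  shows "g c p *v R c p = 0"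
  using main_radical assms unfolding main_radical_def radical_field_def by blast

lemma R_tangent:
  assumes "p \<in> sing \<inter> U" "c \<in> charts_at At p"
  shows "ddet g c p (R c p) = 0"
  using main_radical assms unfolding main_radical_def tangent_to_sing_def by blast

text \<open>The derivative of an extension enters \<open>chart_conn\<close> only paired with g C,
  and this vanishes for C = R. What remains depends on the values at \<open>p\<close> alone.\<close>

lemma II_eq:
  assumes V: "V \<subseteq> U" and A: "smooth_along At g V A" and B: "smooth_along At g V B" and "open V"
    and p: "p \<in> sing \<inter> V" and c: "c \<in> charts_at At p"
  shows "II At g R A B p = christoffel (G c) (snd c p) (A c p) (B c p) (R c p)"
  unfolding II_def
proof (rule dual_conn_along_eqI[OF p _ A B smooth_along_subset[OF R_along \<open>open V\<close> V]])
  fix W \<A> \<B> \<C>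
  assume W: "open W" "p \<in> W" "W \<subseteq> carrier_of At"
    and ext: "extension At g W \<A> A" "extension At g W \<B> B" "extension At g W \<C> R"
  have "dual_conn At g \<A> \<B> \<C> p = chart_conn c \<A> \<B> \<C> p"
    by (rule dual_conn_chart[OF W(1,3,2) c ext[THEN extension_smooth]])
  also have "\<dots> = christoffel (G c) (snd c p) (A c p) (B c p) (R c p)"
    using p W(2) c V g_R[of p c] by (simp add: chart_conn_def ext[THEN extension_at] subset_iff)
  finally show "dual_conn At g \<A> \<B> \<C> p = christoffel (G c) (snd c p) (A c p) (B c p) (R c p)" .
qed (use V U_subset in auto)

text \<open>The pairing of an extension of \<open>R\<close> with \<open>Y\<close> vanishes on the
  hypersurface, so its derivative in a tangent direction is zero. The product-rule term with the
  derivative of \<open>Y\<close> drops out because \<open>R\<close> is radical.\<close>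

lemma radical_pairing_derivative:
  assumes W: "open W" "W \<subseteq> U" and c: "c \<in> charts_at At p" and p: "p \<in> sing \<inter> W"
    and R': "extension At g W \<R> R" and Y: "smooth_vfield At W Y" and v: "ddet g c p v = 0"
  shows "frechet_derivative (coord_rep c (\<R> c)) (at (snd c p)) v \<bullet> (g c p *v Y c p) +
    R c p \<bullet> (frechet_derivative (G c) (at (snd c p)) v *v Y c p) = 0"
proof -
  note c' = charts_atD[OF c]
  interpret smooth_symmetric_matrix "snd c ` fst c" "G c"
    by (rule smooth_symmetric_matrix_chart[OF c'(1)])
  let ?W = "fst c \<inter> W"
  let ?f = "\<lambda>x. coord_rep c (\<R> c) x \<bullet> (G c x *v coord_rep c (Y c) x)"
  have x: "snd c p \<in> snd c ` fst c" and pW: "p \<in> W"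
    using c' p by auto
  note sR = extension_smooth[OF R']
  have W': "open ?W" "p \<in> sing \<inter> ?W" "?W \<subseteq> fst c"
    using W(1) chart_homeomorphism(1)[OF c'(1)] p c' by auto
  have sm: "smooth_on (snd c ` ?W) ?f"
    by (intro smooth_on_inner smooth_on_matrix_vector_mult open_chart_image c' W(1)
        smooth_vfield_coord[OF sR] smooth_vfield_coord[OF Y] smooth_on_G) auto
  have zero: "?f (snd c q) = 0" if q: "q \<in> sing \<inter> ?W" for q
  proof -
    have cq: "c \<in> charts_at At q"
      using q c' charts_atI by auto
    have "R c q \<bullet> (g c q *v Y c q) = Y c q \<bullet> (g c q *v R c q)"
      by (rule symmetric_matrix_inner[OF g_symmetric[OF cq]])
    also have "\<dots> = 0"
      using g_R[of q c] q cq W(2) by auto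
    finally show ?thesis
      using q c' extension_at[OF R', of q c] cq by (simp add: coord_rep_chart)
  qed
  have "frechet_derivative ?f (at (snd c p)) v = 0"
    by (rule tangent_derivative_eq_0[OF c W' sm zero v])
  moreover have "(g c p *v R c p) = 0"
    using g_R[of p c] c p W(2) by auto
  then have "R c p \<bullet> (g c p *v w) = 0" for w
    using symmetric_matrix_inner[OF g_symmetric[OF c], of "R c p" w] by simp
  ultimately show ?thesis
    using has_derivative_inner_G[OF x coord_vfield_has_derivative[OF sR pW c] coord_vfield_has_derivative[OF Y pW c]]
      extension_at[OF R' _ pW c] p c'
    by (simp add: coord_rep_chart flip: frechet_derivative_at)
qed

text \<open>Expresses H(X,R) as -II(X,N). The derivative of the extension of \<open>R\<close> is
  removed by \<open>radical_pairing_derivative\<close>, at the price of - R . DG(X) N; by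
  \<open>christoffel_metric\<close> this is -Gamma(X,R,N) - Gamma(X,N,R), whose first term
  cancels.\<close>

lemma second_ff_eq:
  assumes V: "open V" "V \<subseteq> U" and X: "smooth_along At g V X"
    and p: "p \<in> sing \<inter> V" and c: "c \<in> charts_at At p" and tan: "ddet g c p (X c p) = 0"
  shows "second_ff At g N X R p = - christoffel (G c) (snd c p) (X c p) (N c p) (R c p)"
  unfolding second_ff_def
proof (rule dual_conn_along_eqI[OF p _ X smooth_along_subset[OF R_along V] smooth_along_subset[OF N_along V]])
  fix W \<X> \<R> \<N>
  assume W: "open W" "p \<in> W" "W \<subseteq> carrier_of At"
    and ext: "extension At g W \<X> X" "extension At g W \<R> R" "extension At g W \<N> N"
  note c' = charts_atD[OF c]
  interpret smooth_symmetric_matrix "snd c ` fst c" "G c"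
    by (rule smooth_symmetric_matrix_chart[OF c'(1)])
  have x: "snd c p \<in> snd c ` fst c"
    using c' by auto
  have pW: "p \<in> sing" "p \<in> W" "p \<in> sing \<inter> (W \<inter> U)" and op: "open (W \<inter> U)"
    using W p V open_U by auto
  have "dual_conn At g \<X> \<R> \<N> p = chart_conn c \<X> \<R> \<N> p"
    by (rule dual_conn_chart[OF W(1,3,2) c ext[THEN extension_smooth]])
  also have "\<dots> = frechet_derivative (coord_rep c (\<R> c)) (at (snd c p)) (X c p) \<bullet> (g c p *v N c p) +
      christoffel (G c) (snd c p) (X c p) (R c p) (N c p)"
    by (simp add: chart_conn_def ext[THEN extension_at, OF pW(1,2) c])
  also have "\<dots> = - christoffel (G c) (snd c p) (X c p) (N c p) (R c p)"
    using radical_pairing_derivative[OF op _ c pW(3) extension_subset[OF ext(2)] smooth_vfield_subset[OF extension_smooth[OF ext(3)]] tan]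
      christoffel_metric[OF x, of "X c p" "R c p" "N c p"] extension_at[OF ext(3) pW(1,2) c]
    by auto
  finally show "dual_conn At g \<X> \<R> \<N> p = - christoffel (G c) (snd c p) (X c p) (N c p) (R c p)" .
qed (use V U_subset in auto)

section \<open>Values of the symbols on the frame N, R at a singular point\<close>

context
  fixes p c assumes p: "p \<in> sing \<inter> U" and c: "c \<in> charts_at At p"
begin

text \<open>The 1 is the normalisation H(R,R) = -1 with the sign of \<open>second_ff_eq\<close>; it
  may be applied because \<open>R\<close> is tangent.\<close>

lemma christoffel_R_N_R: "christoffel (G c) (snd c p) (R c p) (N c p) (R c p) = 1"
  using second_ff_eq[OF open_U subset_refl R_along p c R_tangent[OF p c]] main_radical p
  by (simp add: main_radical_def)

lemma christoffel_N_N_R: "christoffel (G c) (snd c p) (N c p) (N c p) (R c p) = 0"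
proof -
  have "II At g R N N p = 0"
    using main_normal main_radical open_U p unfolding main_normal_def main_radical_def by blast
  then show ?thesis
    using II_eq[OF subset_refl N_along N_along open_U p c] by simp
qed

text \<open>With both last slots equal to \<open>R\<close>, metric compatibility gives half of R .
  DG(v) R. This is zero by differentiating the vanishing length of \<open>R\<close> along the
  hypersurface.\<close>

lemma christoffel_tangent_R_R:
  assumes "ddet g c p v = 0"
  shows "christoffel (G c) (snd c p) v (R c p) (R c p) = 0"
proof -
  note c' = charts_atD[OF c]
  interpret smooth_symmetric_matrix "snd c ` fst c" "G c"
    by (rule smooth_symmetric_matrix_chart[OF c'(1)])
  have x: "snd c p \<in> snd c ` fst c"
    using c' by auto
  obtain W \<R> where W: "open W" "p \<in> W" "W \<subseteq> U" "extension At g W \<R> R"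
    by (rule smooth_along_extension[OF R_along p])
  have "R c p \<bullet> (frechet_derivative (G c) (at (snd c p)) v *v R c p) = 0"
    using radical_pairing_derivative[OF W(1,3) c _ W(4) extension_smooth[OF W(4)] assms] p W(2)
      extension_at[OF W(4) _ W(2) c] g_R[OF p c] by auto
  then show ?thesis
    using christoffel_metric[OF x, of v "R c p" "R c p"] by simp
qed

lemma R_nonzero: "R c p \<noteq> 0"
proof
  assume "R c p = 0"
  then show False
    using christoffel_R_N_R charts_atD[OF c]
      linear_0[OF smooth_symmetric_matrix.christoffel_linear(3)[OF smooth_symmetric_matrix_chart]] by auto
qed

text \<open>A tangent \<open>N\<close> would be orthogonal to itself, against its unit
  length.\<close>

lemma N_transverse: "ddet g c p (N c p) \<noteq> 0"
proof
  assume "ddet g c p (N c p) = 0"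
  then have 0: "N c p \<bullet> (g c p *v N c p) = 0"
    using main_normal p c unfolding main_normal_def by blast
  \<comment> \<open>The unit length is stated in the chart chosen by \<open>ip\<close>. Moving it to
    \<open>c\<close> uses the transformation law of a field on an open set, so \<open>N\<close> is
    replaced by an extension.\<close>
  obtain W \<N> where W: "open W" "p \<in> W" "W \<subseteq> U" "extension At g W \<N> N"
    by (rule smooth_along_extension[OF N_along p])
  have pc: "p \<in> carrier_of At"
    using p U_subset by auto
  have eq: "\<N> d p = N d p" if "d \<in> charts_at At p" for d
    by (rule extension_at[OF W(4) _ W(2) that]) (use p in auto)
  have "ip At g N N p = ip At g \<N> \<N> p"
    by (simp add: ip_def Let_def eq[OF chart_at[OF pc]])
  also have "\<dots> = N c p \<bullet> (g c p *v N c p)"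
    using ip_chart[OF W(2) pc extension_smooth[OF W(4)] extension_smooth[OF W(4)] c] by (simp add: eq[OF c])
  finally show False
    using 0 main_normal p by (simp add: main_normal_def)
qed

lemma adjugate_mult_eq_0_iff: "adjugate_mult (g c p) y = 0 \<longleftrightarrow> y \<bullet> R c p = 0"
proof
  note c' = charts_atD[OF c]
  interpret smooth_symmetric_matrix "snd c ` fst c" "G c"
    by (rule smooth_symmetric_matrix_chart[OF c'(1)])
  have x: "snd c p \<in> snd c ` fst c"
    using c' by auto
  show "y \<bullet> R c p = 0" if "adjugate_mult (g c p) y = 0"
    using adjugate_mult_neq_0[OF x regular_chart[OF c'(1)], of "R c p" y] that g_R[OF p c] sing_iff_det[OF c] p
    by (auto simp: G_chart[OF c])
  show "adjugate_mult (g c p) y = 0" if "y \<bullet> R c p = 0"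
    using adjugate_mult_eq_0[OF g_symmetric[OF c] g_R[OF p c] R_nonzero that] .
qed

end

section \<open>Existence of the limit of the connection, statement (a)\<close>

lemma good_limit_iff:
  assumes V: "open V" "V \<subseteq> U" and A: "smooth_vfield At V A" and B: "smooth_vfield At V B"
  shows "good_limit At g V (D A B) \<longleftrightarrow> (\<forall>p\<in>sing \<inter> V. II At g R A B p = 0)"
proof -
  have Vc: "V \<subseteq> carrier_of At"
    using V U_subset by auto
  note along = smooth_vfield_imp_along[OF V(1) A] smooth_vfield_imp_along[OF V(1) B]
  have II: "II At g R A B p = christoffel_vec (G c) (snd c p) (A c p) (B c p) \<bullet> R c p"
    if "p \<in> sing \<inter> V" "c \<in> charts_at At p" for p c
    unfolding II_eq[OF V(2) along V(1) that]
    by (rule smooth_symmetric_matrix.christoffel_vec_inner[OF smooth_symmetric_matrix_chart, symmetric])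
      (use charts_atD[OF that(2)] in auto)
  let ?DB = "\<lambda>c q. frechet_derivative (coord_rep c (B c)) (at (snd c q)) (A c q)"
  let ?\<Gamma> = "\<lambda>c q. christoffel_vec (G c) (snd c q) (A c q) (B c q)"
  have DB: "continuous_on (fst c \<inter> V) (?DB c)" if "c \<in> At" for c
    using smooth_on_chart_continuous[OF that smooth_on_chart_conn_terms(1)[OF V(1) that A B]]
    by (rule continuous_on_eq) (auto simp: coord_rep_chart that)
  have \<Gamma>: "continuous_on (fst c \<inter> V) (?\<Gamma> c)" if "c \<in> At" for c
    using smooth_on_chart_continuous[OF that smooth_on_chart_conn_terms(2)[OF V(1) that A B]]
    by (rule continuous_on_eq) (auto simp: coord_rep_chart that)
  have gc: "continuous_on (fst c \<inter> V) (g c)" if "c \<in> At" for c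
    by (rule coord_rep_continuous[OF that smooth_on_G[OF that]]) auto
  show ?thesis
  proof
    assume "good_limit At g V (D A B)"
    then obtain F where F: "smooth_vfield At V F" "vf_eq At (V - sing) F (D A B)"
      by (auto simp: good_limit_def extends_over_sing_def)
    show "\<forall>p\<in>sing \<inter> V. II At g R A B p = 0"
    proof
      fix p assume p: "p \<in> sing \<inter> V"
      obtain c where c: "c \<in> charts_at At p"
        using p Vc chart_at by blast
      note c' = charts_atD[OF c]
      \<comment> \<open>Multiplying by \<open>g\<close> clears the inverse before passing to the
        limit. Pairing the result with \<open>R\<close> then kills both terms containing
        \<open>g\<close>.\<close>
      have eq: "g c p *v F c p = g c p *v ?DB c p + ?\<Gamma> c p"
      proof (rule continuous_eq_off_sing[OF c'(1), of "fst c \<inter> V"])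
        show "open (fst c \<inter> V)"
          using chart_homeomorphism(1)[OF c'(1)] V(1) by blast
        show "continuous_on (fst c \<inter> V) (\<lambda>q. g c q *v F c q)"
          "continuous_on (fst c \<inter> V) (\<lambda>q. g c q *v ?DB c q + ?\<Gamma> c q)"
          by (intro continuous_on_add bounded_bilinear.continuous_on[OF bounded_bilinear_matrix_vector_mult]
              gc DB \<Gamma> c' smooth_vfield_continuous[OF F(1)])+
        show "g c q *v F c q = g c q *v ?DB c q + ?\<Gamma> c q" if q: "q \<in> fst c \<inter> V - sing" for q
        proof -
          have cq: "c \<in> charts_at At q" and q': "q \<in> V - sing"
            using q c' charts_atI by auto
          then have "F c q = D A B c q"
            using F(2) unfolding vf_eq_def by blast
          then show ?thesis
            using levi_civita_lowered[OF V(1) Vc q' cq A B] by simp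
        qed
      qed (use c' p in auto)
      have pU: "p \<in> sing \<inter> U"
        using p V by auto
      have "(g c p *v w) \<bullet> R c p = 0" for w
        using symmetric_matrix_inner[OF g_symmetric[OF c], of "R c p" w] g_R[OF pU c] by (simp add: inner_commute)
      then have "?\<Gamma> c p \<bullet> R c p = 0"
        using arg_cong[OF eq, of "\<lambda>w. w \<bullet> R c p"] by (simp add: inner_add_left)
      then show "II At g R A B p = 0"
        by (simp add: II[OF p c])
    qed
  next
    assume 0: "\<forall>p\<in>sing \<inter> V. II At g R A B p = 0"
    \<comment> \<open>Vanishing of \<open>II\<close> says that the symbol covector has no
      \<open>R\<close>-component on the hypersurface, so its product with the adjugate vanishes
      there and can be divided by the determinant, separately in each chart.\<close>
    have "\<exists>r. smooth_on (snd c ` (fst c \<inter> V)) r \<and>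
        (\<forall>q\<in>fst c \<inter> V. adjugate_mult (g c q) (?\<Gamma> c q) = det (g c q) *\<^sub>R r (snd c q))" if c: "c \<in> At" for c
    proof -
      let ?f = "\<lambda>x. adjugate_mult (G c x) (christoffel_vec (G c) x (coord_rep c (A c) x) (coord_rep c (B c) x))"
      obtain r where r: "smooth_on (snd c ` (fst c \<inter> V)) r"
        "\<And>x. x \<in> snd c ` (fst c \<inter> V) \<Longrightarrow> ?f x = det (G c x) *\<^sub>R r x"
      proof (rule vector_division_chart[OF c])
        show "open (fst c \<inter> V)"
          using chart_homeomorphism(1)[OF c] V(1) by blast
        show "smooth_on (snd c ` (fst c \<inter> V)) ?f"
          by (intro smooth_on_adjugate_mult open_chart_image c V(1) smooth_on_G smooth_on_chart_conn_terms(2) A B) auto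
        show "?f (snd c q) = 0" if q: "q \<in> sing \<inter> (fst c \<inter> V)" for q
        proof -
          have cq: "c \<in> charts_at At q" and "q \<in> sing \<inter> V" "q \<in> sing \<inter> U"
            using q c charts_atI V by auto
          then show ?thesis
            using 0 II[OF _ cq] adjugate_mult_eq_0_iff[OF _ cq] charts_atD[OF cq] by (simp add: coord_rep_chart)
        qed
      qed (use that in auto)
      have "adjugate_mult (g c q) (?\<Gamma> c q) = det (g c q) *\<^sub>R r (snd c q)" if "q \<in> fst c \<inter> V" for q
        using r(2)[of "snd c q"] that c by (auto simp: coord_rep_chart)
      then show ?thesis
        using r(1) by blast
    qed
    then obtain r where r: "\<And>c. c \<in> At \<Longrightarrow> smooth_on (snd c ` (fst c \<inter> V)) (r c)"
      "\<And>c q. c \<in> At \<Longrightarrow> q \<in> fst c \<inter> V \<Longrightarrow> adjugate_mult (g c q) (?\<Gamma> c q) = det (g c q) *\<^sub>R r c (snd c q)"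
      by metis
    define F where "F c q = ?DB c q + r c (snd c q)" for c q
    have F_off: "F c q = D A B c q" if q: "q \<in> V - sing" and c: "c \<in> charts_at At q" for c q
    proof -
      have det: "det (g c q) \<noteq> 0"
        using q sing_iff_det[OF c] by auto
      have "det (g c q) *\<^sub>R (matrix_inv (g c q) *v ?\<Gamma> c q) = det (g c q) *\<^sub>R r c (snd c q)"
        using r(2)[of c q] charts_atD[OF c] q adjugate_mult_eq[OF det] by auto
      then show ?thesis
        using levi_civita_chart[OF V(1) Vc q c A B] det by (simp add: F_def)
    qed
    have F_smooth: "smooth_on (snd c ` (fst c \<inter> V)) (coord_rep c (F c))" if c: "c \<in> At" for c
    proof (rule smooth_on_cong[OF open_chart_image[OF c V(1)]])
      show "frechet_derivative (coord_rep c (B c)) (at x) (coord_rep c (A c) x) + r c x = coord_rep c (F c) x"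
        if "x \<in> snd c ` (fst c \<inter> V)" for x
        using that c by (auto simp: F_def coord_rep_chart)
      show "smooth_on (snd c ` (fst c \<inter> V))
          (\<lambda>x. frechet_derivative (coord_rep c (B c)) (at x) (coord_rep c (A c) x) + r c x)"
        by (rule smooth_on_add[OF open_chart_image[OF c V(1)] smooth_on_chart_conn_terms(1)[OF V(1) c A B] r(1)[OF c]])
    qed
    \<comment> \<open>The quotients were chosen independently in the charts. Off the hypersurface
      they give the components of \<open>D A B\<close>, which transform correctly, and density
      extends the law to singular points.\<close>
    have "F d q = chart_jacobian c d q *v F c q"
      if q: "q \<in> V" and c: "c \<in> charts_at At q" and d: "d \<in> charts_at At q" for c d q
    proof (rule continuous_eq_off_sing[of c "fst c \<inter> fst d \<inter> V"])
      note c' = charts_atD[OF c] and d' = charts_atD[OF d]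
      show "open (fst c \<inter> fst d \<inter> V)"
        using chart_homeomorphism(1)[OF c'(1)] chart_homeomorphism(1)[OF d'(1)] V(1) by blast
      have cont: "continuous_on (fst e \<inter> V) (F e)" if "e \<in> At" for e
        by (rule coord_rep_continuous[OF that F_smooth[OF that]]) auto
      show "continuous_on (fst c \<inter> fst d \<inter> V) (F d)"
        using cont[OF d'(1)] by (rule continuous_on_subset) auto
      have "smooth_on (snd c ` (fst c \<inter> fst d)) (\<lambda>x. matrix (frechet_derivative (coord_rep c (snd d)) (at x)))"
        by (rule smooth_on_matrix_frechet_derivative[OF open_chart_image[OF c'(1) chart_homeomorphism(1)[OF d'(1)]]
              smooth_transition[OF c'(1) d'(1)]])
      then have "continuous_on (fst c \<inter> fst d) (chart_jacobian c d)"
        unfolding chart_jacobian_def by (rule smooth_on_chart_continuous[OF c'(1)]) auto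
      then show "continuous_on (fst c \<inter> fst d \<inter> V) (\<lambda>q. chart_jacobian c d q *v F c q)"
        by (intro bounded_bilinear.continuous_on[OF bounded_bilinear_matrix_vector_mult]
            continuous_on_subset[OF cont[OF c'(1)]]) (auto elim: continuous_on_subset)
      show "F d q' = chart_jacobian c d q' *v F c q'" if q': "q' \<in> fst c \<inter> fst d \<inter> V - sing" for q'
      proof -
        have cd: "c \<in> charts_at At q'" "d \<in> charts_at At q'" and q'': "q' \<in> V - sing"
          using q' c' d' charts_atI by auto
        show ?thesis
          unfolding F_off[OF q'' cd(1)] F_off[OF q'' cd(2)]
          by (rule vfield_change[OF levi_civita_smooth[OF V(1) Vc A B] q'' cd])
      qed
    qed (use q charts_atD[OF c] charts_atD[OF d] in auto)
    then have "smooth_vfield At V F"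
      unfolding smooth_vfield_def vfield_on_def using F_smooth by blast
    moreover have "vf_eq At (V - sing) F (D A B)"
      using F_off by (simp add: vf_eq_def)
    ultimately show "good_limit At g V (D A B)"
      unfolding good_limit_def extends_over_sing_def by blast
  qed
qed

section \<open>Tangent vectors, screen sections and flatness, statement (b)\<close>

lemma christoffel_linear_at:
  assumes "c \<in> charts_at At p"
  shows "linear (\<lambda>a. christoffel (G c) (snd c p) a b v)" "linear (\<lambda>b. christoffel (G c) (snd c p) a b v)"
    "christoffel (G c) (snd c p) a b v = christoffel (G c) (snd c p) b a v"
    "christoffel_vec (G c) (snd c p) a b \<bullet> v = christoffel (G c) (snd c p) a b v"
proof -
  note c' = charts_atD[OF assms]
  interpret smooth_symmetric_matrix "snd c ` fst c" "G c"
    by (rule smooth_symmetric_matrix_chart[OF c'(1)])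
  have x: "snd c p \<in> snd c ` fst c"
    using c' by auto
  show "linear (\<lambda>a. christoffel (G c) (snd c p) a b v)" "linear (\<lambda>b. christoffel (G c) (snd c p) a b v)"
    "christoffel (G c) (snd c p) a b v = christoffel (G c) (snd c p) b a v"
    "christoffel_vec (G c) (snd c p) a b \<bullet> v = christoffel (G c) (snd c p) a b v"
    by (rule christoffel_linear[OF x] christoffel_commute[OF x] christoffel_vec_inner[OF x])+
qed

lemma ddet_linear: "c \<in> charts_at At p \<Longrightarrow> linear (ddet g c p)"
  using ddet_has_derivative has_derivative_linear by blast

text \<open>Tangency does not depend on the chart: the determinant of the Gram matrix of
  \<open>d\<close>, read in the coordinates of \<open>c\<close>, vanishes on the same hypersurface,
  so its derivative kills the kernel of \<open>ddet g c p\<close>.\<close>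

lemma ddet_change_eq_0:
  assumes p: "p \<in> sing" and c: "c \<in> charts_at At p" and d: "d \<in> charts_at At p" and v: "ddet g c p v = 0"
  shows "ddet g d p (chart_jacobian c d p *v v) = 0"
proof -
  note c' = charts_atD[OF c] and d' = charts_atD[OF d]
  let ?W = "fst c \<inter> fst d" and ?f = "\<lambda>q. det (g d q)"
  have W: "open ?W" "p \<in> sing \<inter> ?W" "?W \<subseteq> fst c"
    using chart_homeomorphism(1)[OF c'(1)] chart_homeomorphism(1)[OF d'(1)] c' d' p by auto
  have sub: "smooth_on (snd d ` (fst d \<inter> fst c)) (\<lambda>x. det (G d x))"
    by (rule smooth_on_subset[OF smooth_det_G[OF d'(1)]]) auto
  have "fst c \<inter> (fst d \<inter> fst c) = ?W"
    by auto
  with smooth_on_transition_compose[OF d'(1) c'(1) chart_homeomorphism(1)[OF c'(1)] sub]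
  have "smooth_on (snd c ` ?W) (\<lambda>y. det (G d (coord_rep c (snd d) y)))"
    by (simp only:)
  then have sm: "smooth_on (snd c ` ?W) (coord_rep c ?f)"
    by (rule smooth_on_cong[OF open_chart_image[OF c'(1) chart_homeomorphism(1)[OF d'(1)]], rotated])
      (use c' d' in \<open>auto simp: coord_rep_chart\<close>)
  have "frechet_derivative (coord_rep c ?f) (at (snd c p)) v = 0"
    by (rule tangent_derivative_eq_0[OF c W sm _ v]) (use c' d' charts_atI[OF d'(1)] sing_iff_det[of d] in \<open>auto simp: coord_rep_chart\<close>)
  moreover have "(coord_rep c ?f has_derivative (\<lambda>v. ddet g d p (chart_jacobian c d p *v v))) (at (snd c p))"
    using has_derivative_change[OF d c, of ?f "ddet g d p"] ddet_has_derivative[OF d] by (simp add: coord_rep_def)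
  ultimately show ?thesis
    by (simp flip: frechet_derivative_at)
qed

text \<open>\<open>II_flat\<close> speaks of screen sections over open sets, while the arguments
  below are pointwise. Here every tangent vector at \<open>p\<close> is projected along
  \<open>R\<close> to the screen and the result is realised by a section nearby.\<close>

lemma screen_section_extending:
  assumes p: "p \<in> sing \<inter> U" and c: "c \<in> charts_at At p" and v: "ddet g c p v = 0"
  obtains V X where "open V" "p \<in> V" "V \<subseteq> U" "screen_section At g N R V X"
    "X c p = v - christoffel (G c) (snd c p) v (N c p) (R c p) *\<^sub>R R c p"
proof -
  note c' = charts_atD[OF c]
  obtain W1 \<R> where 1: "open W1" "p \<in> W1" "W1 \<subseteq> U" "extension At g W1 \<R> R"
    by (rule smooth_along_extension[OF R_along p])
  obtain W2 \<N> where 2: "open W2" "p \<in> W2" "W2 \<subseteq> U" "extension At g W2 \<N> N"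
    by (rule smooth_along_extension[OF N_along p])
  define d\<phi> where "d\<phi> w x = frechet_derivative (\<lambda>x. det (G c x)) (at x) w" for w x
  have d\<phi>: "smooth_on (snd c ` fst c) (d\<phi> w)" for w
    unfolding d\<phi>_def by (rule smooth_on_frechet_derivative[OF smooth_det_G[OF c'(1)]])
  obtain e where e: "ddet g c p e \<noteq> 0"
    using regular c p by blast
  \<comment> \<open>On \<open>V\<close> the constant direction \<open>e\<close> stays transverse and
    both extensions are defined.\<close>
  define V where "V = (fst c \<inter> (\<lambda>q. d\<phi> e (snd c q)) -` (- {0})) \<inter> (W1 \<inter> W2)"
  have "open (fst c \<inter> (\<lambda>q. d\<phi> e (snd c q)) -` (- {0}))"
    by (rule continuous_open_preimage[OF smooth_on_chart_continuous[OF c'(1) d\<phi>] chart_homeomorphism(1)[OF c'(1)]]) auto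
  then have V: "open V"
    unfolding V_def using 1(1) 2(1) by blast
  have V': "p \<in> V" "V \<subseteq> U" "V \<subseteq> fst c" "fst c \<inter> V = V"
    using 1 2 c' e by (auto simp: V_def d\<phi>_def ddet_eq)
  have cV: "c \<in> charts_at At q" if "q \<in> V" for q
    using that V'(3) charts_atI[OF c'(1)] by blast
  have op: "open (snd c ` V)"
    using open_chart_image[OF c'(1) V] V'(4) by simp
  have ext: "extension At g V \<R> R" "extension At g V \<N> N"
    using extension_subset[OF 1(4), of V] extension_subset[OF 2(4), of V] by (auto simp: V_def)
  have sm: "smooth_on (snd c ` V) (coord_rep c (\<R> c))" "smooth_on (snd c ` V) (coord_rep c (\<N> c))"
    using smooth_vfield_coord[OF extension_smooth[OF ext(1)] c'(1)]
      smooth_vfield_coord[OF extension_smooth[OF ext(2)] c'(1)] V'(4) by auto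
  have nz: "d\<phi> e x \<noteq> 0" if "x \<in> snd c ` V" for x
    using that by (auto simp: V_def)
  \<comment> \<open>The constant field \<open>v\<close> is corrected along \<open>e\<close> so as to
    lie in the kernel of the differential of the determinant; at \<open>p\<close> the correction is
    zero because \<open>v\<close> is tangent.\<close>
  define T where "T x = v + (- (d\<phi> v x * inverse (d\<phi> e x))) *\<^sub>R e" for x
  have d\<phi>V: "smooth_on (snd c ` V) (d\<phi> w)" for w
    using smooth_on_subset[OF d\<phi>] V'(3) by blast
  have T: "smooth_on (snd c ` V) T"
    unfolding T_def
    by (intro smooth_on_add smooth_on_scaleR smooth_on_const smooth_on_minus smooth_on_mult smooth_on_inverse op d\<phi>V nz)
  have Ttan: "ddet g c q (T (snd c q)) = 0" if q: "q \<in> V" for q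
  proof -
    have "d\<phi> w (snd c q) = ddet g c q w" for w
      by (simp add: d\<phi>_def ddet_eq)
    then show ?thesis
      using nz[of "snd c q"] q linear_diff[OF ddet_linear[OF cV[OF q]]] linear_cmul[OF ddet_linear[OF cV[OF q]]]
      by (simp add: T_def)
  qed
  \<comment> \<open>Subtracting the multiple Gamma(T,N,R) of \<open>R\<close> preserves tangency on
    the hypersurface and, since Gamma(R,N,R) = 1, makes Gamma(X,N,R) = -H(X,R) vanish there.\<close>
  define X where "X x = T x + (- christoffel (G c) x (T x) (coord_rep c (\<N> c) x) (coord_rep c (\<R> c) x)) *\<^sub>R coord_rep c (\<R> c) x" for x
  have X: "smooth_on (snd c ` V) X"
    unfolding X_def
    by (intro smooth_on_add smooth_on_scaleR smooth_on_minus op T sm V'(3) image_mono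
        smooth_symmetric_matrix.smooth_on_christoffel[OF smooth_symmetric_matrix_chart[OF c'(1)]])
  have XR: "chart_field c X c q = T (snd c q) -
      christoffel (G c) (snd c q) (T (snd c q)) (N c q) (R c q) *\<^sub>R R c q" if q: "q \<in> sing \<inter> V" for q
    using chart_field_self[OF cV] q extension_at[OF ext(1) _ _ cV] extension_at[OF ext(2) _ _ cV] V'(3) c'
    by (auto simp: X_def coord_rep_chart subset_iff)
  have field: "smooth_vfield At V (chart_field c X)"
    by (rule smooth_chart_field[OF c'(1) V V'(3) X])
  have tan: "ddet g c q (chart_field c X c q) = 0" if q: "q \<in> sing \<inter> V" for q
  proof -
    have cq: "c \<in> charts_at At q" and qU: "q \<in> sing \<inter> U"
      using q cV V'(2) by auto
    show ?thesis
      unfolding XR[OF q] using R_tangent[OF qU cq] Ttan[of q] q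
      by (simp add: linear_diff[OF ddet_linear[OF cq]] linear_cmul[OF ddet_linear[OF cq]])
  qed
  have "screen_section At g N R V (chart_field c X)"
    unfolding screen_section_def
  proof (intro conjI ballI)
    show along: "smooth_along At g V (chart_field c X)"
      by (rule smooth_vfield_imp_along[OF V field])
    show "tangent_to_sing At g V (chart_field c X)"
      unfolding tangent_to_sing_def
    proof (intro ballI)
      fix q d assume q: "q \<in> sing \<inter> V" and d: "d \<in> charts_at At q"
      have cq: "c \<in> charts_at At q" and q': "q \<in> sing" "q \<in> V"
        using q cV by auto
      show "ddet g d q (chart_field c X d q) = 0"
        unfolding vfield_change[OF field q'(2) cq d]
        by (rule ddet_change_eq_0[OF q'(1) cq d tan[OF q]])
    qed
    fix q assume q: "q \<in> sing \<inter> V"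
    have cq: "c \<in> charts_at At q" and qU: "q \<in> sing \<inter> U"
      using q cV V'(2) by auto
    note lin = christoffel_linear_at(1)[OF cq]
    show "second_ff At g N (chart_field c X) R q = 0"
      unfolding second_ff_eq[OF V V'(2) along q cq tan[OF q]] XR[OF q]
      by (simp add: linear_diff[OF lin] linear_cmul[OF lin] christoffel_R_N_R[OF qU cq])
  qed
  moreover have "T (snd c p) = v"
    using v by (simp add: T_def d\<phi>_def ddet_eq)
  ultimately show thesis
    using that[OF V V'(1,2)] XR[of p] p V'(1) by simp
qed

lemma II_flat_tangent:
  assumes flat: "II_flat At g N R U" and p: "p \<in> sing \<inter> U" and c: "c \<in> charts_at At p"
    and v: "ddet g c p v = 0" and w: "ddet g c p w = 0"
  shows "christoffel (G c) (snd c p) v w (R c p) = 0"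
proof -
  let ?\<Gamma> = "\<lambda>a b. christoffel (G c) (snd c p) a b (R c p)"
  obtain V1 X where X: "open V1" "p \<in> V1" "V1 \<subseteq> U" "screen_section At g N R V1 X"
    "X c p = v - ?\<Gamma> v (N c p) *\<^sub>R R c p"
    by (rule screen_section_extending[OF p c v])
  obtain V2 Y where Y: "open V2" "p \<in> V2" "V2 \<subseteq> U" "screen_section At g N R V2 Y"
    "Y c p = w - ?\<Gamma> w (N c p) *\<^sub>R R c p"
    by (rule screen_section_extending[OF p c w])
  let ?V = "V1 \<inter> V2"
  have V: "open ?V" "?V \<subseteq> U" "p \<in> sing \<inter> ?V"
    using X Y p by auto
  have scr: "screen_section At g N R ?V X" "screen_section At g N R ?V Y"
    using X(4) Y(4) smooth_along_subset[OF _ V(1)] by (auto simp: screen_section_def tangent_to_sing_def)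
  then have along: "smooth_along At g ?V X" "smooth_along At g ?V Y"
    by (auto simp: screen_section_def)
  have "II At g R X Y p = 0"
    using flat V scr unfolding II_flat_def by blast
  then have "?\<Gamma> (X c p) (Y c p) = 0"
    using II_eq[OF V(2) along V(1,3) c] by simp
  moreover have "?\<Gamma> v (R c p) = 0" "?\<Gamma> (R c p) w = 0" "?\<Gamma> (R c p) (R c p) = 0"
    using christoffel_tangent_R_R[OF p c v] christoffel_tangent_R_R[OF p c w]
      christoffel_tangent_R_R[OF p c R_tangent[OF p c]] christoffel_linear_at(3)[OF c, of "R c p" w] by auto
  ultimately show ?thesis
    unfolding X(5) Y(5)
    by (simp add: linear_diff[OF christoffel_linear_at(1)[OF c]] linear_cmul[OF christoffel_linear_at(1)[OF c]]
        linear_diff[OF christoffel_linear_at(2)[OF c]] linear_cmul[OF christoffel_linear_at(2)[OF c]])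
qed

lemma good_limit_of_II_flat:
  assumes "II_flat At g N R U" "open V" "V \<subseteq> U" "smooth_vfield At V A" "smooth_vfield At V B"
    and "tangent_to_sing At g V A" "tangent_to_sing At g V B"
  shows "good_limit At g V (D A B)"
  unfolding good_limit_iff[OF assms(2-5)]
proof
  fix p assume p: "p \<in> sing \<inter> V"
  obtain c where c: "c \<in> charts_at At p"
    using p sing_subset_carrier chart_at by blast
  have "christoffel (G c) (snd c p) (A c p) (B c p) (R c p) = 0"
    by (rule II_flat_tangent[OF assms(1) _ c]) (use assms p c in \<open>auto simp: tangent_to_sing_def\<close>)
  then show "II At g R A B p = 0"
    using II_eq[OF assms(3) smooth_vfield_imp_along[OF assms(2,4)] smooth_vfield_imp_along[OF assms(2,5)] assms(2) p c]
    by simp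
qed

lemma tangent_extension:
  assumes "extension At g W \<A> A" "W \<subseteq> V" "tangent_to_sing At g V A"
  shows "tangent_to_sing At g W \<A>"
  using assms extension_at[OF assms(1)] by (auto simp: tangent_to_sing_def)

text \<open>The common converse of (b) and (d). Extensions of \<open>X\<close> and \<open>Y\<close>
  exist only near each point, hence the smaller set \<open>W\<close>; as \<open>II\<close> depends
  only on values at the point, its vanishing passes from the extensions back to the
  sections.\<close>

lemma II_flatI:
  assumes "\<And>V X Y W \<X> \<Y>. open V \<Longrightarrow> V \<subseteq> U \<Longrightarrow> screen_section At g N R V X \<Longrightarrow> screen_section At g N R V Y \<Longrightarrow>
      open W \<Longrightarrow> W \<subseteq> V \<Longrightarrow> extension At g W \<X> X \<Longrightarrow> extension At g W \<Y> Y \<Longrightarrow> good_limit At g W (D \<X> \<Y>)"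
  shows "II_flat At g N R U"
  unfolding II_flat_def
proof (intro allI impI ballI)
  fix V X Y p
  assume *: "open V \<and> V \<subseteq> U \<and> screen_section At g N R V X \<and> screen_section At g N R V Y" and p: "p \<in> sing \<inter> V"
  then have along: "smooth_along At g V X" "smooth_along At g V Y"
    by (auto simp: screen_section_def)
  obtain W1 \<X> where 1: "open W1" "p \<in> W1" "W1 \<subseteq> V" "extension At g W1 \<X> X"
    by (rule smooth_along_extension[OF along(1) p])
  obtain W2 \<Y> where 2: "open W2" "p \<in> W2" "W2 \<subseteq> V" "extension At g W2 \<Y> Y"
    by (rule smooth_along_extension[OF along(2) p])
  let ?W = "W1 \<inter> W2"
  have W: "open ?W" "?W \<subseteq> V" "?W \<subseteq> U" "p \<in> sing \<inter> ?W"
    using 1 2 * p by auto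
  have ext: "extension At g ?W \<X> X" "extension At g ?W \<Y> Y"
    using extension_subset[OF 1(4), of ?W] extension_subset[OF 2(4), of ?W] by auto
  obtain c where c: "c \<in> charts_at At p"
    using p sing_subset_carrier chart_at by blast
  note sm = ext[THEN extension_smooth]
  have "good_limit At g ?W (D \<X> \<Y>)"
    using assms[of V X Y ?W \<X> \<Y>] * W ext by blast
  then have "II At g R \<X> \<Y> p = 0"
    using good_limit_iff[OF W(1,3) sm] W(4) by blast
  moreover have "II At g R \<X> \<Y> p = II At g R X Y p"
    using II_eq[OF W(3) smooth_vfield_imp_along[OF W(1) sm(1)] smooth_vfield_imp_along[OF W(1) sm(2)] W(1,4) c]
      II_eq[OF _ along _ p c] ext[THEN extension_at, of p c] * W(4) c by auto
  ultimately show "II At g R X Y p = 0"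
    by simp
qed

section \<open>Dependence of the limit on the extensions, statements (c) and (d)\<close>

lemma christoffel_vec_bilinear:
  assumes "c \<in> charts_at At p"
  shows "christoffel_vec (G c) (snd c p) (a + s *\<^sub>R x) b =
      christoffel_vec (G c) (snd c p) a b + s *\<^sub>R christoffel_vec (G c) (snd c p) x b"
    "christoffel_vec (G c) (snd c p) a (b + s *\<^sub>R y) =
      christoffel_vec (G c) (snd c p) a b + s *\<^sub>R christoffel_vec (G c) (snd c p) a y"
  by (auto simp: christoffel_vec_def vec_eq_iff linear_add[OF christoffel_linear_at(1)[OF assms]]
      linear_cmul[OF christoffel_linear_at(1)[OF assms]] linear_add[OF christoffel_linear_at(2)[OF assms]]
      linear_cmul[OF christoffel_linear_at(2)[OF assms]])

text \<open>A perturbation by a multiple of phi changes the symbols by a multiple of phi, which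
  cancels the 1/phi in the inverse matrix and leaves an adjugate term. The change formula is thus
  smooth, holds off the hypersurface, and can be evaluated at \<open>p\<close> by
  continuity.\<close>

lemma levi_civita_perturbation:
  assumes W: "open W" "W \<subseteq> U" and p: "p \<in> sing \<inter> W" and c: "c \<in> charts_at At p" and Wc: "W \<subseteq> fst c"
    and A: "smooth_vfield At W A" and B: "smooth_vfield At W B"
    and A': "smooth_vfield At W A'" and B': "smooth_vfield At W B'"
    and X: "smooth_on (snd c ` W) X" "\<And>q. q \<in> W \<Longrightarrow> A' c q = A c q + det (g c q) *\<^sub>R X (snd c q)"
    and Y: "smooth_on (snd c ` W) Y" "\<And>q. q \<in> W \<Longrightarrow> B' c q = B c q + det (g c q) *\<^sub>R Y (snd c q)"
    and F: "extends_over_sing At g W (D A B) F" and F': "extends_over_sing At g W (D A' B') F'"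
  shows "F' c p = F c p + ddet g c p (A c p) *\<^sub>R Y (snd c p) +
    adjugate_mult (g c p) (christoffel_vec (G c) (snd c p) (X (snd c p)) (B c p) +
      christoffel_vec (G c) (snd c p) (A c p) (Y (snd c p)))"
proof -
  note c' = charts_atD[OF c]
  interpret smooth_symmetric_matrix "snd c ` fst c" "G c"
    by (rule smooth_symmetric_matrix_chart[OF c'(1)])
  have Wcar: "W \<subseteq> carrier_of At" and pW: "p \<in> W" and WW: "fst c \<inter> W = W"
    using W(2) U_subset p Wc by auto
  have cW: "c \<in> charts_at At q" if "q \<in> W" for q
    using that Wc charts_atI[OF c'(1)] by blast
  have op: "open (snd c ` W)"
    using open_chart_image[OF c'(1) W(1)] unfolding WW .
  have sub: "snd c ` W \<subseteq> snd c ` fst c"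
    using Wc by blast
  let ?DB = "\<lambda>A B q. frechet_derivative (coord_rep c (B c)) (at (snd c q)) (A c q)"
  \<comment> \<open>The second symbol is taken with \<open>A'\<close> instead of \<open>A\<close>:
    this absorbs the term quadratic in phi, so the expansion is exact. At \<open>p\<close> the two
    fields coincide.\<close>
  let ?E = "\<lambda>q. christoffel_vec (G c) (snd c q) (X (snd c q)) (B c q) +
      christoffel_vec (G c) (snd c q) (A' c q) (Y (snd c q))"
  have FS: "smooth_vfield At W F" "smooth_vfield At W F'"
    using F F' by (auto simp: extends_over_sing_def)
  have DBc: "continuous_on W (?DB A B)" if "smooth_vfield At W A" "smooth_vfield At W B" for A B
    by (rule continuous_on_eq[OF smooth_on_chart_continuous[OF c'(1)
            smooth_on_chart_conn_terms(1)[OF W(1) c'(1) that, unfolded WW] Wc]])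
      (use Wc c' in \<open>auto simp: coord_rep_chart subset_iff\<close>)
  have co: "smooth_on (snd c ` W) (coord_rep c (Z c))" if "smooth_vfield At W Z" for Z
    using smooth_vfield_coord[OF that c'(1)] unfolding WW .
  have "smooth_on (snd c ` W) (\<lambda>x. adjugate_mult (G c x) (christoffel_vec (G c) x (X x) (coord_rep c (B c) x) +
      christoffel_vec (G c) x (coord_rep c (A' c) x) (Y x)))"
    by (intro smooth_on_adjugate_mult smooth_on_add smooth_on_christoffel_vec op sub X(1) Y(1) co A' B smooth_on_G[OF c'(1)])
  from smooth_on_chart_continuous[OF c'(1) this Wc]
  have Ec: "continuous_on W (\<lambda>q. adjugate_mult (g c q) (?E q))"
    by (rule continuous_on_eq) (use Wc c' in \<open>auto simp: coord_rep_chart subset_iff\<close>)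
  have Fc: "continuous_on W (Z c)" if "smooth_vfield At W Z" for Z
    using smooth_vfield_continuous[OF that c'(1)] unfolding WW .
  have "F' c p = F c p + (?DB A' B' p - ?DB A B p) + adjugate_mult (g c p) (?E p)"
  proof (rule continuous_eq_off_sing[OF c'(1) W(1) Wc _ _ _ pW])
    show "continuous_on W (F' c)" by (rule Fc[OF FS(2)])
    show "continuous_on W (\<lambda>q. F c q + (?DB A' B' q - ?DB A B q) + adjugate_mult (g c q) (?E q))"
      by (rule continuous_on_add[OF continuous_on_add[OF Fc[OF FS(1)]
              continuous_on_diff[OF DBc[OF A' B'] DBc[OF A B]]] Ec])
    fix q assume q: "q \<in> W - sing"
    then have cq: "c \<in> charts_at At q" and qW: "q \<in> W"
      using cW by auto
    have det: "det (g c q) \<noteq> 0"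
      using q sing_iff_det[OF cq] by auto
    have FD: "F c q = D A B c q" "F' c q = D A' B' c q"
      using F F' q cq unfolding extends_over_sing_def vf_eq_def by auto
    have "christoffel_vec (G c) (snd c q) (A' c q) (B' c q) =
        christoffel_vec (G c) (snd c q) (A c q) (B c q) + det (g c q) *\<^sub>R ?E q"
      unfolding Y(2)[OF qW] christoffel_vec_bilinear(2)[OF cq]
      by (simp add: X(2)[OF qW] christoffel_vec_bilinear(1)[OF cq] algebra_simps)
    then show "F' c q = F c q + (?DB A' B' q - ?DB A B q) + adjugate_mult (g c q) (?E q)"
      unfolding FD levi_civita_chart[OF W(1) Wcar q cq A B] levi_civita_chart[OF W(1) Wcar q cq A' B']
        adjugate_mult_eq[OF det]
      by (simp add: matrix_vector_mult_add_right matrix_vector_mult_scaleR_right)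
  qed
  moreover have det0: "det (g c p) = 0"
    using p sing_iff_det[OF c] by auto
  then have A'p: "A' c p = A c p"
    using X(2)[OF pW] by simp
  have x: "snd c p \<in> snd c ` W"
    using pW by auto
  \<comment> \<open>Product rule for phi Y: the term with the derivative of \<open>Y\<close> carries
    the factor phi, which is zero at \<open>p\<close>.\<close>
  have "?DB A' B' p - ?DB A B p = ddet g c p (A c p) *\<^sub>R Y (snd c p)"
  proof -
    have "((\<lambda>x. coord_rep c (B c) x + det (G c x) *\<^sub>R Y x) has_derivative
        (\<lambda>v. frechet_derivative (coord_rep c (B c)) (at (snd c p)) v +
          (det (G c (snd c p)) *\<^sub>R frechet_derivative Y (at (snd c p)) v + ddet g c p v *\<^sub>R Y (snd c p)))) (at (snd c p))"
      by (intro has_derivative_add has_derivative_scaleR coord_vfield_has_derivative[OF B pW c]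
          ddet_has_derivative[OF c] smooth_on_has_derivative[OF Y(1) x])
    then have "(coord_rep c (B' c) has_derivative
        (\<lambda>v. frechet_derivative (coord_rep c (B c)) (at (snd c p)) v +
          (det (G c (snd c p)) *\<^sub>R frechet_derivative Y (at (snd c p)) v + ddet g c p v *\<^sub>R Y (snd c p)))) (at (snd c p))"
      by (rule has_derivative_transform_within_open[OF _ op x])
        (use Y(2) Wc c' in \<open>auto simp: coord_rep_chart subset_iff\<close>)
    then show ?thesis
      using det0 by (simp add: A'p G_chart[OF c] flip: frechet_derivative_at)
  qed
  ultimately show ?thesis
    by (simp add: A'p)
qed

text \<open>The determinant vanishes on the hypersurface, so adding it times any constant vector
  gives another extension of the same field. These are the tests against which well-definedness is
  measured.\<close>

lemma perturbed_extension:
  fixes v :: "real ^ 'n"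
  assumes W: "open W" and c: "c \<in> At" and Wc: "W \<subseteq> fst c" and ext: "extension At g W \<A> A"
  defines "\<A>' \<equiv> vf_add \<A> (chart_field c (\<lambda>x. det (G c x) *\<^sub>R v))"
  shows "extension At g W \<A>' A" "\<And>q. q \<in> W \<Longrightarrow> \<A>' c q = \<A> c q + det (g c q) *\<^sub>R v"
proof -
  let ?X = "chart_field c (\<lambda>x. det (G c x) *\<^sub>R v)"
  have cW: "c \<in> charts_at At q" if "q \<in> W" for q
    using that Wc charts_atI[OF c] by blast
  have op: "open (snd c ` W)"
    using open_chart_image[OF c W] Wc by (simp add: Int_absorb1)
  have X: "smooth_vfield At W ?X"
    by (intro smooth_chart_field c W Wc smooth_on_scaleR op smooth_on_subset[OF smooth_det_G[OF c]] image_mono smooth_on_const)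
  show eq: "\<A>' c q = \<A> c q + det (g c q) *\<^sub>R v" if "q \<in> W" for q
    by (simp add: \<A>'_def vf_add_def chart_field_self[OF cW[OF that]] G_chart[OF cW[OF that]])
  show "extension At g W \<A>' A"
    unfolding extension_def
  proof
    show "smooth_vfield At W \<A>'"
      unfolding smooth_vfield_def vfield_on_def
    proof (intro conjI ballI)
      show "\<A>' e q = chart_jacobian d e q *v \<A>' d q"
        if "q \<in> W" "d \<in> charts_at At q" "e \<in> charts_at At q" for q d e
        unfolding \<A>'_def vf_add_def matrix_vector_mult_add_right
          vfield_change[OF extension_smooth[OF ext] that, symmetric] vfield_change[OF X that, symmetric] ..
      show "smooth_on (snd d ` (fst d \<inter> W)) (coord_rep d (\<A>' d))" if "d \<in> At" for d
        using smooth_on_add[OF open_chart_image[OF that W] smooth_vfield_coord[OF extension_smooth[OF ext] that]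
            smooth_vfield_coord[OF X that]]
        by (simp add: \<A>'_def vf_add_def coord_rep_def)
    qed
    show "vf_eq At (sing \<inter> W) \<A>' A"
      unfolding vf_eq_def
    proof (intro ballI)
      fix q d assume q: "q \<in> sing \<inter> W" and d: "d \<in> charts_at At q"
      then have qW: "q \<in> W" by simp
      have "?X c q = 0"
        using q sing_iff_det[OF cW[OF qW]] by (simp add: chart_field_self[OF cW[OF qW]] G_chart[OF cW[OF qW]])
      then have "?X d q = 0"
        using vfield_change[OF X qW cW[OF qW] d] by simp
      then show "\<A>' d q = A d q"
        using extension_at[OF ext _ qW d] q by (simp add: \<A>'_def vf_add_def)
    qed
  qed
qed

text \<open>The first condition comes from perturbing only the extension of \<open>A\<close> by phi
  v, the second from perturbing only that of \<open>B\<close>. In the first, a vanishing adjugate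
  product is read as a vanishing \<open>R\<close>-component of the symbol.\<close>

lemma conn_well_defined_conditions:
  assumes wd: "conn_well_defined At g D V A B" and V: "open V" "V \<subseteq> U"
    and A: "smooth_along At g V A" and B: "smooth_along At g V B"
    and p: "p \<in> sing \<inter> V" and c: "c \<in> charts_at At p"
  shows "christoffel (G c) (snd c p) v (B c p) (R c p) = 0"
    and "ddet g c p (A c p) *\<^sub>R v + adjugate_mult (g c p) (christoffel_vec (G c) (snd c p) (A c p) v) = 0"
proof -
  note c' = charts_atD[OF c]
  obtain W1 \<A> where 1: "open W1" "p \<in> W1" "W1 \<subseteq> V" "extension At g W1 \<A> A"
    by (rule smooth_along_extension[OF A p])
  obtain W2 \<B> where 2: "open W2" "p \<in> W2" "W2 \<subseteq> V" "extension At g W2 \<B> B"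
    by (rule smooth_along_extension[OF B p])
  define W where "W = W1 \<inter> W2 \<inter> fst c"
  have W: "open W" "p \<in> sing \<inter> W" "W \<subseteq> V" "W \<subseteq> U" "W \<subseteq> fst c"
    using 1 2 p c' chart_homeomorphism(1)[OF c'(1)] V by (auto simp: W_def)
  have pW: "p \<in> sing" "p \<in> W"
    using W(2) by auto
  have ext: "extension At g W \<A> A" "extension At g W \<B> B"
    using extension_subset[OF 1(4), of W] extension_subset[OF 2(4), of W] by (auto simp: W_def)
  let ?\<A> = "vf_add \<A> (chart_field c (\<lambda>x. det (G c x) *\<^sub>R v))"
    and ?\<B> = "vf_add \<B> (chart_field c (\<lambda>x. det (G c x) *\<^sub>R v))"
  note pA = perturbed_extension[OF W(1) c'(1) W(5) ext(1), where v = v]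
    and pB = perturbed_extension[OF W(1) c'(1) W(5) ext(2), where v = v]
  have ex: "\<exists>F. extends_over_sing At g W (D X Y) F" if "extension At g W X A" "extension At g W Y B" for X Y
    using wd W(1,3) that unfolding conn_well_defined_def good_limit_def by blast
  obtain F where F: "extends_over_sing At g W (D \<A> \<B>) F"
    using ex[OF ext] ..
  obtain FA where FA: "extends_over_sing At g W (D ?\<A> \<B>) FA"
    using ex[OF pA(1) ext(2)] ..
  obtain FB where FB: "extends_over_sing At g W (D \<A> ?\<B>) FB"
    using ex[OF ext(1) pB(1)] ..
  have uniq: "F2 c p = F1 c p" if "extension At g W X A" "extension At g W Y B" "extension At g W X' A"
    "extension At g W Y' B" "extends_over_sing At g W (D X Y) F1" "extends_over_sing At g W (D X' Y') F2" for X Y X' Y' F1 F2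
  proof -
    have "vf_eq At (sing \<inter> W) F1 F2"
      by (rule wd[unfolded conn_well_defined_def, THEN conjunct2, THEN spec[of _ W], THEN spec[of _ X],
            THEN spec[of _ Y], THEN spec[of _ X'], THEN spec[of _ Y'], THEN spec[of _ F1], THEN spec[of _ F2], THEN mp])
        (intro conjI W(1,3) that)
    then show ?thesis
      using W(2) c by (simp add: vf_eq_def)
  qed
  note sm = ext[THEN extension_smooth]
  have at: "\<A> c p = A c p" "\<B> c p = B c p"
    using ext[THEN extension_at, OF pW c] by auto
  have zero: "christoffel_vec (G c) (snd c p) 0 y = 0" "christoffel_vec (G c) (snd c p) y 0 = 0" for y
    using linear_0[OF christoffel_linear_at(1)[OF c]] linear_0[OF christoffel_linear_at(2)[OF c]]
    by (auto simp: christoffel_vec_def vec_eq_iff)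
  have "FA c p = F c p + ddet g c p (\<A> c p) *\<^sub>R 0 +
      adjugate_mult (g c p) (christoffel_vec (G c) (snd c p) v (\<B> c p) + christoffel_vec (G c) (snd c p) (\<A> c p) 0)"
    by (rule levi_civita_perturbation[where X = "\<lambda>x. v" and Y = "\<lambda>x. 0",
          OF W(1,4,2) c W(5) sm extension_smooth[OF pA(1)] sm(2) _ pA(2) _ _ F FA]) auto
  then have "adjugate_mult (g c p) (christoffel_vec (G c) (snd c p) v (B c p)) = 0"
    using uniq[OF ext pA(1) ext(2) F FA] by (simp add: zero at)
  moreover have pU: "p \<in> sing \<inter> U"
    using W by auto
  ultimately show "christoffel (G c) (snd c p) v (B c p) (R c p) = 0"
    by (simp add: adjugate_mult_eq_0_iff[OF pU c] christoffel_linear_at(4)[OF c])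
  have "FB c p = F c p + ddet g c p (\<A> c p) *\<^sub>R v +
      adjugate_mult (g c p) (christoffel_vec (G c) (snd c p) 0 (\<B> c p) + christoffel_vec (G c) (snd c p) (\<A> c p) v)"
    by (rule levi_civita_perturbation[where X = "\<lambda>x. 0" and Y = "\<lambda>x. v",
          OF W(1,4,2) c W(5) sm sm(1) extension_smooth[OF pB(1)] _ _ _ pB(2) F FB]) auto
  then show "ddet g c p (A c p) *\<^sub>R v + adjugate_mult (g c p) (christoffel_vec (G c) (snd c p) (A c p) v) = 0"
    using uniq[OF ext ext(1) pB(1) F FB] by (simp add: zero at)
qed

text \<open>A suitable test vector refutes one of the two conditions. For A = N take v = N: the
  symbol term drops since Gamma(N,N,R) = 0, leaving a nonzero multiple of N. For A = R take v = N:
  now dphi(R) = 0 and the symbol term survives. For B = N take v = R and for B = R take v = N; both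
  contradict Gamma(R,N,R) = 1.\<close>

lemma not_conn_well_defined:
  assumes V: "open V" "V \<subseteq> U" "sing \<inter> V \<noteq> {}"
    and A: "smooth_along At g V A" and B: "smooth_along At g V B"
    and Z: "Z \<in> {A, B}" "vf_eq At (sing \<inter> V) Z N \<or> vf_eq At (sing \<inter> V) Z R"
  shows "\<not> conn_well_defined At g D V A B"
proof
  assume wd: "conn_well_defined At g D V A B"
  obtain p where p: "p \<in> sing \<inter> V"
    using V(3) by blast
  obtain c where c: "c \<in> charts_at At p"
    using p sing_subset_carrier chart_at by blast
  have pU: "p \<in> sing \<inter> U"
    using p V(2) by blast
  note cond = conn_well_defined_conditions[OF wd V(1,2) A B p c]
  note RNR = christoffel_R_N_R[OF pU c] and NT = N_transverse[OF pU c]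
  have "Z c p = N c p \<or> Z c p = R c p"
    using Z(2) p c unfolding vf_eq_def by blast
  then consider "A c p = N c p" | "A c p = R c p" | "B c p = N c p" | "B c p = R c p"
    using Z(1) by blast
  then show False
  proof cases
    case 1
    have "adjugate_mult (g c p) (christoffel_vec (G c) (snd c p) (N c p) (N c p)) = 0"
      by (simp add: adjugate_mult_eq_0_iff[OF pU c] christoffel_linear_at(4)[OF c] christoffel_N_N_R[OF pU c])
    then have "N c p = 0"
      using cond(2)[of "N c p"] NT 1 by simp
    then show False
      using NT linear_0[OF ddet_linear[OF c]] by simp
  next
    case 2
    then have "adjugate_mult (g c p) (christoffel_vec (G c) (snd c p) (R c p) (N c p)) = 0"
      using cond(2)[of "N c p"] R_tangent[OF pU c] by simp
    then show False
      using RNR by (simp add: adjugate_mult_eq_0_iff[OF pU c] christoffel_linear_at(4)[OF c])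
  next
    case 3
    then show False
      using cond(1)[of "R c p"] RNR by simp
  next
    case 4
    then show False
      using cond(1)[of "N c p"] RNR christoffel_linear_at(3)[OF c, of "N c p" "R c p"] by simp
  qed
qed

text \<open>Independence of the extensions involves perturbations in transverse directions too. The
  direction \<open>N\<close> is harmless because the screen condition on \<open>B\<close> is
  Gamma(B,N,R) = 0, and modulo \<open>N\<close> every vector is tangent.\<close>

lemma II_flat_screen:
  assumes flat: "II_flat At g N R U" and V: "open V" "V \<subseteq> U" and B: "screen_section At g N R V B"
    and p: "p \<in> sing \<inter> V" and c: "c \<in> charts_at At p"
  shows "christoffel (G c) (snd c p) v (B c p) (R c p) = 0"
proof -
  have pU: "p \<in> sing \<inter> U"
    using p V(2) by blast
  have along: "smooth_along At g V B" and tan: "ddet g c p (B c p) = 0" and "second_ff At g N B R p = 0"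
    using B p c by (auto simp: screen_section_def tangent_to_sing_def)
  then have "christoffel (G c) (snd c p) (B c p) (N c p) (R c p) = 0"
    using second_ff_eq[OF V along p c tan] by simp
  then have N0: "christoffel (G c) (snd c p) (N c p) (B c p) (R c p) = 0"
    using christoffel_linear_at(3)[OF c, of "N c p"] by simp
  \<comment> \<open>The coefficient that makes \<open>v - a *\<^sub>R N c p\<close> tangent;
    transversality of \<open>N\<close> permits the division.\<close>
  define a where "a = ddet g c p v / ddet g c p (N c p)"
  have "ddet g c p (v - a *\<^sub>R N c p) = 0"
    using N_transverse[OF pU c] by (simp add: linear_diff[OF ddet_linear[OF c]] linear_cmul[OF ddet_linear[OF c]] a_def)
  from II_flat_tangent[OF flat pU c this tan] N0 show ?thesis
    by (simp add: linear_diff[OF christoffel_linear_at(1)[OF c]] linear_cmul[OF christoffel_linear_at(1)[OF c]])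
qed

lemma extension_difference:
  assumes W: "open W" and c: "c \<in> At" and Wc: "W \<subseteq> fst c"
    and ext: "extension At g W \<A> A" "extension At g W \<A>' A"
  obtains X where "smooth_on (snd c ` W) X" "\<And>q. q \<in> W \<Longrightarrow> \<A>' c q = \<A> c q + det (g c q) *\<^sub>R X (snd c q)"
proof -
  have WW: "fst c \<inter> W = W"
    using Wc by blast
  have op: "open (snd c ` W)"
    using open_chart_image[OF c W] unfolding WW .
  let ?f = "\<lambda>x. coord_rep c (\<A>' c) x - coord_rep c (\<A> c) x"
  have sm: "smooth_on (snd c ` W) ?f"
    using smooth_on_diff[OF op] smooth_vfield_coord[OF extension_smooth[OF ext(1)] c]
      smooth_vfield_coord[OF extension_smooth[OF ext(2)] c] unfolding WW by blast
  have eq: "?f (snd c q) = \<A>' c q - \<A> c q" if "q \<in> W" for q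
    using that Wc c by (auto simp: coord_rep_chart subset_iff)
  obtain X where X: "smooth_on (snd c ` W) X" "\<And>x. x \<in> snd c ` W \<Longrightarrow> ?f x = det (G c x) *\<^sub>R X x"
  proof (rule vector_division_chart[OF c W Wc sm])
    show "?f (snd c q) = 0" if q: "q \<in> sing \<inter> W" for q
      using extension_at[OF ext(1), of q c] extension_at[OF ext(2), of q c] eq[of q] q Wc charts_atI[OF c] by auto
  qed (use that in blast)
  show thesis
  proof (rule that[OF X(1)])
    show "\<A>' c q = \<A> c q + det (g c q) *\<^sub>R X (snd c q)" if "q \<in> W" for q
      using X(2)[of "snd c q"] eq[OF that] that Wc c by (auto simp: coord_rep_chart subset_iff algebra_simps)
  qed
qed

text \<open>In the change of the limit, dphi(A) Y vanishes since \<open>A\<close> is tangent, and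
  the adjugate term vanishes since both symbols have zero \<open>R\<close>-component: this is
  \<open>II_flat_screen\<close> applied to \<open>B\<close> and, by symmetry of the symbols, to
  \<open>A\<close>.\<close>

lemma conn_well_defined_of_II_flat:
  assumes flat: "II_flat At g N R U" and V: "open V" "V \<subseteq> U"
    and A: "screen_section At g N R V A" and B: "screen_section At g N R V B"
  shows "conn_well_defined At g D V A B"
  unfolding conn_well_defined_def
proof (intro conjI allI impI)
  fix W \<A> \<B>
  assume *: "open W \<and> W \<subseteq> V \<and> extension At g W \<A> A \<and> extension At g W \<B> B"
  show "good_limit At g W (D \<A> \<B>)"
    by (rule good_limit_of_II_flat[OF flat])
      (use * V A B tangent_extension in \<open>auto simp: screen_section_def intro: extension_smooth\<close>)
next
  fix W \<A> \<B> \<A>' \<B>' F F'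
  assume *: "open W \<and> W \<subseteq> V \<and> extension At g W \<A> A \<and> extension At g W \<B> B \<and>
    extension At g W \<A>' A \<and> extension At g W \<B>' B \<and>
    extends_over_sing At g W (D \<A> \<B>) F \<and> extends_over_sing At g W (D \<A>' \<B>') F'"
  show "vf_eq At (sing \<inter> W) F F'"
    unfolding vf_eq_def
  proof (intro ballI)
    fix p c assume p: "p \<in> sing \<inter> W" and c: "c \<in> charts_at At p"
    note c' = charts_atD[OF c]
    let ?W = "W \<inter> fst c"
    have W: "open ?W" "?W \<subseteq> U" "p \<in> sing \<inter> ?W" "?W \<subseteq> fst c" and pV: "p \<in> sing \<inter> V" and pU: "p \<in> sing \<inter> U"
      using * V p c' chart_homeomorphism(1)[OF c'(1)] by auto
    have ext: "extension At g ?W \<A> A" "extension At g ?W \<A>' A" "extension At g ?W \<B> B" "extension At g ?W \<B>' B"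
      using * extension_subset[of W _ _ ?W] by auto
    have F: "extends_over_sing At g ?W (D \<A> \<B>) F" "extends_over_sing At g ?W (D \<A>' \<B>') F'"
      using * smooth_vfield_subset[of W _ ?W] by (auto simp: extends_over_sing_def vf_eq_def)
    obtain X where X: "smooth_on (snd c ` ?W) X" "\<And>q. q \<in> ?W \<Longrightarrow> \<A>' c q = \<A> c q + det (g c q) *\<^sub>R X (snd c q)"
      using extension_difference[OF W(1) c'(1) W(4) ext(1,2)] by blast
    obtain Y where Y: "smooth_on (snd c ` ?W) Y" "\<And>q. q \<in> ?W \<Longrightarrow> \<B>' c q = \<B> c q + det (g c q) *\<^sub>R Y (snd c q)"
      using extension_difference[OF W(1) c'(1) W(4) ext(3,4)] by blast
    have at: "\<A> c p = A c p" "\<B> c p = B c p"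
      using extension_at[OF ext(1) _ _ c] extension_at[OF ext(3) _ _ c] W(3) by auto
    have tan: "ddet g c p (A c p) = 0"
      using A pV c by (auto simp: screen_section_def tangent_to_sing_def)
    have "(christoffel_vec (G c) (snd c p) (X (snd c p)) (B c p) +
        christoffel_vec (G c) (snd c p) (A c p) (Y (snd c p))) \<bullet> R c p = 0"
      using II_flat_screen[OF flat V B pV c, of "X (snd c p)"] II_flat_screen[OF flat V A pV c, of "Y (snd c p)"]
        christoffel_linear_at(3)[OF c, of "A c p" "Y (snd c p)"]
      by (simp add: inner_add_left christoffel_linear_at(4)[OF c])
    then show "F c p = F' c p"
      using levi_civita_perturbation[OF W(1-3) c W(4) ext(1,3,2,4)[THEN extension_smooth] X Y F] tan
      by (simp add: at adjugate_mult_eq_0_iff[OF pU c, THEN iffD2])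
  qed
qed

end

theorem proposition8:
  fixes At :: "('a::{t2_space, second_countable_topology}, 'n::finite) chart set"
    and g :: "('a, 'n) tensor02"
    and D :: "('a, 'n) vfield \<Rightarrow> ('a, 'n) vfield \<Rightarrow> ('a, 'n) vfield"
    and U :: "'a set"
    and N R :: "('a, 'n) vfield"
  assumes "transverse_singular_space At g"
    and "riemann_lorentz At g"
    and "tangent_radical At g"
    and "levi_civita At g D"
    and "open U" "U \<subseteq> carrier_of At"
    and "main_normal At g U N"
    and "main_radical At g U N R"
  shows
    "(\<forall>V \<A> \<B>. open V \<and> V \<subseteq> U \<and> smooth_vfield At V \<A> \<and> smooth_vfield At V \<B> \<longrightarrow>
        (good_limit At g V (D \<A> \<B>) \<longleftrightarrow> (\<forall>p\<in>sing_set At g \<inter> V. II At g R \<A> \<B> p = 0))) \<and>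
     ((\<forall>V \<A> \<B>. open V \<and> V \<subseteq> U \<and> smooth_vfield At V \<A> \<and> smooth_vfield At V \<B> \<and>
          tangent_to_sing At g V \<A> \<and> tangent_to_sing At g V \<B> \<longrightarrow>
          good_limit At g V (D \<A> \<B>))
        \<longleftrightarrow> II_flat At g N R U) \<and>
     (\<forall>V A B. open V \<and> V \<subseteq> U \<and> sing_set At g \<inter> V \<noteq> {} \<and>
        smooth_along At g V A \<and> smooth_along At g V B \<and>
        (\<exists>Z\<in>{A, B}. vf_eq At (sing_set At g \<inter> V) Z N \<or> vf_eq At (sing_set At g \<inter> V) Z R) \<longrightarrow>
        \<not> conn_well_defined At g D V A B) \<and>
     ((\<forall>V A B. open V \<and> V \<subseteq> U \<and> screen_section At g N R V A \<and> screen_section At g N R V B \<longrightarrow>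
          conn_well_defined At g D V A B)
        \<longleftrightarrow> II_flat At g N R U)"
proof -
  interpret main_frame_space At g D U N R
    using assms by unfold_locales (auto simp: transverse_singular_space_def)
  show ?thesis
  proof (intro conjI)
    show "\<forall>V \<A> \<B>. open V \<and> V \<subseteq> U \<and> smooth_vfield At V \<A> \<and> smooth_vfield At V \<B> \<longrightarrow>
        (good_limit At g V (D \<A> \<B>) \<longleftrightarrow> (\<forall>p\<in>sing \<inter> V. II At g R \<A> \<B> p = 0))"
      using good_limit_iff by blast
    show "(\<forall>V \<A> \<B>. open V \<and> V \<subseteq> U \<and> smooth_vfield At V \<A> \<and> smooth_vfield At V \<B> \<and>
          tangent_to_sing At g V \<A> \<and> tangent_to_sing At g V \<B> \<longrightarrow> good_limit At g V (D \<A> \<B>))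
        \<longleftrightarrow> II_flat At g N R U" (is "?good \<longleftrightarrow> _")
    proof
      assume good: ?good
      show "II_flat At g N R U"
      proof (rule II_flatI)
        fix V X Y W \<X> \<Y>
        assume "open V" "V \<subseteq> U" "screen_section At g N R V X" "screen_section At g N R V Y"
          and "open W" "W \<subseteq> V" and ext: "extension At g W \<X> X" "extension At g W \<Y> Y"
        \<comment> \<open>Tangency concerns values on the hypersurface, so it passes from a screen
          section to its extensions, and the assumption applies to them.\<close>
        then have "tangent_to_sing At g W \<X>" "tangent_to_sing At g W \<Y>" "W \<subseteq> U"
          using tangent_extension[OF ext(1)] tangent_extension[OF ext(2)] by (auto simp: screen_section_def)
        then show "good_limit At g W (D \<X> \<Y>)"
          using good \<open>open W\<close> ext[THEN extension_smooth] by blast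
      qed
    next
      assume "II_flat At g N R U"
      then show ?good
        using good_limit_of_II_flat by blast
    qed
    show "\<forall>V A B. open V \<and> V \<subseteq> U \<and> sing \<inter> V \<noteq> {} \<and>
        smooth_along At g V A \<and> smooth_along At g V B \<and>
        (\<exists>Z\<in>{A, B}. vf_eq At (sing \<inter> V) Z N \<or> vf_eq At (sing \<inter> V) Z R) \<longrightarrow>
        \<not> conn_well_defined At g D V A B"
      using not_conn_well_defined by blast
    show "(\<forall>V A B. open V \<and> V \<subseteq> U \<and> screen_section At g N R V A \<and> screen_section At g N R V B \<longrightarrow>
          conn_well_defined At g D V A B) \<longleftrightarrow> II_flat At g N R U" (is "?wd \<longleftrightarrow> _")
    proof
      assume wd: ?wd
      show "II_flat At g N R U"
      proof (rule II_flatI)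
        fix V X Y W \<X> \<Y>
        assume *: "open V" "V \<subseteq> U" "screen_section At g N R V X" "screen_section At g N R V Y"
          "open W" "W \<subseteq> V" "extension At g W \<X> X" "extension At g W \<Y> Y"
        then have "conn_well_defined At g D V X Y"
          using wd by blast
        \<comment> \<open>Supplied by the existence half of well-definedness.\<close>
        then show "good_limit At g W (D \<X> \<Y>)"
          using *(5-8) unfolding conn_well_defined_def by blast
      qed
    next
      assume "II_flat At g N R U"
      then show ?wd
        using conn_well_defined_of_II_flat by blast
    qed
  qed
qed

end
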